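(* Let $T[1..n]$ be a text over alphabet $[1..\sigma]$ whose $\Psi$ function has $r$ $\Psi$-runs, and let $s\ge 1$ be an integer parameter. For any constants $\epsilon,B>0$ there is an index (the $sr$-CSA$_0$) that uses $$r\cdot\big((2\log(n/r)+\log\sigma)(1+\epsilon)+O((\log n)/B)+O(1)\big)+\min(r,2\lceil n/(s+1)\rceil)\cdot 2\log n$$ bits of space and finds all the $occ$ occurrences of any pattern $P[1..m]$ in $T$ in time $O(m(\log r+B)+occ\,(s(\log r+B)+\log n))$.
   Context: $T[n]=\$$ is a unique terminator smaller than every other symbol. $SA$ is the suffix array of $T$, $SA^{-1}$ its inverse, and $\Psi(i)=SA^{-1}[(SA[i]\bmod n)+1]$. For each symbol $c$, $\Psi_c$ is the restriction of $\Psi$ to the interval of suffix-array positions whose suffixes start with $c$. A $\Psi$-run is a maximal interval of positions inside one such interval on which $\Psi$ takes consecutive increasing values; $r$ is the number of $\Psi$-runs. $B$ is the block size used in the representation of $\Psi$. Finding the occurrences means reporting all positions $q$ with $T[q..q+m-1]=P$. *)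

theory Defs
  imports Complex_Main "HOL-Library.List_Lexorder"
begin

section \<open>Texts, suffix arrays and \<open>\<Psi>\<close>-runs\<close>

text \<open>Texts and patterns are lists of symbols, which are natural numbers; text positions and
  suffix-array positions are 1-based. The order on lists is the lexicographic one
  (a proper prefix is smaller) from \<^theory>\<open>HOL-Library.List_Lexorder\<close>.\<close>

definition sym_at :: "nat list \<Rightarrow> nat \<Rightarrow> nat" where
  "sym_at T i = T ! (i - 1)"

definition terminated_text :: "nat \<Rightarrow> nat list \<Rightarrow> bool" where
  "terminated_text \<sigma> T \<longleftrightarrow>
     T \<noteq> [] \<and> set T \<subseteq> {1..\<sigma>} \<and> (\<forall>i\<in>{1..<length T}. sym_at T (length T) < sym_at T i)"

definition suffix_array :: "nat list \<Rightarrow> nat list" where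
  "suffix_array T = sort_key (\<lambda>i. drop (i - 1) T) [1..<length T + 1]"

definition SA :: "nat list \<Rightarrow> nat \<Rightarrow> nat" where
  "SA T i = suffix_array T ! (i - 1)"

definition SA_inv :: "nat list \<Rightarrow> nat \<Rightarrow> nat" where
  "SA_inv T = inv_into {1..length T} (SA T)"

definition Psi :: "nat list \<Rightarrow> nat \<Rightarrow> nat" where
  "Psi T i = SA_inv T (SA T i mod length T + 1)"

definition sym_interval :: "nat list \<Rightarrow> nat \<Rightarrow> nat set" where
  "sym_interval T c = {i \<in> {1..length T}. sym_at T (SA T i) = c}"

text \<open>The pair \<open>(a, b)\<close> stands for the nonempty interval \<open>{a..b}\<close>.\<close>

definition consecutive_interval :: "nat list \<Rightarrow> nat \<Rightarrow> nat \<Rightarrow> bool" where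
  "consecutive_interval T a b \<longleftrightarrow>
     a \<le> b \<and> (\<exists>c. {a..b} \<subseteq> sym_interval T c) \<and> (\<forall>j\<in>{a..<b}. Psi T (j + 1) = Psi T j + 1)"

definition Psi_runs :: "nat list \<Rightarrow> (nat \<times> nat) set" where
  "Psi_runs T = {(a, b). consecutive_interval T a b \<and>
     (\<forall>a' b'. consecutive_interval T a' b' \<and> {a..b} \<subseteq> {a'..b'} \<longrightarrow> {a'..b'} = {a..b})}"

definition occurrences :: "nat list \<Rightarrow> nat list \<Rightarrow> nat set" where
  "occurrences T P = {q. 1 \<le> q \<and> q + length P \<le> length T + 1 \<and>
     (\<forall>k<length P. sym_at T (q + k) = P ! k)}"


section \<open>Word RAM\<close>

text \<open>All operations act on words of \<open>w\<close> bits, that is, on naturals below \<open>2 ^ w\<close>, and take unit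
  time. The index and the pattern are read-only; the working memory is separate.\<close>

datatype alu_op = Add | Sub | Mul | Div | Mod | And | Or | Xor | Shl | Shr | Less | Equal

fun alu :: "nat \<Rightarrow> alu_op \<Rightarrow> nat \<Rightarrow> nat \<Rightarrow> nat" where
  "alu w Add x y = (x + y) mod 2 ^ w"
| "alu w Sub x y = nat ((int x - int y) mod 2 ^ w)"
| "alu w Mul x y = (x * y) mod 2 ^ w"
| "alu w Div x y = x div y"
| "alu w Mod x y = x mod y"
| "alu w And x y = and x y"
| "alu w Or x y = or x y"
| "alu w Xor x y = xor x y"
| "alu w Shl x y = (x * 2 ^ y) mod 2 ^ w"
| "alu w Shr x y = x div 2 ^ y"
| "alu w Less x y = of_bool (x < y)"
| "alu w Equal x y = of_bool (x = y)"

datatype instr =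
    Literal nat nat
  | Compute alu_op nat nat nat
  | Load nat nat
  | Store nat nat
  | Read_Index nat nat
  | Read_Pattern nat nat
  | Emit nat
  | Jump_Zero nat nat

text \<open>A configuration consists of the program counter, the working memory and the words emitted so
  far.\<close>

type_synonym config = "nat \<times> (nat \<Rightarrow> nat) \<times> nat list"

text \<open>The index is a bit string, packed into words of \<open>w\<close> bits, least significant bit first.\<close>

definition index_word :: "nat \<Rightarrow> bool list \<Rightarrow> nat \<Rightarrow> nat" where
  "index_word w D i = horner_sum of_bool 2 (take w (drop (i * w) D))"

text \<open>Symbols are positive, so reading \<open>0\<close> signals the end of the pattern.\<close>

definition pattern_word :: "nat list \<Rightarrow> nat \<Rightarrow> nat" where
  "pattern_word P i = (if i < length P then P ! i else 0)"

fun exec_instr :: "nat \<Rightarrow> bool list \<Rightarrow> nat list \<Rightarrow> instr \<Rightarrow> config \<Rightarrow> config" where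
  "exec_instr w D P (Literal d k) (pc, M, out) = (pc + 1, M(d := k mod 2 ^ w), out)"
| "exec_instr w D P (Compute f d a b) (pc, M, out) = (pc + 1, M(d := alu w f (M a) (M b)), out)"
| "exec_instr w D P (Load d a) (pc, M, out) = (pc + 1, M(d := M (M a)), out)"
| "exec_instr w D P (Store d a) (pc, M, out) = (pc + 1, M(M d := M a), out)"
| "exec_instr w D P (Read_Index d a) (pc, M, out) = (pc + 1, M(d := index_word w D (M a)), out)"
| "exec_instr w D P (Read_Pattern d a) (pc, M, out) = (pc + 1, M(d := pattern_word P (M a)), out)"
| "exec_instr w D P (Emit a) (pc, M, out) = (pc + 1, M, out @ [M a])"
| "exec_instr w D P (Jump_Zero a l) (pc, M, out) = (if M a = 0 then l else pc + 1, M, out)"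

definition halted :: "instr list \<Rightarrow> config \<Rightarrow> bool" where
  "halted prog cfg \<longleftrightarrow> length prog \<le> fst cfg"

definition step :: "instr list \<Rightarrow> nat \<Rightarrow> bool list \<Rightarrow> nat list \<Rightarrow> config \<Rightarrow> config" where
  "step prog w D P cfg =
     (if halted prog cfg then cfg else exec_instr w D P (prog ! fst cfg) cfg)"

text \<open>The word size is available to the program in memory cell \<open>0\<close>; everything else it needs to
  know about the text, including its length, has to be part of the index.\<close>

definition init_config :: "nat \<Rightarrow> config" where
  "init_config w = (0, (\<lambda>_. 0)(0 := w), [])"

definition run :: "instr list \<Rightarrow> nat \<Rightarrow> bool list \<Rightarrow> nat list \<Rightarrow> nat \<Rightarrow> config" where
  "run prog w D P t = (step prog w D P ^^ t) (init_config w)"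

text \<open>Every occurrence is reported exactly once, in any order.\<close>

definition finds_occurrences ::
    "instr list \<Rightarrow> nat \<Rightarrow> bool list \<Rightarrow> nat list \<Rightarrow> nat list \<Rightarrow> real \<Rightarrow> bool" where
  "finds_occurrences prog w D T P time \<longleftrightarrow>
     (\<exists>t pc M out. real t \<le> time \<and> run prog w D P t = (pc, M, out) \<and> halted prog (pc, M, out) \<and>
        distinct out \<and> set out = occurrences T P)"

end

theory Submission
  imports Defs
begin

text \<open>Writing \<open>N\<close> for a power of two above \<open>n + 1\<close>, the map \<open>V i = c * N + \<Psi> i\<close>, where \<open>c\<close> is the first
  symbol of the \<open>i\<close>-th suffix, is increasing on all suffix-array positions and has the same runs as
  \<open>\<Psi>\<close>. So the index stores one sorted table of runs, each as a gap in \<open>V\<close> and a length, with absolute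
  values once per block. By concavity of the logarithm the gaps cost \<open>log (n \<sigma> / r)\<close> and the lengths
  \<open>log (n / r)\<close> bits per run, up to a factor \<open>1 + \<epsilon>\<close>. A backward search step for \<open>c\<close> maps a range
  \<open>[lo, hi)\<close> to the ranks of \<open>c * N + lo\<close> and \<open>c * N + hi\<close> under \<open>V\<close>: binary search over the blocks, then
  a scan of one block.

  Locating uses \<open>min r \<lceil>n / (s + 1)\<rceil>\<close> samples. If there are fewer than \<open>r\<close>, they are the text positions at
  distance a multiple of \<open>s + 1\<close> from the end, and \<open>\<Psi>\<close> reaches one of them in at most \<open>s\<close> steps.
  Otherwise they are the run ends: the search maintains the suffix-array entry at \<open>lo\<close>, and from an
  entry the next one is found through the first following run end in the text. Either way the sampled keys
  are stored as further records of the same table at \<open>log (n / r)\<close> bits, and with a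
  permutation entry of \<open>log r\<close> bits and a text position of \<open>log n\<close> bits this makes \<open>2 log n\<close> per sample.\<close>

section \<open>Structured programs\<close>

datatype com =
    Code "instr list"
  | Seq com com (infixr \<open>;;\<close> 60)
  | When nat com
  | Rep com nat

fun comp_len :: "com \<Rightarrow> nat" where
  "comp_len (Code is) = length is"
| "comp_len (c ;; d) = comp_len c + comp_len d"
| "comp_len (When a c) = Suc (comp_len c)"
| "comp_len (Rep c a) = Suc (comp_len c)"

fun compile :: "nat \<Rightarrow> com \<Rightarrow> instr list" where
  "compile l (Code is) = is"
| "compile l (c ;; d) = compile l c @ compile (l + comp_len c) d"
| "compile l (When a c) = Jump_Zero a (l + Suc (comp_len c)) # compile (Suc l) c"
| "compile l (Rep c a) = compile l c @ [Jump_Zero a l]"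

lemma length_compile [simp]: "length (compile l c) = comp_len c"
  by (induction c arbitrary: l) auto

fun jump_free :: "instr \<Rightarrow> bool" where
  "jump_free (Jump_Zero a l) = False"
| "jump_free _ = True"

fun well_formed :: "com \<Rightarrow> bool" where
  "well_formed (Code is) = list_all jump_free is"
| "well_formed (c ;; d) = (well_formed c \<and> well_formed d)"
| "well_formed (When a c) = well_formed c"
| "well_formed (Rep c a) = well_formed c"

type_synonym state = "(nat \<Rightarrow> nat) \<times> nat list"

locale word_ram =
  fixes w :: nat and D :: "bool list" and P :: "nat list"
begin

definition ex :: "instr \<Rightarrow> state \<Rightarrow> state" where
  "ex i s = snd (exec_instr w D P i (0, s))"

lemma ex_simps [simp]:
  "ex (Literal d k) (M, out) = (M(d := k mod 2 ^ w), out)"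
  "ex (Compute f d a b) (M, out) = (M(d := alu w f (M a) (M b)), out)"
  "ex (Read_Index d a) (M, out) = (M(d := index_word w D (M a)), out)"
  "ex (Read_Pattern d a) (M, out) = (M(d := pattern_word P (M a)), out)"
  "ex (Emit a) (M, out) = (M, out @ [M a])"
  by (simp_all add: ex_def)

lemma exec_jump_free:
  "jump_free i \<Longrightarrow> exec_instr w D P i (pc, s) = (Suc pc, ex i s)"
  by (cases i; cases s) (auto simp: ex_def)

inductive big :: "com \<Rightarrow> state \<Rightarrow> nat \<Rightarrow> state \<Rightarrow> bool" where
  big_Code: "big (Code is) s (length is) (fold ex is s)"
| big_Seq: "big c s t s' \<Longrightarrow> big d s' t' s'' \<Longrightarrow> big (c ;; d) s (t + t') s''"
| big_When_skip: "fst s a = 0 \<Longrightarrow> big (When a c) s 1 s"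
| big_When: "fst s a \<noteq> 0 \<Longrightarrow> big c s t s' \<Longrightarrow> big (When a c) s (Suc t) s'"
| big_Rep_exit: "big c s t s' \<Longrightarrow> fst s' a \<noteq> 0 \<Longrightarrow> big (Rep c a) s (Suc t) s'"
| big_Rep_again: "big c s t s' \<Longrightarrow> fst s' a = 0 \<Longrightarrow> big (Rep c a) s' t' s'' \<Longrightarrow>
    big (Rep c a) s (Suc t + t') s''"

definition code_at :: "instr list \<Rightarrow> nat \<Rightarrow> instr list \<Rightarrow> bool" where
  "code_at prog l is \<longleftrightarrow> (\<forall>k<length is. l + k < length prog \<and> prog ! (l + k) = is ! k)"

lemma code_at_append:
  "code_at prog l (is @ js) \<longleftrightarrow> code_at prog l is \<and> code_at prog (l + length is) js"
proof
  assume a: "code_at prog l (is @ js)"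
  have "l + length is + k < length prog \<and> prog ! (l + length is + k) = js ! k" if "k < length js" for k
    using a that unfolding code_at_def
    by (auto dest!: spec[of _ "length is + k"] simp: nth_append add.assoc)
  moreover have "code_at prog l is"
    using a unfolding code_at_def by (auto simp: nth_append)
  ultimately show "code_at prog l is \<and> code_at prog (l + length is) js"
    by (simp add: code_at_def)
next
  assume a: "code_at prog l is \<and> code_at prog (l + length is) js"
  show "code_at prog l (is @ js)"
    unfolding code_at_def
  proof (intro allI impI)
    fix k assume k: "k < length (is @ js)"
    show "l + k < length prog \<and> prog ! (l + k) = (is @ js) ! k"
    proof (cases "k < length is")
      case True then show ?thesis using a by (simp add: code_at_def nth_append)
    next
      case False
      then show ?thesis using a k
        unfolding code_at_def by (auto dest!: spec[of _ "k - length is"] simp: nth_append)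
    qed
  qed
qed

lemma code_at_Cons:
  "code_at prog l (i # js) \<longleftrightarrow> l < length prog \<and> prog ! l = i \<and> code_at prog (Suc l) js"
  using code_at_append[of prog l "[i]" js] by (simp add: code_at_def)

lemma funpow_step_add:
  "(step prog w D P ^^ t) c = c' \<Longrightarrow> (step prog w D P ^^ t') c' = c'' \<Longrightarrow>
   (step prog w D P ^^ (t + t')) c = c''"
  by (simp add: add.commute[of t] funpow_add)

lemma step_at:
  "pc < length prog \<Longrightarrow> step prog w D P (pc, s) = exec_instr w D P (prog ! pc) (pc, s)"
  by (simp add: step_def halted_def)

lemma steps_Code:
  "code_at prog l is \<Longrightarrow> list_all jump_free is \<Longrightarrow>
   (step prog w D P ^^ length is) (l, s) = (l + length is, fold ex is s)"
  by (induction "is" arbitrary: l s)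
    (simp_all add: code_at_Cons step_at exec_jump_free funpow_swap1)

lemma compile_correct:
  "big c s t s' \<Longrightarrow> well_formed c \<Longrightarrow> code_at prog l (compile l c) \<Longrightarrow>
   (step prog w D P ^^ t) (l, s) = (l + comp_len c, s')"
proof (induction arbitrary: l rule: big.induct)
  case (big_Code "is" s)
  then show ?case by (simp add: steps_Code)
next
  case (big_Seq c s t s' d t' s'')
  then have "(step prog w D P ^^ t) (l, s) = (l + comp_len c, s')"
    "(step prog w D P ^^ t') (l + comp_len c, s') = (l + comp_len c + comp_len d, s'')"
    by (simp_all add: code_at_append)
  then show ?case by (auto simp: add.assoc dest: funpow_step_add)
next
  case (big_When_skip s a c)
  then show ?case by (cases s) (simp add: code_at_Cons step_at)
next
  case (big_When s a c t s')
  have "(step prog w D P ^^ 1) (l, s) = (Suc l, s)"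
    using big_When by (cases s) (simp add: code_at_Cons step_at)
  with big_When funpow_step_add[of 1 prog "(l, s)" "(Suc l, s)" t] show ?case
    by (simp add: code_at_Cons)
next
  case (big_Rep_exit c s t s' a)
  have "(step prog w D P ^^ 1) (l + comp_len c, s') = (Suc (l + comp_len c), s')"
    using big_Rep_exit by (cases s') (simp add: code_at_append code_at_Cons step_at)
  with big_Rep_exit funpow_step_add[of t prog "(l, s)" "(l + comp_len c, s')" 1]
  show ?case by (simp add: code_at_append)
next
  case (big_Rep_again c s t s' a t' s'')
  have "(step prog w D P ^^ 1) (l + comp_len c, s') = (l, s')"
    using big_Rep_again by (cases s') (simp add: code_at_append code_at_Cons step_at)
  with big_Rep_again funpow_step_add[of t prog "(l, s)" "(l + comp_len c, s')" 1]
  have "(step prog w D P ^^ Suc t) (l, s) = (l, s')" by (simp add: code_at_append)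
  with big_Rep_again funpow_step_add[of "Suc t" prog "(l, s)" "(l, s')" t'] show ?case by simp
qed

definition ok :: "com \<Rightarrow> (nat \<Rightarrow> state \<Rightarrow> bool) \<Rightarrow> state \<Rightarrow> bool" where
  "ok c Q s \<longleftrightarrow> (\<exists>t s'. big c s t s' \<and> Q t s')"

lemma ok_Code: "Q (length is) (fold ex is s) \<Longrightarrow> ok (Code is) Q s"
  unfolding ok_def by (blast intro: big_Code)

lemma ok_Seq: "ok c (\<lambda>t s'. ok d (\<lambda>t'. Q (t + t')) s') s \<Longrightarrow> ok (c ;; d) Q s"
  unfolding ok_def by (blast intro: big_Seq)

lemma ok_When:
  "(fst s a = 0 \<Longrightarrow> Q 1 s) \<Longrightarrow> (fst s a \<noteq> 0 \<Longrightarrow> ok c (\<lambda>t. Q (Suc t)) s) \<Longrightarrow> ok (When a c) Q s"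
  unfolding ok_def by (cases "fst s a = 0") (blast intro: big_When_skip big_When)+

lemma ok_mono: "ok c Q s \<Longrightarrow> (\<And>t s'. Q t s' \<Longrightarrow> Q' t s') \<Longrightarrow> ok c Q' s"
  unfolding ok_def by blast

lemma ok_Rep:
  assumes "I k s"
    and "\<And>k s. I k s \<Longrightarrow>
      ok c (\<lambda>t s'. t \<le> b \<and> (if fst s' a = 0 then k > 0 \<and> I (k - 1) s' else Q s')) s"
  shows "ok (Rep c a) (\<lambda>t s'. t \<le> (k + 1) * (b + 1) \<and> Q s') s"
  using assms(1)
proof (induction k arbitrary: s)
  case 0
  from assms(2)[OF 0] obtain t s' where "big c s t s'" "t \<le> b" "fst s' a \<noteq> 0" "Q s'"
    unfolding ok_def by (auto split: if_splits)
  then show ?case unfolding ok_def 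
    by (intro exI[of _ "Suc t"] exI[of _ s']) (auto intro: big_Rep_exit)
next
  case (Suc k)
  from assms(2)[OF Suc.prems] obtain t s' where
    b: "big c s t s'" "t \<le> b" "if fst s' a = 0 then I k s' else Q s'"
    unfolding ok_def by (auto split: if_splits)
  show ?case
  proof (cases "fst s' a = 0")
    case True
    with b Suc.IH[of s'] obtain t' s'' where
      "big (Rep c a) s' t' s''" "t' \<le> (k + 1) * (b + 1)" "Q s''"
      unfolding ok_def by auto
    moreover from this have "big (Rep c a) s (Suc t + t') s''" using b True big_Rep_again by blast
    ultimately show ?thesis unfolding ok_def using b(2)
      by (intro exI[of _ "Suc t + t'"] exI[of _ s'']) auto
  next
    case False
    with b show ?thesis unfolding ok_def
      by (intro exI[of _ "Suc t"] exI[of _ s']) (auto intro: big_Rep_exit)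
  qed
qed

lemma ok_finds_occurrences:
  assumes "ok c (\<lambda>t s'. real t \<le> time \<and> distinct (snd s') \<and> set (snd s') = occurrences T P)
             ((\<lambda>_. 0)(0 := w), [])"
    and "well_formed c"
  shows "finds_occurrences (compile 0 c) w D T P time"
proof -
  from assms(1) obtain t M out where b: "big c ((\<lambda>_. 0)(0 := w), []) t (M, out)"
    "real t \<le> time" "distinct out" "set out = occurrences T P"
    unfolding ok_def by auto
  have "code_at (compile 0 c) 0 (compile 0 c)" by (simp add: code_at_def)
  from compile_correct[OF b(1) assms(2) this]
  have "run (compile 0 c) w D P t = (comp_len c, M, out)"
    by (simp add: run_def init_config_def)
  with b show ?thesis unfolding finds_occurrences_def halted_def
    by (intro exI[of _ t] exI[of _ "comp_len c"] exI[of _ M] exI[of _ out]) simp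
qed

end

section \<open>A code that is decoded in constant time\<close>

abbreviation nat_of_bits :: "bool list \<Rightarrow> nat" where
  "nat_of_bits bs \<equiv> horner_sum of_bool 2 bs"

lemma nat_of_bits_append:
  "nat_of_bits (xs @ ys) = nat_of_bits xs + 2 ^ length xs * nat_of_bits ys"
  by (induction xs) (simp_all add: algebra_simps)

lemma nat_of_bits_less: "nat_of_bits xs < 2 ^ length xs"
  by (induction xs) auto

lemma nat_of_bits_take: "nat_of_bits (take k xs) = nat_of_bits xs mod 2 ^ k"
  and nat_of_bits_drop: "nat_of_bits (drop k xs) = nat_of_bits xs div 2 ^ k"
proof -
  have "nat_of_bits (take k xs) = nat_of_bits xs mod 2 ^ k \<and>
    nat_of_bits (drop k xs) = nat_of_bits xs div 2 ^ k"
  proof (cases "k \<le> length xs")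
    case True
    have "nat_of_bits xs = nat_of_bits (take k xs) + 2 ^ k * nat_of_bits (drop k xs)"
      using nat_of_bits_append[of "take k xs" "drop k xs"] True by simp
    moreover have "nat_of_bits (take k xs) < 2 ^ k"
      using nat_of_bits_less[of "take k xs"] True by simp
    ultimately show ?thesis by simp
  next
    case False
    have "nat_of_bits xs < 2 ^ k"
      using nat_of_bits_less[of xs] False
      by (meson less_le_trans linorder_le_cases one_le_numeral power_increasing)
    with False show ?thesis by simp
  qed
  then show "nat_of_bits (take k xs) = nat_of_bits xs mod 2 ^ k"
    "nat_of_bits (drop k xs) = nat_of_bits xs div 2 ^ k" by auto
qed

definition fixed_code :: "nat \<Rightarrow> nat \<Rightarrow> bool list" where
  "fixed_code l x = map (bit x) [0..<l]"

lemma length_fixed_code [simp]: "length (fixed_code l x) = l"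
  by (simp add: fixed_code_def)

lemma nat_of_fixed_code: "x < 2 ^ l \<Longrightarrow> nat_of_bits (fixed_code l x) = x"
  by (simp add: fixed_code_def horner_sum_bit_eq_take_bit take_bit_nat_eq_self)

definition chunks :: "nat \<Rightarrow> nat \<Rightarrow> nat" where
  "chunks K x = (LEAST u. x < 2 ^ (K * u))"

text \<open>The chunk count is given in unary, followed by the number in chunks of \<open>K\<close> bits. This costs
  only a factor \<open>1 + 1 / K\<close> over the binary representation, and the decoder, which isolates the
  lowest set bit \<open>2 ^ u\<close>, finds the payload and the end of the code by multiplications and divisions
  by powers of \<open>2 ^ u\<close>, hence in time independent of \<open>u\<close>.\<close>

definition chunk_code :: "nat \<Rightarrow> nat \<Rightarrow> bool list" where
  "chunk_code K x = replicate (chunks K x) False @ True # fixed_code (K * chunks K x) x"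

lemma chunks_bound: "K > 0 \<Longrightarrow> x < 2 ^ (K * chunks K x)"
  unfolding chunks_def
proof (rule LeastI)
  assume "K > 0"
  have "x < 2 ^ x" by (rule less_exp)
  also have "\<dots> \<le> (2::nat) ^ (K * x)" using \<open>K > 0\<close> by (intro power_increasing) auto
  finally show "x < 2 ^ (K * x)" .
qed

lemma length_chunk_code: "length (chunk_code K x) = (K + 1) * chunks K x + 1"
  by (simp add: chunk_code_def)

lemma nat_of_bits_replicate: "nat_of_bits (replicate u False @ bs) = 2 ^ u * nat_of_bits bs"
  by (induction u) auto

lemma nat_of_chunk_code:
  assumes "K > 0"
  shows "nat_of_bits (chunk_code K x) = 2 ^ chunks K x * (1 + 2 * x)"
  using chunks_bound[OF assms, of x]
  by (simp add: chunk_code_def nat_of_bits_replicate nat_of_fixed_code)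

lemma and_minus_one: "and (2 ^ u * (1 + 2 * z)) (2 ^ u * (1 + 2 * z) - 1) = 2 ^ u * (2 * z :: nat)"
proof (induction u)
  case 0
  show ?case by (subst and_rec) simp
next
  case (Suc u)
  define y where "y = 2 ^ u * (1 + 2 * z)"
  have "y > 0" by (simp add: y_def)
  then have "(2 * y - 1) div 2 = y - 1" by linarith
  then have "and (2 * y) (2 * y - 1) = 2 * and y (y - 1)" by (subst and_rec) simp
  with Suc show ?case by (simp add: y_def mult.assoc)
qed

lemma add_mult_power_mod:
  fixes a r :: nat
  assumes "a < 2 ^ l" "l \<le> w"
  shows "(a + 2 ^ l * r) mod 2 ^ w = a + 2 ^ l * (r mod 2 ^ (w - l))"
proof -
  have "(2::nat) ^ w = 2 ^ l * 2 ^ (w - l)" using assms(2) by (simp flip: power_add)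
  then show ?thesis using assms(1) by (simp add: mod_mult2_eq)
qed

definition peek_code :: "instr list" where
  "peek_code = [Read_Index 12 10, Compute Div 12 12 11, Compute Add 13 10 1, Read_Index 13 13,
     Compute Div 14 2 11, Compute Add 14 14 14, Compute Mul 13 13 14, Compute Add 12 12 13]"

definition advance_code :: "instr list" where
  "advance_code = [Compute Div 18 2 17, Compute Add 18 18 18, Compute Div 18 11 18,
     Compute Mul 11 11 17, Compute Equal 19 11 3, Compute Add 10 10 19, Compute Add 11 11 18]"

definition decode_code :: "nat \<Rightarrow> instr list" where
  "decode_code K = peek_code @
     [Compute Sub 13 12 1, Compute And 13 12 13, Compute Sub 13 12 13, Compute Add 14 1 3] @
     replicate K (Compute Mul 14 14 13) @
     [Compute Add 15 13 13, Compute Div 16 12 15, Compute Mod 16 16 14, Compute Mul 17 14 15] @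
     advance_code"

lemma length_decode_code: "length (decode_code K) = K + 23"
  by (simp add: decode_code_def peek_code_def advance_code_def)

lemma jump_free_codes [simp]:
  "list_all jump_free peek_code" "list_all jump_free advance_code"
  "list_all jump_free (decode_code K)"
  by (simp_all add: decode_code_def peek_code_def advance_code_def list_all_iff)

lemma sub_word:
  fixes a b :: nat
  assumes "b \<le> a" "a < 2 ^ w" shows "nat ((int a - int b) mod 2 ^ w) = a - b"
proof -
  have "(int a - int b) mod 2 ^ w = int a - int b"
    using assms by (intro mod_pos_pos_trivial) (auto simp flip: of_nat_diff of_nat_power)
  then show ?thesis using assms by simp
qed

lemma alu_add: "a + b < 2 ^ w \<Longrightarrow> alu w Add a b = a + b"
  and alu_sub: "b \<le> a \<Longrightarrow> a < 2 ^ w \<Longrightarrow> alu w Sub a b = a - b"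
  and alu_mul: "a * b < 2 ^ w \<Longrightarrow> alu w Mul a b = a * b"
  by (simp_all add: sub_word)

context word_ram
begin

definition base_regs :: "(nat \<Rightarrow> nat) \<Rightarrow> bool" where
  "base_regs M \<longleftrightarrow> M 0 = w \<and> M 1 = 1 \<and> M 2 = 2 ^ (w - 1) \<and> M 3 = 0"

text \<open>Bit position \<open>p\<close> of the index is held as a word number and a power of two, because the decoder
  knows the length of a code only as a power of two and cannot take logarithms.\<close>

definition at_pos :: "(nat \<Rightarrow> nat) \<Rightarrow> nat \<Rightarrow> bool" where
  "at_pos M p \<longleftrightarrow> M 10 = p div w \<and> M 11 = 2 ^ (p mod w)"

definition bits_from :: "nat \<Rightarrow> nat" where
  "bits_from p = nat_of_bits (drop p D)"

lemma index_word_eq: "index_word w D i = bits_from (i * w) mod 2 ^ w"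
  by (simp add: index_word_def bits_from_def nat_of_bits_take)

lemma bits_from_add: "bits_from (p + k) = bits_from p div 2 ^ k"
  by (simp add: bits_from_def nat_of_bits_drop power_add div_mult2_eq)

lemma bits_from_append:
  "drop p D = bs @ rest \<Longrightarrow> bits_from p = nat_of_bits bs + 2 ^ length bs * nat_of_bits rest"
  by (simp add: bits_from_def nat_of_bits_append)

lemma double_half_power:
  assumes "k < w"
  shows "(2 ^ (w - 1) div 2 ^ k + 2 ^ (w - 1) div 2 ^ k) mod 2 ^ w = (2 ^ (w - k) :: nat) mod 2 ^ w"
proof -
  have "(2::nat) ^ (w - 1) = 2 ^ k * 2 ^ (w - 1 - k)" using assms by (simp flip: power_add)
  then have "(2::nat) ^ (w - 1) div 2 ^ k = 2 ^ (w - 1 - k)" by simp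
  moreover have "w - k = Suc (w - 1 - k)" using assms by linarith
  ultimately show ?thesis by (simp add: mult_2)
qed

lemma peek:
  assumes "base_regs M" "at_pos M p" "p < 2 ^ w - 1" "w > 0"
  shows "\<exists>M'. fold ex peek_code (M, out) = (M', out) \<and> M' 12 = bits_from p mod 2 ^ w \<and>
    (\<forall>a. a \<notin> {12, 13, 14} \<longrightarrow> M' a = M a)"
proof -
  define q t Y where "q = p div w" and "t = p mod w" and "Y = bits_from (q * w)"
  have t: "t < w" using assms by (simp add: t_def)
  have p: "p = q * w + t" by (simp add: q_def t_def)
  have q1: "Suc q < 2 ^ w"
  proof -
    have "q \<le> p" by (simp add: q_def)
    then show ?thesis using assms(3) by linarith
  qed
  have w': "(2::nat) ^ w = 2 ^ t * 2 ^ (w - t)" using t by (simp flip: power_add)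
  have "Y = Y mod 2 ^ w + 2 ^ t * (2 ^ (w - t) * (Y div 2 ^ w))"
    using w' by (simp flip: mult.assoc)
  then have "Y div 2 ^ t = (Y mod 2 ^ w + 2 ^ t * (2 ^ (w - t) * (Y div 2 ^ w))) div 2 ^ t"
    by simp
  then have Y: "Y div 2 ^ t = Y mod 2 ^ w div 2 ^ t + 2 ^ (w - t) * (Y div 2 ^ w)"
    by simp
  have next_word: "index_word w D (Suc q) = Y div 2 ^ w mod 2 ^ w"
    using bits_from_add[of "q * w" w] by (simp add: index_word_eq Y_def add.commute)
  have "(Y mod 2 ^ w div 2 ^ t + (Y div 2 ^ w mod 2 ^ w) * (2 ^ (w - t) mod 2 ^ w) mod 2 ^ w) mod 2 ^ w
    = Y div 2 ^ t mod 2 ^ w"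
    unfolding Y by (simp add: mod_simps mult.commute)
  also have "\<dots> = bits_from p mod 2 ^ w" by (simp add: p bits_from_add Y_def)
  finally show ?thesis
    using assms(1,2) q1 double_half_power[OF t] next_word
    by (simp add: peek_code_def base_regs_def at_pos_def index_word_eq[of q] Y_def
        flip: q_def t_def)
qed

lemma advance:
  assumes "base_regs M" "at_pos M p" "M 17 = 2 ^ k" "k < w" "p + k < 2 ^ w"
  shows "\<exists>M'. fold ex advance_code (M, out) = (M', out) \<and> at_pos M' (p + k) \<and>
    (\<forall>a. a \<notin> {10, 11, 18, 19} \<longrightarrow> M' a = M a)"
proof -
  define q t where "q = p div w" and "t = p mod w"
  have w: "w > 0" using assms(4) by simp
  then have t: "t < w" by (simp add: t_def)
  have p: "p = q * w + t" by (simp add: q_def t_def)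
  have M: "M 10 = q" "M 11 = 2 ^ t" using assms(2) by (simp_all add: at_pos_def q_def t_def)
  have ql: "(p + k) div w < 2 ^ w"
    using assms(5) by (meson div_le_dividend le_less_trans)
  show ?thesis
  proof (cases "t + k < w")
    case True
    have e: "(p + k) div w = q" "(p + k) mod w = t + k"
      using True w by (simp_all add: p add.assoc)
    have "(2::nat) ^ t < 2 ^ (w - k)" using True by (intro power_strict_increasing) auto
    then have "(2::nat) ^ t div (2 ^ (w - k) mod 2 ^ w) = 0"
      using assms(4) by (cases "k = 0") (simp_all)
    moreover have "(2::nat) ^ t * 2 ^ k mod 2 ^ w = 2 ^ (t + k)"
      using True by (simp add: power_add[symmetric])
    moreover have "(2::nat) ^ (t + k) mod 2 ^ w = 2 ^ (t + k)" using True by simp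
    ultimately show ?thesis
      using assms(1,3,4) M double_half_power[OF assms(4)] e ql
      by (simp add: advance_code_def base_regs_def at_pos_def)
  next
    case False
    have k: "k > 0" using False t by simp
    have "p + k = Suc q * w + (t + k - w)" using False by (simp add: p)
    moreover have "t + k - w < w" using t assms(4) by linarith
    ultimately have e: "(p + k) div w = Suc q" "(p + k) mod w = t + k - w"
      using w by (simp_all only: div_mult_self3 div_less mod_mult_self3 mod_less)
    have "(2::nat) ^ (w - k) mod 2 ^ w = 2 ^ (w - k)" using k w by simp
    moreover have "(2::nat) ^ t div 2 ^ (w - k) = 2 ^ (t + k - w)"
      using False assms(4) by (simp flip: power_diff)
    moreover have "(2::nat) ^ t * 2 ^ k mod 2 ^ w = 0"
      using False by (simp add: le_imp_power_dvd flip: power_add)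
    moreover have "(2::nat) ^ (t + k - w) mod 2 ^ w = 2 ^ (t + k - w)"
      using t assms(4) by simp
    ultimately show ?thesis
      using assms(1,3,4) M double_half_power[OF assms(4)] e ql
      by (simp add: advance_code_def base_regs_def at_pos_def)
  qed
qed

lemma fold_replicate_Mul:
  "M 14 < 2 ^ w \<Longrightarrow> fold ex (replicate K (Compute Mul 14 14 13)) (M, out) =
   (M(14 := M 14 * M 13 ^ K mod 2 ^ w), out)"
  by (induction K arbitrary: M) (simp_all add: mod_simps mult_ac)

lemma decode:
  assumes M: "base_regs M" "at_pos M p"
    and D: "drop p D = chunk_code K x @ rest" "length D < 2 ^ w - 1"
    and K: "K > 0" "length (chunk_code K x) < w"
  shows "\<exists>M'. fold ex (decode_code K) (M, out) = (M', out) \<and> M' 16 = x \<and>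
    at_pos M' (p + length (chunk_code K x)) \<and> (\<forall>a. a < 10 \<or> a \<ge> 20 \<longrightarrow> M' a = M a)"
proof -
  define u l where "u = chunks K x" and "l = length (chunk_code K x)"
  have l: "l = Suc u + K * u" by (simp add: l_def u_def length_chunk_code)
  have lw: "l < w" using K l_def by simp
  have "length (drop p D) = l + length rest" using D(1) by (simp add: l_def)
  then have pl: "p + l \<le> length D" using l by simp
  obtain z where z: "bits_from p mod 2 ^ w = 2 ^ u * (1 + 2 * z)" "z mod 2 ^ (K * u) = x"
  proof -
    have x: "x < 2 ^ (K * u)" using chunks_bound[OF K(1)] by (simp add: u_def)
    define R where "R = nat_of_bits rest mod 2 ^ (w - l)"
    have "nat_of_bits (chunk_code K x) < 2 ^ l" unfolding l_def by (rule nat_of_bits_less)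
    then have "bits_from p mod 2 ^ w = nat_of_bits (chunk_code K x) + 2 ^ l * R"
      using bits_from_append[OF D(1)] add_mult_power_mod lw by (simp add: R_def flip: l_def)
    also have "\<dots> = 2 ^ u * (1 + 2 * (x + 2 ^ (K * u) * R))"
      by (simp add: nat_of_chunk_code[OF K(1)] l power_add algebra_simps flip: u_def)
    finally show thesis using x by (intro that[of "x + 2 ^ (K * u) * R"]) auto
  qed
  define y where "y = 2 ^ u * (1 + 2 * z)"
  have yw: "y < 2 ^ w" using z(1) by (metis mod_less_divisor y_def zero_less_numeral zero_less_power)
  have pw: "(2::nat) ^ i < 2 ^ w" if "i \<le> l" for i using that lw by simp
  obtain M1 where M1: "fold ex peek_code (M, out) = (M1, out)" "M1 12 = y"
    "\<forall>a. a \<notin> {12, 13, 14} \<longrightarrow> M1 a = M a"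
    using peek[OF M, of out] pl D(2) lw l z(1) unfolding y_def by auto
  have c1: "M1 1 = 1" "M1 3 = 0" using M1(3) M(1) by (simp_all add: base_regs_def)
  have y1: "y \<ge> 1" by (simp add: y_def Suc_le_eq)
  have ym: "nat ((int y - int 1) mod 2 ^ w) = y - 1" using sub_word y1 yw by blast
  have "and y (y - 1) = 2 ^ u * (2 * z)" unfolding y_def by (rule and_minus_one)
  moreover from this have "nat ((int y - int (and y (y - 1))) mod 2 ^ w) = y - 2 ^ u * (2 * z)"
    using yw by (simp only:, intro sub_word) (auto simp: y_def)
  ultimately have yp: "nat ((int y - int (and y (y - 1))) mod 2 ^ w) = 2 ^ u"
    by (simp add: y_def algebra_simps)
  have f1: "fold ex [Compute Sub 13 12 1, Compute And 13 12 13, Compute Sub 13 12 13, Compute Add 14 1 3]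
     (M1, out) = (M1(13 := 2 ^ u, 14 := 1), out)"
    using M1(2) c1 ym yp pw[of 0] l by (auto simp: fun_upd_def)
  have f2: "fold ex (replicate K (Compute Mul 14 14 13)) (M1(13 := 2 ^ u, 14 := 1), out) =
    (M1(13 := 2 ^ u, 14 := 2 ^ (K * u)), out)"
    using pw[of 0] pw[of "K * u"] l
    by (subst fold_replicate_Mul) (simp_all add: mult.commute flip: power_mult)
  define M2 where "M2 = M1(13 := 2 ^ u, 14 := 2 ^ (K * u), 15 := 2 ^ Suc u,
    16 := x, 17 := 2 ^ l)"
  have "y div 2 ^ Suc u = z"
  proof -
    have "y div 2 ^ Suc u = y div 2 ^ u div 2"
      by (simp only: power_Suc2 div_mult2_eq)
    then show ?thesis by (simp add: y_def)
  qed
  then have f3: "fold ex [Compute Add 15 13 13, Compute Div 16 12 15, Compute Mod 16 16 14,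
     Compute Mul 17 14 15] (M1(13 := 2 ^ u, 14 := 2 ^ (K * u)), out) = (M2, out)"
    using M1(2) pw[of "Suc u"] pw[of l] l z(2)
    by (simp add: M2_def mult_2[symmetric] power_add[symmetric] ac_simps flip: power_Suc)
  have "base_regs M2" "at_pos M2 p" using M M1(3) by (simp_all add: M2_def base_regs_def at_pos_def)
  moreover have "p + l < 2 ^ w" using pl D(2) by linarith
  moreover have "M2 17 = 2 ^ l" by (simp add: M2_def)
  ultimately obtain M3 where M3: "fold ex advance_code (M2, out) = (M3, out)"
    "at_pos M3 (p + l)" "\<forall>a. a \<notin> {10, 11, 18, 19} \<longrightarrow> M3 a = M2 a"
    using advance[of M2 p l out] lw by blast
  have "M3 16 = x" "\<forall>a. a < 10 \<or> a \<ge> 20 \<longrightarrow> M3 a = M a"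
    using M3(3) M1(3) by (auto simp: M2_def)
  moreover have "fold ex (decode_code K) (M, out) = (M3, out)"
    by (simp only: decode_code_def fold_append comp_apply M1(1) f1 f2 f3 M3(1))
  ultimately show ?thesis using M3(2) unfolding l_def by blast
qed

end

section \<open>Searching a table of blocked records\<close>

fun quiet :: "nat set \<Rightarrow> instr \<Rightarrow> bool" where
  "quiet W (Literal d k) = (d \<in> W)"
| "quiet W (Compute f d a b) = (d \<in> W)"
| "quiet W (Load d a) = (d \<in> W)"
| "quiet W (Read_Index d a) = (d \<in> W)"
| "quiet W (Read_Pattern d a) = (d \<in> W)"
| "quiet W _ = False"

definition seek_code :: "instr list" where
  "seek_code = [Compute Div 10 16 0, Compute Add 10 10 40, Compute Mod 17 16 0, Compute Shl 17 1 17,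
     Compute Add 11 41 3] @ advance_code"

definition fetch_code :: "nat \<Rightarrow> instr list" where
  "fetch_code c = seek_code @ peek_code @ [Compute Mod 16 12 c]"

lemma length_seek_code: "length seek_code = 12"
  by (simp add: seek_code_def advance_code_def)

lemma length_fetch_code: "length (fetch_code c) = 21"
  by (simp add: fetch_code_def length_seek_code peek_code_def)

lemma quiet_codes:
  "list_all (quiet {10..<20}) peek_code"
  "list_all (quiet {10..<20}) seek_code"
  "list_all (quiet {10..<20}) (fetch_code c)"
  by (simp_all add: list_all_iff peek_code_def fetch_code_def seek_code_def advance_code_def)

lemma or_of_bool [simp]: "or (of_bool a) (of_bool b) = (of_bool (a \<or> b) :: nat)"
  by (cases a; cases b) simp_all

lemma jump_free_seek_fetch [simp]:
  "list_all jump_free seek_code" "list_all jump_free (fetch_code c)"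
  by (simp_all add: list_all_iff peek_code_def fetch_code_def seek_code_def advance_code_def)

context word_ram
begin

lemma fold_quiet:
  "list_all (quiet W) is \<Longrightarrow>
   \<exists>M'. fold ex is (M, out) = (M', out) \<and> (\<forall>a. a \<notin> W \<longrightarrow> M' a = M a)"
proof (induction "is" arbitrary: M)
  case (Cons i "is")
  obtain M1 where "ex i (M, out) = (M1, out)" "\<forall>a. a \<notin> W \<longrightarrow> M1 a = M a"
    using Cons.prems by (cases i) (auto simp: ex_def)
  with Cons.IH[of M1] Cons.prems show ?case by fastforce
qed simp

lemma seek:
  assumes "base_regs M" "M 40 = b div w" "M 41 = 2 ^ (b mod w)" "M 16 = p" "b + p < 2 ^ w" "w > 0"
  shows "\<exists>M'. fold ex seek_code (M, out) = (M', out) \<and> at_pos M' (b + p) \<and>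
    (\<forall>a. a < 10 \<or> a \<ge> 20 \<longrightarrow> M' a = M a)"
proof -
  define p' where "p' = b + p div w * w"
  have pw: "p' + p mod w = b + p" by (simp add: p'_def)
  have d: "p' div w = b div w + p div w" "p' mod w = b mod w"
    using assms(6) by (simp_all add: p'_def)
  have "p' div w \<le> p'" by simp
  then have "p' div w < 2 ^ w" using pw assms(5) by linarith
  moreover have "(2::nat) ^ (p mod w) < 2 ^ w" "(2::nat) ^ (b mod w) < 2 ^ w"
    using assms(6) by simp_all
  ultimately have c: "fold ex [Compute Div 10 16 0, Compute Add 10 10 40, Compute Mod 17 16 0,
      Compute Shl 17 1 17, Compute Add 11 41 3] (M, out) =
      (M(10 := p' div w, 17 := 2 ^ (p mod w), 11 := 2 ^ (p' mod w)), out)"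
    using assms(1-4) d by (auto simp: base_regs_def add.commute fun_upd_def)
  define M1 where "M1 = M(10 := p' div w, 17 := 2 ^ (p mod w), 11 := 2 ^ (p' mod w))"
  have "base_regs M1" "at_pos M1 p'" using assms(1) by (simp_all add: M1_def base_regs_def at_pos_def)
  from advance[OF this, of "p mod w" out] obtain M2 where
    "fold ex advance_code (M1, out) = (M2, out)" "at_pos M2 (b + p)"
    "\<forall>a. a \<notin> {10, 11, 18, 19} \<longrightarrow> M2 a = M1 a"
    using assms(5,6) pw by (auto simp: M1_def)
  with c show ?thesis unfolding seek_code_def by (auto simp: M1_def)
qed

lemma fetch:
  assumes "base_regs M" "M 40 = b div w" "M 41 = 2 ^ (b mod w)" "M 16 = p" "M c = 2 ^ l" "c \<ge> 20"
    "l \<le> w" "x < 2 ^ l" "drop (b + p) D = fixed_code l x @ rest" "length D < 2 ^ w - 1" "w > 0"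
    "b + p < length D"
  shows "\<exists>M'. fold ex (fetch_code c) (M, out) = (M', out) \<and> M' 16 = x \<and>
    (\<forall>a. a < 10 \<or> a \<ge> 20 \<longrightarrow> M' a = M a)"
proof -
  have "b + p < 2 ^ w" using assms(10,12) by linarith
  from seek[OF assms(1-4) this assms(11), of out]
  obtain M1 where M1: "fold ex seek_code (M, out) = (M1, out)" "at_pos M1 (b + p)"
    "\<forall>a. a < 10 \<or> a \<ge> 20 \<longrightarrow> M1 a = M a"
    by blast
  have "base_regs M1" using assms(1) M1(3) by (simp add: base_regs_def)
  from peek[OF this M1(2), of out] obtain M2 where M2: "fold ex peek_code (M1, out) = (M2, out)"
    "M2 12 = bits_from (b + p) mod 2 ^ w" "\<forall>a. a \<notin> {12, 13, 14} \<longrightarrow> M2 a = M1 a"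
    using assms(10-12) by auto
  have "bits_from (b + p) mod 2 ^ w mod 2 ^ l = bits_from (b + p) mod 2 ^ l"
    using assms(7) by (simp add: le_imp_power_dvd mod_mod_cancel)
  also have "\<dots> = x"
    using bits_from_append[OF assms(9)] assms(8) by (simp add: nat_of_fixed_code)
  finally have "M2 12 mod M2 c = x" using M2(2,3) M1(3) assms(5,6) by simp
  moreover have "fold ex [Compute Mod 16 12 c] (M2, out) = (M2(16 := M2 12 mod M2 c), out)" by simp
  ultimately show ?thesis using M1 M2 unfolding fetch_code_def by auto
qed

end

declare alu.simps(1-3) [simp del]

definition bsearch_body :: com where
  "bsearch_body =
    Code ([Compute Add 29 27 28, Compute Add 29 29 1, Compute Shr 29 29 1, Compute Sub 33 29 1,
           Compute Mul 33 33 45, Compute Add 33 33 42, Compute Add 16 33 3] @ fetch_code 46 @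
          [Compute Add 34 16 3, Compute Add 33 33 44, Compute Add 16 33 3] @ fetch_code 46 @
          [Compute Add 35 16 3, Compute Add 33 33 44, Compute Add 16 33 3] @ fetch_code 46 @
          [Compute Add 36 16 3, Compute Less 37 26 34, Compute Less 38 25 35, Compute Or 37 37 38,
           Compute Equal 38 37 3]) ;;
    When 37 (Code [Compute Sub 28 29 1]) ;;
    When 38 (Code [Compute Add 27 29 3, Compute Add 20 34 3, Compute Add 21 35 3,
                   Compute Add 30 36 3]) ;;
    Code [Compute Less 32 27 28, Compute Equal 32 32 3]"

definition scan_body :: "nat \<Rightarrow> com" where
  "scan_body K = Code (decode_code K @ [Compute Add 23 20 16] @ decode_code K @
     [Compute Add 20 23 16, Compute Add 24 21 3, Compute Add 21 21 16, Compute Add 22 22 1,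
      Compute Less 31 26 20, Compute Less 32 25 21, Compute Or 31 31 32, Compute Equal 32 22 49,
      Compute Or 31 31 32])"

definition query :: "nat \<Rightarrow> com" where
  "query K =
    Code [Literal 20 0, Literal 21 0, Literal 30 0, Literal 27 0, Compute Add 28 47 3,
          Compute Less 31 27 28] ;;
    When 31 (Rep bsearch_body 32) ;;
    Code ([Compute Mul 22 27 48, Compute Add 16 43 30] @ seek_code) ;;
    Rep (scan_body K) 31 ;;
    Code [Compute Sub 22 22 1]"

locale records =
  fixes K :: nat and R :: nat and sv ln :: "nat \<Rightarrow> nat"
  assumes K: "K > 0" and R: "R > 0"
    and ln_pos: "j < R \<Longrightarrow> ln j > 0"
    and sep: "Suc j < R \<Longrightarrow> sv j + ln j \<le> sv (Suc j)"
begin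

definition ve :: "nat \<Rightarrow> nat" where
  "ve j = (if j = 0 then 0 else sv (j - 1) + ln (j - 1))"

definition ps :: "nat \<Rightarrow> nat" where
  "ps j = (\<Sum>i<j. ln i)"

definition rec_code :: "nat \<Rightarrow> bool list" where
  "rec_code j = chunk_code K (sv j - ve j) @ chunk_code K (ln j)"

definition so :: "nat \<Rightarrow> nat" where
  "so j = (\<Sum>i<j. length (rec_code i))"

definition found :: "nat \<Rightarrow> nat \<Rightarrow> nat \<Rightarrow> bool" where
  "found p v j \<longleftrightarrow> j < R \<and> (\<forall>i<j. ve (Suc i) \<le> v \<and> ps (Suc i) \<le> p) \<and>
     (Suc j = R \<or> ve (Suc j) > v \<or> ps (Suc j) > p)"

lemma ve_le_sv: "j < R \<Longrightarrow> ve j \<le> sv j"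
  using sep[of "j - 1"] by (cases j) (auto simp: ve_def)

lemma ve_Suc: "ve (Suc j) = sv j + ln j"
  by (simp add: ve_def)

lemma ps_Suc: "ps (Suc j) = ps j + ln j"
  by (simp add: ps_def)

lemma ve_mono: "i \<le> j \<Longrightarrow> j \<le> R \<Longrightarrow> ve i \<le> ve j"
proof (induction j rule: dec_induct)
  case (step j)
  then show ?case using ve_le_sv[of j] ve_Suc[of j] by simp
qed simp

lemma ps_mono: "i \<le> j \<Longrightarrow> ps i \<le> ps j"
  unfolding ps_def by (rule sum_mono2) auto

lemma so_mono: "i \<le> j \<Longrightarrow> so i \<le> so j"
  unfolding so_def by (rule sum_mono2) auto

end

locale table = word_ram w D P + records K R sv ln
  for w :: nat and D :: "bool list" and P :: "nat list" and K R :: nat and sv ln :: "nat \<Rightarrow> nat" +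
  fixes BB L base offH offS :: nat
  assumes BB: "BB > 0" and L: "L > 0"
    and small: "ve R < 2 ^ L" "ps R < 2 ^ L" "so R < 2 ^ L"
    and word: "2 * L + K + 3 \<le> w" "length D < 2 ^ (w - 1)"
    and code_small: "x < 2 ^ L \<Longrightarrow> length (chunk_code K x) < w"
    and stream: "j < R \<Longrightarrow> \<exists>rest. drop (base + offS + so j) D = rec_code j @ rest"
    and heads: "b > 0 \<Longrightarrow> b * BB < R \<Longrightarrow> \<exists>rest. drop (base + offH + (b - 1) * (3 * L)) D =
       fixed_code L (ve (b * BB)) @ fixed_code L (ps (b * BB)) @ fixed_code L (so (b * BB)) @ rest"
begin

definition nb :: nat where
  "nb = (R - 1) div BB"

definition table_regs :: "(nat \<Rightarrow> nat) \<Rightarrow> bool" where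
  "table_regs M \<longleftrightarrow> base_regs M \<and> M 40 = base div w \<and> M 41 = 2 ^ (base mod w) \<and> M 42 = offH \<and>
     M 43 = offS \<and> M 44 = L \<and> M 45 = 3 * L \<and> M 46 = 2 ^ L \<and> M 47 = nb \<and> M 48 = BB \<and> M 49 = R"

lemma table_regs_cong:
  "table_regs M \<Longrightarrow> (\<forall>a. a < 10 \<or> a \<ge> 40 \<longrightarrow> M' a = M a) \<Longrightarrow> table_regs M'"
  by (simp add: table_regs_def base_regs_def)

lemma nb_less: "b \<le> nb \<Longrightarrow> b * BB < R"
proof -
  assume "b \<le> nb"
  then have "b * BB \<le> nb * BB" by simp
  also have "\<dots> \<le> R - 1" by (simp add: nb_def)
  finally show ?thesis using R by linarith
qed

lemma R_le_Suc_nb: "R \<le> Suc nb * BB"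
  using BB R dividend_less_div_times[of BB "R - 1"] by (simp add: nb_def)

lemma w_pos: "w > 0" and D_less: "length D < 2 ^ w - 1"
proof -
  show "w > 0" using word by simp
  then have "(2::nat) ^ w = 2 * 2 ^ (w - 1)" by (simp flip: power_Suc)
  then show "length D < 2 ^ w - 1" using word(2) by simp
qed

lemma R_small: "R < 2 ^ L"
proof -
  have "R \<le> ps R" unfolding ps_def using sum_mono[of "{..<R}" "\<lambda>_. 1" ln] ln_pos
    by (simp add: Suc_le_eq)
  then show ?thesis using small by simp
qed

lemma less_word: "x < 2 ^ L \<Longrightarrow> x < (2::nat) ^ w"
proof -
  assume "x < (2::nat) ^ L"
  also have "(2::nat) ^ L \<le> 2 ^ w" using word(1) by (intro power_increasing) auto
  finally show ?thesis .
qed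

lemma drop_in_D: "drop p D = bs @ rest \<Longrightarrow> bs \<noteq> [] \<Longrightarrow> p + length bs \<le> length D"
proof -
  assume a: "drop p D = bs @ rest" "bs \<noteq> []"
  then have "length D - p = length bs + length rest" by (metis length_append length_drop)
  moreover have "length bs > 0" using a by simp
  ultimately show ?thesis by linarith
qed

lemma drop_later: "drop p D = xs @ ys \<Longrightarrow> drop (p + length xs) D = ys"
  by (metis add.commute append_eq_conv_conj drop_drop)


lemma bsearch_load:
  assumes M: "table_regs M" and mid: "mid = (M 27 + M 28 + 1) div 2" "0 < mid" "mid \<le> nb"
    and less: "M 27 + M 28 + 1 < 2 ^ w"
  shows "\<exists>M'. fold ex
     ([Compute Add 29 27 28, Compute Add 29 29 1, Compute Shr 29 29 1, Compute Sub 33 29 1,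
       Compute Mul 33 33 45, Compute Add 33 33 42, Compute Add 16 33 3] @ fetch_code 46 @
      [Compute Add 34 16 3, Compute Add 33 33 44, Compute Add 16 33 3] @ fetch_code 46 @
      [Compute Add 35 16 3, Compute Add 33 33 44, Compute Add 16 33 3] @ fetch_code 46 @
      [Compute Add 36 16 3, Compute Less 37 26 34, Compute Less 38 25 35, Compute Or 37 37 38,
       Compute Equal 38 37 3]) (M, out) = (M', out) \<and>
    M' 29 = mid \<and> M' 34 = ve (mid * BB) \<and> M' 35 = ps (mid * BB) \<and> M' 36 = so (mid * BB) \<and>
    M' 37 = of_bool (M 26 < ve (mid * BB) \<or> M 25 < ps (mid * BB)) \<and>
    M' 38 = of_bool (\<not> (M 26 < ve (mid * BB) \<or> M 25 < ps (mid * BB))) \<and>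
    (\<forall>a. a < 10 \<or> a \<ge> 40 \<or> a \<in> {20..28} \<or> a \<in> {30..32} \<longrightarrow> M' a = M a)"
    (is "\<exists>M'. fold ex (?c1 @ ?f @ ?c2 @ ?f @ ?c3 @ ?f @ ?c4) _ = _ \<and> _")
proof -
  define h where "h = offH + (mid - 1) * (3 * L)"
  have mB: "mid * BB < R" using nb_less mid by blast
  obtain rest where rest: "drop (base + h) D = fixed_code L (ve (mid * BB)) @
      fixed_code L (ps (mid * BB)) @ fixed_code L (so (mid * BB)) @ rest"
    using heads[OF mid(2) mB] by (auto simp: h_def add.assoc)
  have rest1: "drop (base + (h + L)) D = fixed_code L (ps (mid * BB)) @ fixed_code L (so (mid * BB)) @ rest"
    using drop_later[OF rest] by (simp add: add.assoc)
  have rest2: "drop (base + (h + L + L)) D = fixed_code L (so (mid * BB)) @ rest"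
    using drop_later[OF rest1] by (simp add: add.assoc)
  have "fixed_code L (so (mid * BB)) \<noteq> []" using L by (simp add: fixed_code_def)
  from drop_in_D[OF rest2 this] have hD: "base + h + 3 * L \<le> length D" by simp
  have hw: "h + L + L < 2 ^ w" "offH < 2 ^ w" "(mid - 1) * (3 * L) < 2 ^ w"
    using hD D_less by (simp_all add: h_def)
  have vals: "ve (mid * BB) < 2 ^ L" "ps (mid * BB) < 2 ^ L" "so (mid * BB) < 2 ^ L"
    using small ve_mono[of "mid * BB" R] ps_mono[of "mid * BB" R] so_mono[of "mid * BB" R] mB
    by auto
  note vw = vals[THEN less_word]
  have Lw: "L \<le> w" using word by simp
  have regs: "M 1 = 1" "M 3 = 0" "M 42 = offH" "M 44 = L" "M 45 = 3 * L"
    using M by (simp_all add: table_regs_def base_regs_def)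
  have mw: "mid < 2 ^ w" using less mid by linarith
  have h': "(mid - 1) * (3 * L) + offH = h" by (simp add: h_def)
  have c1: "fold ex ?c1 (M, out) = (M(29 := mid, 33 := h, 16 := h), out)"
  proof -
    have "alu w Add (M 27) (M 28) = M 27 + M 28" "alu w Add (M 27 + M 28) 1 = M 27 + M 28 + 1"
      "alu w Sub mid 1 = mid - 1"
      "alu w Mul (mid - 1) (3 * L) = (mid - 1) * (3 * L)"
      "alu w Add ((mid - 1) * (3 * L)) offH = h" "alu w Add h 0 = h"
      using less mid mw hw h' by (auto simp: alu_add alu_sub alu_mul simp del: mult_Suc_right)
    moreover have "alu w Shr (M 27 + M 28 + 1) 1 = mid" by (simp add: mid(1) del: One_nat_def)
    ultimately show ?thesis by (simp add: regs del: One_nat_def alu.simps)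
  qed
  define M1 where "M1 = M(29 := mid, 33 := h, 16 := h)"
  have "\<exists>M'. fold ex ?f (M1, out) = (M', out) \<and> M' 16 = ve (mid * BB) \<and>
    (\<forall>a. a < 10 \<or> a \<ge> 20 \<longrightarrow> M' a = M1 a)"
    using M hD L
    by (intro fetch[OF _ _ _ _ _ _ Lw vals(1) rest D_less w_pos])
       (auto simp: M1_def table_regs_def base_regs_def)
  then obtain M2 where M2: "fold ex ?f (M1, out) = (M2, out)" "M2 16 = ve (mid * BB)"
    "\<forall>a. a < 10 \<or> a \<ge> 20 \<longrightarrow> M2 a = M1 a" by blast
  define M3 where "M3 = M2(34 := ve (mid * BB), 33 := h + L, 16 := h + L)"
  have c2: "fold ex ?c2 (M2, out) = (M3, out)"
    using regs M2 vw hw by (simp add: M3_def M1_def alu_add)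
  have "\<exists>M'. fold ex ?f (M3, out) = (M', out) \<and> M' 16 = ps (mid * BB) \<and>
    (\<forall>a. a < 10 \<or> a \<ge> 20 \<longrightarrow> M' a = M3 a)"
    using M hD L M2
    by (intro fetch[OF _ _ _ _ _ _ Lw vals(2) rest1 D_less w_pos])
       (auto simp: M3_def M1_def table_regs_def base_regs_def)
  then obtain M4 where M4: "fold ex ?f (M3, out) = (M4, out)" "M4 16 = ps (mid * BB)"
    "\<forall>a. a < 10 \<or> a \<ge> 20 \<longrightarrow> M4 a = M3 a" by blast
  define M5 where "M5 = M4(35 := ps (mid * BB), 33 := h + L + L, 16 := h + L + L)"
  have c3: "fold ex ?c3 (M4, out) = (M5, out)"
    using regs M2 M4 vw hw by (simp add: M5_def M3_def M1_def alu_add)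
  have "\<exists>M'. fold ex ?f (M5, out) = (M', out) \<and> M' 16 = so (mid * BB) \<and>
    (\<forall>a. a < 10 \<or> a \<ge> 20 \<longrightarrow> M' a = M5 a)"
    using M hD L M2 M4
    by (intro fetch[OF _ _ _ _ _ _ Lw vals(3) rest2 D_less w_pos])
       (auto simp: M5_def M3_def M1_def table_regs_def base_regs_def)
  then obtain M6 where M6: "fold ex ?f (M5, out) = (M6, out)" "M6 16 = so (mid * BB)"
    "\<forall>a. a < 10 \<or> a \<ge> 20 \<longrightarrow> M6 a = M5 a" by blast
  define bad where "bad \<longleftrightarrow> M 26 < ve (mid * BB) \<or> M 25 < ps (mid * BB)"
  define M7 where "M7 = M6(36 := so (mid * BB), 37 := of_bool bad, 38 := of_bool (\<not> bad))"
  have c4: "fold ex ?c4 (M6, out) = (M7, out)"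
    using regs M2 M4 M6 vw
    by (simp add: M7_def M5_def M3_def M1_def bad_def alu_add fun_upd_twist)
  have "fold ex (?c1 @ ?f @ ?c2 @ ?f @ ?c3 @ ?f @ ?c4) (M, out) = (M7, out)"
    using c1 M2(1) c2 M4(1) c3 M6(1) c4 by (simp only: fold_append comp_apply M1_def)
  moreover have "M7 29 = mid" "M7 34 = ve (mid * BB)" "M7 35 = ps (mid * BB)" "M7 36 = so (mid * BB)"
    "M7 37 = of_bool bad" "M7 38 = of_bool (\<not> bad)"
    "\<forall>a. a < 10 \<or> a \<ge> 40 \<or> a \<in> {20..28} \<or> a \<in> {30..32} \<longrightarrow> M7 a = M a"
    using M2(3) M4(3) M6(3) by (auto simp: M7_def M5_def M3_def M1_def)
  ultimately show ?thesis unfolding bad_def by blast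
qed

definition frame :: "(nat \<Rightarrow> nat) \<Rightarrow> (nat \<Rightarrow> nat) \<Rightarrow> bool" where
  "frame M M' \<longleftrightarrow> (\<forall>a. a < 10 \<or> a \<ge> 40 \<or> a \<in> {25, 26} \<longrightarrow> M' a = M a)"

definition bsearch_inv :: "(nat \<Rightarrow> nat) \<Rightarrow> (nat \<Rightarrow> nat) \<Rightarrow> bool" where
  "bsearch_inv M0 M \<longleftrightarrow> frame M0 M \<and> M 27 \<le> M 28 \<and> M 28 \<le> nb \<and>
     M 20 = ve (M 27 * BB) \<and> M 21 = ps (M 27 * BB) \<and> M 30 = so (M 27 * BB) \<and>
     (M 27 = 0 \<or> ve (M 27 * BB) \<le> M0 26 \<and> ps (M 27 * BB) \<le> M0 25) \<and>
     (M 28 = nb \<or> ve (Suc (M 28) * BB) > M0 26 \<or> ps (Suc (M 28) * BB) > M0 25)"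

lemma nb_small: "nb < R"
  using R by (auto simp: nb_def intro: le_less_trans[OF div_le_dividend])

lemma nb2_less: "nb + nb + 1 < 2 ^ w"
proof -
  have "nb + nb + 1 < 2 ^ Suc L" using nb_small R_small by simp
  also have "(2::nat) ^ Suc L \<le> 2 ^ w" using word(1) L by (intro power_increasing) auto
  finally show ?thesis .
qed

lemma bsearch_body_ok:
  assumes M0: "table_regs M0" and inv: "bsearch_inv M0 M" and less: "M 27 < M 28"
    and k: "M 28 - M 27 < 2 ^ Suc k"
  shows "ok bsearch_body (\<lambda>t s'. t \<le> 91 \<and> (if fst s' 32 = 0 then
      k > 0 \<and> snd s' = out \<and> bsearch_inv M0 (fst s') \<and> fst s' 27 < fst s' 28 \<and>
        fst s' 28 - fst s' 27 < 2 ^ Suc (k - 1)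
      else snd s' = out \<and> bsearch_inv M0 (fst s') \<and> fst s' 27 = fst s' 28)) (M, out)"
proof -
  define lo hi mid where "lo = M 27" and "hi = M 28" and "mid = (lo + hi + 1) div 2"
  have mid: "lo < mid" "mid \<le> hi" using less by (auto simp: mid_def lo_def hi_def)
  have T: "table_regs M" using M0 inv table_regs_cong unfolding bsearch_inv_def frame_def by blast
  have hi: "hi \<le> nb" using inv by (simp add: bsearch_inv_def hi_def)
  have lt: "lo + hi + 1 < 2 ^ w" using less hi nb2_less by (simp add: lo_def hi_def)
  have mw: "mid < 2 ^ w" using lt mid by linarith
  have mBR: "mid * BB < R" using nb_less mid hi by simp
  have vw: "ve (mid * BB) < 2 ^ w" "ps (mid * BB) < 2 ^ w" "so (mid * BB) < 2 ^ w"
    using small ve_mono[of "mid * BB" R] ps_mono[of "mid * BB" R] so_mono[of "mid * BB" R] mBR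
    by (auto intro!: less_word)
  define bad where "bad \<longleftrightarrow> M 26 < ve (mid * BB) \<or> M 25 < ps (mid * BB)"
  obtain M1 where M1: "fold ex
     ([Compute Add 29 27 28, Compute Add 29 29 1, Compute Shr 29 29 1, Compute Sub 33 29 1,
       Compute Mul 33 33 45, Compute Add 33 33 42, Compute Add 16 33 3] @ fetch_code 46 @
      [Compute Add 34 16 3, Compute Add 33 33 44, Compute Add 16 33 3] @ fetch_code 46 @
      [Compute Add 35 16 3, Compute Add 33 33 44, Compute Add 16 33 3] @ fetch_code 46 @
      [Compute Add 36 16 3, Compute Less 37 26 34, Compute Less 38 25 35, Compute Or 37 37 38,
       Compute Equal 38 37 3]) (M, out) = (M1, out)"
    and M1v: "M1 29 = mid" "M1 34 = ve (mid * BB)" "M1 35 = ps (mid * BB)" "M1 36 = so (mid * BB)"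
     "M1 37 = of_bool bad" "M1 38 = of_bool (\<not> bad)"
    and M1f: "\<forall>a. a < 10 \<or> a \<ge> 40 \<or> a \<in> {20..28} \<or> a \<in> {30..32} \<longrightarrow> M1 a = M a"
    using bsearch_load[OF T, of mid out] mid hi lt unfolding mid_def lo_def hi_def bad_def by auto
  have M1r: "M1 3 = 0" "M1 1 = 1" using M1f T by (simp_all add: table_regs_def base_regs_def)
  define M2 where "M2 = (if bad then M1(28 := mid - 1) else M1(27 := mid, 20 := ve (mid * BB),
     21 := ps (mid * BB), 30 := so (mid * BB)))"
  define M3 where "M3 = M2(32 := of_bool (\<not> M2 27 < M2 28))"
  have M27: "M2 27 = (if bad then lo else mid)" "M2 28 = (if bad then mid - 1 else hi)"
    using M1f by (auto simp: M2_def lo_def hi_def)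
  have fr: "\<forall>a. a < 10 \<or> a \<ge> 40 \<or> a \<in> {25, 26} \<longrightarrow> M3 a = M a"
    using M1f by (auto simp: M3_def M2_def)
  have inv3: "bsearch_inv M0 M3"
  proof -
    have "frame M0 M3" using inv fr by (auto simp: bsearch_inv_def frame_def)
    moreover have "M0 25 = M 25" "M0 26 = M 26" using inv by (simp_all add: bsearch_inv_def frame_def)
    moreover have "M3 20 = ve (M3 27 * BB) \<and> M3 21 = ps (M3 27 * BB) \<and> M3 30 = so (M3 27 * BB)"
      using inv M1f by (auto simp: M3_def M2_def bsearch_inv_def)
    moreover have "BB + (mid - Suc 0) * BB = mid * BB" using mid by (cases mid) auto
    ultimately show ?thesis
      using inv mid hi M27 unfolding bsearch_inv_def
      by (auto simp: M3_def bad_def not_less simp flip: lo_def hi_def)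
  qed
  have half: "M2 28 - M2 27 \<le> (hi - lo) div 2" unfolding M27 mid_def by auto
  have post: "if M3 32 = 0 then k > 0 \<and> bsearch_inv M0 M3 \<and> M3 27 < M3 28 \<and>
        M3 28 - M3 27 < 2 ^ Suc (k - 1) else bsearch_inv M0 M3 \<and> M3 27 = M3 28"
  proof (cases "M2 27 < M2 28")
    case True
    have "(hi - lo) div 2 < 2 ^ k" using k by (simp add: lo_def hi_def)
    with half have d: "M2 28 - M2 27 < 2 ^ k" by linarith
    with True have "k > 0" by (cases k) auto
    with d True inv3 show ?thesis by (simp add: M3_def)
  next
    case False
    moreover have "M3 27 \<le> M3 28" using inv3 by (simp add: bsearch_inv_def)
    ultimately show ?thesis using inv3 by (simp add: M3_def)
  qed
  have final: "fold ex [Compute Less 32 27 28, Compute Equal 32 32 3] (M2, out) = (M3, out)"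
    using M1r by (simp add: M3_def M2_def)
  show ?thesis
  proof (cases bad)
    case True
    then have "fold ex [Compute Sub 28 29 1] (M1, out) = (M2, out)"
      using M1v M1r mw mid by (simp add: M2_def alu_sub)
    note s1 = this
    have "M2 38 = 0" using True M1v by (simp add: M2_def)
    show ?thesis unfolding bsearch_body_def
    proof (rule ok_Seq, rule ok_Code, unfold M1, rule ok_Seq, rule ok_When, goal_cases)
      case 1
      then show ?case using True M1v by simp
    next
      case 2
      show ?case
      proof (rule ok_Code, unfold s1, rule ok_Seq, rule ok_When, goal_cases)
        case 1
        show ?case
          by (rule ok_Code, unfold final) (use post in \<open>auto simp: length_fetch_code simp del: power_Suc split: if_splits\<close>)
      next
        case 2
        then show ?case using \<open>M2 38 = 0\<close> by simp
      qed
    qed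
  next
    case False
    then have "fold ex [Compute Add 27 29 3, Compute Add 20 34 3, Compute Add 21 35 3,
                   Compute Add 30 36 3] (M1, out) = (M2, out)"
      using M1v M1r mw vw by (simp add: M2_def alu_add)
    note s1 = this
    show ?thesis unfolding bsearch_body_def
    proof (rule ok_Seq, rule ok_Code, unfold M1, rule ok_Seq, rule ok_When, goal_cases)
      case 1
      show ?case
      proof (rule ok_Seq, rule ok_When, goal_cases)
        case 1
        then show ?case using False M1v by simp
      next
        case 2
        show ?case
          by (rule ok_Code, unfold s1, rule ok_Code, unfold final)
             (use post in \<open>auto simp: length_fetch_code simp del: power_Suc split: if_splits\<close>)
      qed
    next
      case 2
      then show ?case using False M1v by simp
    qed
  qed
qed

definition scan_inv :: "(nat \<Rightarrow> nat) \<Rightarrow> nat \<Rightarrow> (nat \<Rightarrow> nat) \<Rightarrow> bool" where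
  "scan_inv M0 b M \<longleftrightarrow> frame M0 M \<and> M 22 < R \<and> M 22 < Suc b * BB \<and> M 20 = ve (M 22) \<and>
     M 21 = ps (M 22) \<and> at_pos M (base + offS + so (M 22)) \<and>
     (\<forall>i<M 22. ve (Suc i) \<le> M0 26 \<and> ps (Suc i) \<le> M0 25)"

definition query_post :: "(nat \<Rightarrow> nat) \<Rightarrow> (nat \<Rightarrow> nat) \<Rightarrow> bool" where
  "query_post M0 M \<longleftrightarrow> frame M0 M \<and> found (M0 25) (M0 26) (M 22) \<and> M 23 = sv (M 22) \<and>
     M 24 = ps (M 22) \<and> M 20 = ve (Suc (M 22))"

lemma scan_body_ok:
  assumes M0: "table_regs M0" and inv: "scan_inv M0 b M"
    and b: "b = nb \<or> ve (Suc b * BB) > M0 26 \<or> ps (Suc b * BB) > M0 25"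
    and k: "Suc b * BB \<le> Suc (M 22 + k)"
  shows "ok (scan_body K) (\<lambda>t s'. t \<le> 2 * K + 56 \<and> (if fst s' 31 = 0 then
      k > 0 \<and> (snd s' = out \<and> scan_inv M0 b (fst s') \<and> Suc b * BB \<le> Suc (fst s' 22 + (k - 1)))
      else snd s' = out \<and> fst s' 22 > 0 \<and> query_post M0 ((fst s')(22 := fst s' 22 - 1)))) (M, out)"
proof -
  let ?code = "[Compute Add 20 23 16, Compute Add 24 21 3, Compute Add 21 21 16,
      Compute Add 22 22 1, Compute Less 31 26 20, Compute Less 32 25 21, Compute Or 31 31 32,
      Compute Equal 32 22 49, Compute Or 31 31 32]"
  define j where "j = M 22"
  have j: "j < R" "j < Suc b * BB" using inv by (simp_all add: scan_inv_def j_def)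
  have T: "table_regs M" using M0 inv table_regs_cong unfolding scan_inv_def frame_def by blast
  have regs: "M 1 = 1" "M 3 = 0" "M 49 = R" "base_regs M"
    using T by (simp_all add: table_regs_def base_regs_def)
  have sm: "ve (Suc j) < 2 ^ L" "ps (Suc j) < 2 ^ L" "Suc j < 2 ^ L"
    using small ve_mono[of "Suc j" R] ps_mono[of "Suc j" R] j R_small by auto
  have svj: "sv j + ln j < 2 ^ L" using sm(1) by (simp add: ve_Suc)
  note vw = sm[THEN less_word] svj[THEN less_word]
  have vesv: "ve j \<le> sv j" using ve_le_sv j by simp
  define p g where "p = base + offS + so j" and "g = sv j - ve j"
  obtain rest where rest: "drop p D = chunk_code K g @ chunk_code K (ln j) @ rest"
    using stream[OF j(1)] by (auto simp: p_def g_def rec_code_def)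
  have gl: "length (chunk_code K g) < w" "length (chunk_code K (ln j)) < w"
    using svj vesv by (auto intro!: code_small simp: g_def)
  have "at_pos M p" using inv by (simp add: scan_inv_def p_def j_def)
  from decode[OF regs(4) this rest D_less K gl(1), of out]
  obtain M1 where M1: "fold ex (decode_code K) (M, out) = (M1, out)" "M1 16 = g"
    "at_pos M1 (p + length (chunk_code K g))" "\<forall>a. a < 10 \<or> a \<ge> 20 \<longrightarrow> M1 a = M a" by blast
  define M2 where "M2 = M1(23 := sv j)"
  have "M1 20 = ve j" using M1(4) inv by (simp add: scan_inv_def j_def)
  then have c1: "fold ex [Compute Add 23 20 16] (M1, out) = (M2, out)"
    using M1(2) vesv vw(4) by (simp add: M2_def alu_add g_def)
  have "base_regs M2" "at_pos M2 (p + length (chunk_code K g))"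
    using M1(3,4) regs(4) by (auto simp: M2_def base_regs_def at_pos_def)
  from decode[OF this drop_later[OF rest] D_less K gl(2), of out]
  obtain M3 where M3: "fold ex (decode_code K) (M2, out) = (M3, out)" "M3 16 = ln j"
    "at_pos M3 (p + length (chunk_code K g) + length (chunk_code K (ln j)))"
    "\<forall>a. a < 10 \<or> a \<ge> 20 \<longrightarrow> M3 a = M2 a" by blast
  have pos: "p + length (chunk_code K g) + length (chunk_code K (ln j)) = base + offS + so (Suc j)"
    by (simp add: p_def so_def rec_code_def g_def)
  define stop where "stop \<longleftrightarrow> M0 26 < ve (Suc j) \<or> M0 25 < ps (Suc j) \<or> Suc j = R"
  define M4 where "M4 = M3(20 := ve (Suc j), 24 := ps j, 21 := ps (Suc j), 22 := Suc j,
    31 := of_bool stop, 32 := of_bool (Suc j = R))"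
  have old: "M3 23 = sv j" "M3 21 = ps j" "M3 22 = j" "M3 25 = M0 25" "M3 26 = M0 26"
     "M3 49 = R" "M3 1 = 1" "M3 3 = 0"
    using M3(4) M1(4) inv regs by (simp_all add: M2_def scan_inv_def j_def frame_def)
  have psS: "ps j + ln j = ps (Suc j)" by (simp add: ps_Suc)
  have c2: "fold ex ?code (M3, out) = (M4, out)"
    using old M3(2) vw psS
    by (simp add: M4_def alu_add ve_Suc fun_upd_twist stop_def)
  have eval: "fold ex (decode_code K @ [Compute Add 23 20 16] @ decode_code K @
     ?code) (M, out) = (M4, out)"
    by (simp only: fold_append comp_apply M1(1) c1 M3(1) c2)
  have fr: "frame M0 M4"
    using inv M1(4) M3(4) by (auto simp: scan_inv_def frame_def M4_def M2_def)
  have prev: "\<forall>i<j. ve (Suc i) \<le> M0 26 \<and> ps (Suc i) \<le> M0 25"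
    using inv by (simp add: scan_inv_def j_def)
  have post: "if M4 31 = 0 then
      k > 0 \<and> (scan_inv M0 b M4 \<and> Suc b * BB \<le> Suc (M4 22 + (k - 1)))
      else M4 22 > 0 \<and> query_post M0 (M4(22 := M4 22 - 1))"
  proof (cases stop)
    case True
    have "frame M0 (M4(22 := M4 22 - 1))" using fr by (simp add: frame_def)
    moreover have "found (M0 25) (M0 26) j" using prev True j by (auto simp: found_def stop_def)
    moreover have "M4 23 = sv j" using old by (simp add: M4_def)
    ultimately show ?thesis using True by (simp add: query_post_def M4_def)
  next
    case False
    have lt: "Suc j < Suc b * BB"
    proof (rule ccontr)
      assume "\<not> Suc j < Suc b * BB"
      then have e: "Suc b * BB = Suc j" using j by simp
      from b show False
      proof
        assume "b = nb" then show False using e R_le_Suc_nb False j by (auto simp: stop_def)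
      next
        assume "ve (Suc b * BB) > M0 26 \<or> ps (Suc b * BB) > M0 25"
        then show False using e False by (auto simp: stop_def)
      qed
    qed
    then have kp: "k > 0" using k by (cases k) (auto simp: j_def)
    have "at_pos M4 (base + offS + so (Suc j))"
      using M3(3) pos by (simp add: at_pos_def M4_def)
    moreover have "\<forall>i<Suc j. ve (Suc i) \<le> M0 26 \<and> ps (Suc i) \<le> M0 25"
      using prev False by (auto simp: less_Suc_eq stop_def)
    ultimately have "scan_inv M0 b M4"
      using fr False j lt unfolding scan_inv_def by (simp add: M4_def stop_def)
    then show ?thesis using False kp k by (simp add: M4_def j_def)
  qed
  show ?thesis unfolding scan_body_def
    by (rule ok_Code, simp only: eval) (use post in \<open>auto simp: length_decode_code split: if_splits\<close>)
qed

definition query_time :: "nat \<Rightarrow> nat" where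
  "query_time k = 30 + (k + 1) * 92 + BB * (2 * K + 57)"

lemma query_ok:
  assumes M0: "table_regs M" and k: "nb < 2 ^ Suc k"
  shows "ok (query K) (\<lambda>t s'. t \<le> query_time k \<and> snd s' = out \<and> query_post M (fst s')) (M, out)"
proof -
  let ?code = "[Compute Mul 22 27 48, Compute Add 16 43 30]"
  have regs: "M 1 = 1" "M 3 = 0" "M 47 = nb" "M 48 = BB" "M 43 = offS" "base_regs M"
    "M 40 = base div w" "M 41 = 2 ^ (base mod w)"
    using M0 by (simp_all add: table_regs_def base_regs_def)
  have nbw: "nb < 2 ^ w" using nb2_less by linarith
  define M1 where "M1 = M(20 := 0, 21 := 0, 30 := 0, 27 := 0, 28 := nb, 31 := of_bool (0 < nb))"
  have c1: "fold ex [Literal 20 0, Literal 21 0, Literal 30 0, Literal 27 0, Compute Add 28 47 3,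
          Compute Less 31 27 28] (M, out) = (M1, out)"
    using regs nbw by (simp add: M1_def alu_add)
  have inv1: "bsearch_inv M M1"
    by (simp add: bsearch_inv_def M1_def frame_def ve_def ps_def so_def)
  have bs: "ok (When 31 (Rep bsearch_body 32)) (\<lambda>t s'. t \<le> (k + 1) * 92 + 1 \<and>
      (snd s' = out \<and> bsearch_inv M (fst s') \<and> fst s' 27 = fst s' 28)) (M1, out)"
  proof (rule ok_When, goal_cases)
    case 1
    then show ?case using inv1 by (simp add: M1_def)
  next
    case 2
    have "ok (Rep bsearch_body 32) (\<lambda>t s'. t \<le> (k + 1) * (91 + 1) \<and>
        (snd s' = out \<and> bsearch_inv M (fst s') \<and> fst s' 27 = fst s' 28)) (M1, out)"
    proof (rule ok_Rep[where I = "\<lambda>k s. snd s = out \<and> bsearch_inv M (fst s) \<and>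
        fst s 27 < fst s 28 \<and> fst s 28 - fst s 27 < 2 ^ Suc k"], goal_cases)
      case 1
      then show ?case using 2 inv1 k by (simp add: M1_def)
    next
      case (2 k s)
      then show ?case using bsearch_body_ok[OF M0, of "fst s" k out] by (cases s) simp
    qed
    then show ?case by (rule ok_mono) auto
  qed
  have sc: "ok (Code (?code @ seek_code))
      (\<lambda>t s'. t = 14 \<and> (snd s' = out \<and> scan_inv M (M2 27) (fst s') \<and> fst s' 22 = M2 27 * BB)) (M2, out)"
    if inv: "bsearch_inv M M2" "M2 27 = M2 28" for M2
  proof -
    define b where "b = M2 27"
    have b: "b \<le> nb" using inv by (simp add: bsearch_inv_def b_def)
    have bB: "b * BB < R" using nb_less[OF b] .
    obtain rest where "drop (base + offS + so (b * BB)) D = rec_code (b * BB) @ rest"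
      using stream[OF bB] by blast
    then have "base + offS + so (b * BB) + length (rec_code (b * BB)) \<le> length D"
      by (rule drop_in_D) (simp add: rec_code_def chunk_code_def)
    then have pw: "base + (offS + so (b * BB)) < 2 ^ w" using D_less by linarith
    define M3 where "M3 = M2(22 := b * BB, 16 := offS + so (b * BB))"
    have r2: "M2 48 = BB" "M2 43 = offS" "M2 30 = so (b * BB)"
      using inv regs by (simp_all add: bsearch_inv_def frame_def b_def)
    have "b * BB < 2 ^ w" using bB R_small less_word by (meson less_trans)
    then have c: "fold ex ?code (M2, out) = (M3, out)"
      using r2 pw by (simp add: M3_def alu_mul alu_add flip: b_def)
    have "base_regs M3" "M3 40 = base div w" "M3 41 = 2 ^ (base mod w)"
      "M3 16 = offS + so (b * BB)"
      using inv regs by (simp_all add: M3_def base_regs_def bsearch_inv_def frame_def)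
    from seek[OF this pw w_pos, of out] obtain M4 where
      M4: "fold ex seek_code (M3, out) = (M4, out)" "at_pos M4 (base + (offS + so (b * BB)))"
      "\<forall>a. a < 10 \<or> a \<ge> 20 \<longrightarrow> M4 a = M3 a" by blast
    have prev: "ve (Suc i) \<le> M 26 \<and> ps (Suc i) \<le> M 25" if "i < b * BB" for i
    proof -
      have "ve (Suc i) \<le> ve (b * BB)" "ps (Suc i) \<le> ps (b * BB)"
        using that bB by (auto intro!: ve_mono ps_mono)
      moreover have "ve (b * BB) \<le> M 26 \<and> ps (b * BB) \<le> M 25"
        using inv that unfolding bsearch_inv_def by (auto simp: b_def)
      ultimately show ?thesis by linarith
    qed
    have "frame M M4" using inv M4(3) by (auto simp: bsearch_inv_def frame_def M3_def)
    moreover have "M4 22 = b * BB" "M4 20 = ve (b * BB)" "M4 21 = ps (b * BB)"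
      using M4(3) inv by (simp_all add: M3_def bsearch_inv_def b_def)
    ultimately have "scan_inv M b M4"
      using M4(2) prev bB BB unfolding scan_inv_def by (simp add: add.assoc)
    with \<open>M4 22 = b * BB\<close> show ?thesis
      by (intro ok_Code) (simp only: fold_append comp_apply c M4(1), simp add: length_seek_code b_def)
  qed
  have scan: "ok (Rep (scan_body K) 31) (\<lambda>t s'. t \<le> BB * (2 * K + 57) \<and>
      (snd s' = out \<and> fst s' 22 > 0 \<and> query_post M ((fst s')(22 := fst s' 22 - 1)))) (M3, out)"
    if inv: "bsearch_inv M M2" "M2 27 = M2 28" "scan_inv M (M2 27) M3" "M3 22 = M2 27 * BB" for M2 M3
  proof -
    have b: "M2 27 = nb \<or> ve (Suc (M2 27) * BB) > M 26 \<or> ps (Suc (M2 27) * BB) > M 25"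
      using inv(1,2) by (simp add: bsearch_inv_def)
    have "ok (Rep (scan_body K) 31) (\<lambda>t s'. t \<le> (BB - 1 + 1) * (2 * K + 56 + 1) \<and>
      (snd s' = out \<and> fst s' 22 > 0 \<and> query_post M ((fst s')(22 := fst s' 22 - 1)))) (M3, out)"
    proof (rule ok_Rep[where I = "\<lambda>k s. snd s = out \<and> scan_inv M (M2 27) (fst s) \<and>
        Suc (M2 27) * BB \<le> Suc (fst s 22 + k)"], goal_cases)
      case 1
      then show ?case using inv BB by simp
    next
      case (2 k s)
      then show ?case using scan_body_ok[OF M0 _ b, of "fst s" k out] by (cases s) simp
    qed
    moreover have "(BB - 1 + 1) * (2 * K + 56 + 1) = BB * (2 * K + 57)" using BB by simp
    ultimately show ?thesis by (simp only:)
  qed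
  have fin: "fold ex [Compute Sub 22 22 1] (M3, out) = (M3(22 := M3 22 - 1), out)"
    if "M3 22 > 0" "query_post M (M3(22 := M3 22 - 1))" for M3
  proof -
    have "M3 22 \<le> R" "M3 1 = 1"
      using that regs by (auto simp: query_post_def found_def frame_def)
    moreover have "R < 2 ^ w" using R_small less_word by blast
    ultimately show ?thesis using that by (simp add: alu_sub)
  qed
  show ?thesis
    unfolding query_def
  proof (intro ok_Seq ok_Code, unfold c1, rule ok_mono[OF bs], goal_cases)
    case (1 t1 s1)
    then obtain M2 where s1: "s1 = (M2, out)" "bsearch_inv M M2" "M2 27 = M2 28"
      by (cases s1) auto
    show ?case unfolding s1(1)
    proof (intro ok_Seq, rule ok_mono[OF sc[OF s1(2,3)]], goal_cases)
      case (1 t2 s2)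
      then obtain M3 where s2: "s2 = (M3, out)" "scan_inv M (M2 27) M3" "M3 22 = M2 27 * BB"
        by (cases s2) auto
      show ?case unfolding s2(1)
      proof (intro ok_Seq, rule ok_mono[OF scan[OF s1(2,3) s2(2,3)]], goal_cases)
        case (1 t3 s3)
        then obtain M4 where s3: "s3 = (M4, out)" "M4 22 > 0" "query_post M (M4(22 := M4 22 - 1))"
          by (cases s3) auto
        show ?case unfolding s3(1)
          using \<open>t1 \<le> _ \<and> _\<close> \<open>t2 = _ \<and> _\<close> \<open>t3 \<le> _ \<and> _\<close> s3(3)
          by (intro ok_Code) (simp only: fin[OF s3(2,3)], simp add: query_time_def)
      qed
    qed
  qed
qed

end

section \<open>Suffix arrays and runs\<close>

locale indexed_text =
  fixes \<sigma> :: nat and T :: "nat list" and n N :: nat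
  assumes terminated: "terminated_text \<sigma> T" and n: "n = length T" and N: "n + 2 \<le> N"
begin

definition suf :: "nat \<Rightarrow> nat list" where
  "suf q = drop (q - 1) T"

definition sym :: "nat \<Rightarrow> nat" where
  "sym i = sym_at T (SA T i)"

lemma n_pos: "n > 0"
  using terminated n by (simp add: terminated_text_def)

lemma suffix_array_props:
  "length (suffix_array T) = n" "set (suffix_array T) = {1..n}" "distinct (suffix_array T)"
  "sorted (map suf (suffix_array T))"
proof -
  have "suffix_array T = sort_key suf [1..<n + 1]"
    by (simp add: suffix_array_def suf_def[abs_def] n)
  then show "length (suffix_array T) = n" "set (suffix_array T) = {1..n}"
    "distinct (suffix_array T)" "sorted (map suf (suffix_array T))"
    by auto
qed

lemma SA_bij: "bij_betw (SA T) {1..n} {1..n}"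
proof -
  have "bij_betw (\<lambda>i. suffix_array T ! i) {..<n} {1..n}"
    using bij_betw_nth[of "suffix_array T"] suffix_array_props by auto
  moreover have "bij_betw (\<lambda>i. i - 1) {1..n} {..<n}"
    by (rule bij_betw_byWitness[of _ Suc]) auto
  ultimately have "bij_betw ((\<lambda>i. suffix_array T ! i) \<circ> (\<lambda>i. i - 1)) {1..n} {1..n}"
    using bij_betw_trans by blast
  then show ?thesis by (simp add: SA_def[abs_def] comp_def)
qed

lemma SA_in: "i \<in> {1..n} \<Longrightarrow> SA T i \<in> {1..n}"
  using SA_bij by (rule bij_betw_apply)

lemma SA_inj: "i \<in> {1..n} \<Longrightarrow> j \<in> {1..n} \<Longrightarrow> SA T i = SA T j \<Longrightarrow> i = j"
  using SA_bij unfolding bij_betw_def inj_on_def by blast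

lemma SA_inv_in: "q \<in> {1..n} \<Longrightarrow> SA_inv T q \<in> {1..n}"
  and SA_SA_inv: "q \<in> {1..n} \<Longrightarrow> SA T (SA_inv T q) = q"
  and SA_inv_SA: "i \<in> {1..n} \<Longrightarrow> SA_inv T (SA T i) = i"
  using SA_bij unfolding SA_inv_def n[symmetric] bij_betw_def
  by (metis inv_into_into, metis f_inv_into_f, metis inv_into_f_f)

lemma suf_inj: "p \<in> {1..n} \<Longrightarrow> q \<in> {1..n} \<Longrightarrow> suf p = suf q \<Longrightarrow> p = q"
proof -
  assume a: "p \<in> {1..n}" "q \<in> {1..n}" "suf p = suf q"
  then have "length T - (p - 1) = length T - (q - 1)" unfolding suf_def by (metis length_drop)
  moreover have "1 \<le> p" "p \<le> length T" "1 \<le> q" "q \<le> length T" using a n by auto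
  ultimately show ?thesis by linarith
qed

lemma SA_strict: "i \<in> {1..n} \<Longrightarrow> j \<in> {1..n} \<Longrightarrow> i < j \<longleftrightarrow> suf (SA T i) < suf (SA T j)"
proof -
  have *: "suf (SA T i) < suf (SA T j)" if a: "i \<in> {1..n}" "j \<in> {1..n}" "i < j" for i j
  proof -
    have "suf (suffix_array T ! (i - 1)) \<le> suf (suffix_array T ! (j - 1))"
      using sorted_nth_mono[OF suffix_array_props(4), of "i - 1" "j - 1"] a suffix_array_props(1)
      by auto
    moreover have "suf (SA T i) \<noteq> suf (SA T j)"
      using suf_inj[OF SA_in SA_in] SA_inj a by blast
    ultimately show ?thesis by (simp add: SA_def)
  qed
  assume "i \<in> {1..n}" "j \<in> {1..n}"
  then show ?thesis using *[of i j] *[of j i] by (metis less_asym linorder_neqE_nat order.irrefl)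
qed

lemma suf_Cons: "q \<in> {1..n} \<Longrightarrow> suf q = sym_at T q # suf (q + 1)"
  using Cons_nth_drop_Suc[of "q - 1" T] by (auto simp: suf_def sym_at_def n)

lemma SA_1: "SA T 1 = n"
proof -
  define i where "i = SA_inv T n"
  have i: "i \<in> {1..n}" "SA T i = n" using SA_inv_in SA_SA_inv n_pos by (auto simp: i_def)
  have "\<not> 1 < i"
  proof
    assume "1 < i"
    then have "SA T 1 \<noteq> n" using SA_inj[of 1 i] i n_pos by auto
    moreover have "SA T 1 \<in> {1..n}" using SA_in n_pos by simp
    ultimately have "sym_at T n < sym_at T (SA T 1)"
      using terminated by (simp add: terminated_text_def n)
    moreover have "suf (SA T 1) = sym_at T (SA T 1) # suf (SA T 1 + 1)" "suf n = sym_at T n # suf (n + 1)"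
      using suf_Cons \<open>SA T 1 \<in> {1..n}\<close> n_pos by auto
    ultimately have "suf (SA T i) < suf (SA T 1)" using i by simp
    then have "i < 1" using SA_strict[of i 1] i n_pos by simp
    with \<open>1 < i\<close> show False by simp
  qed
  then show ?thesis using i by (cases "i = 1") auto
qed

lemma SA_less: "i \<in> {2..n} \<Longrightarrow> SA T i \<in> {1..<n}"
  using SA_in[of i] SA_inj[of i 1] SA_1 by (cases "SA T i = n") auto

lemma Psi_in: "i \<in> {1..n} \<Longrightarrow> Psi T i \<in> {1..n}"
  unfolding Psi_def n[symmetric] using n_pos by (intro SA_inv_in) (auto simp: Suc_le_eq)

lemma SA_Psi: "i \<in> {2..n} \<Longrightarrow> SA T (Psi T i) = SA T i + 1"
  using SA_less[of i] SA_SA_inv[of "SA T i + 1"] by (simp add: Psi_def n[symmetric])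

lemma sym_1_less: "i \<in> {2..n} \<Longrightarrow> sym 1 < sym i"
  using SA_less[of i] terminated by (simp add: sym_def SA_1[simplified] terminated_text_def n)

lemma sym_in: "i \<in> {1..n} \<Longrightarrow> sym i \<in> {1..\<sigma>}"
proof -
  assume "i \<in> {1..n}"
  then have "SA T i \<in> {1..n}" by (rule SA_in)
  then have "sym i \<in> set T" by (auto simp: sym_def sym_at_def n)
  then show ?thesis using terminated by (auto simp: terminated_text_def)
qed

lemma sym_Psi_mono:
  assumes "i \<in> {1..n}" "j \<in> {1..n}" "i < j"
  shows "sym i < sym j \<or> sym i = sym j \<and> i \<ge> 2 \<and> Psi T i < Psi T j"
proof (cases "i = 1")
  case True then show ?thesis using sym_1_less[of j] assms by simp
next
  case False
  have s: "suf (SA T k) = sym k # suf (SA T (Psi T k))" if "k \<in> {2..n}" for k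
    using suf_Cons[of "SA T k"] SA_in[of k] SA_Psi[of k] that by (simp add: sym_def)
  have "suf (SA T i) < suf (SA T j)" using SA_strict assms by blast
  then have "sym i < sym j \<or> sym i = sym j \<and> suf (SA T (Psi T i)) < suf (SA T (Psi T j))"
    using s[of i] s[of j] assms False by auto
  then show ?thesis using SA_strict[of "Psi T i" "Psi T j"] Psi_in assms False by auto
qed

text \<open>\<open>V\<close> merges the functions \<open>\<Psi>\<^sub>c\<close> into a single increasing one. The wrap-around value of \<open>\<Psi>\<close> at
  the terminator is replaced by \<open>N - 1\<close>, which lies in no range of suffix-array positions, so that
  a pattern with an inner terminator has no match.\<close>

definition V :: "nat \<Rightarrow> nat" where
  "V i = sym i * N + (if i = 1 then N - 1 else Psi T i)"

lemma V_div: "i \<in> {1..n} \<Longrightarrow> V i div N = sym i"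
  and V_mod: "i \<in> {1..n} \<Longrightarrow> V i mod N = (if i = 1 then N - 1 else Psi T i)"
  using Psi_in[of i] N by (auto simp: V_def)

lemma V_bounds: "i \<in> {1..n} \<Longrightarrow> N < V i" "i \<in> {1..n} \<Longrightarrow> V i < (\<sigma> + 1) * N"
proof -
  assume i: "i \<in> {1..n}"
  have s: "1 \<le> sym i" "sym i \<le> \<sigma>" using sym_in[OF i] by auto
  have "1 * N \<le> sym i * N" using s by (intro mult_right_mono) auto
  moreover have "(if i = 1 then N - 1 else Psi T i) > 0" using Psi_in[OF i] N by auto
  ultimately show "N < V i" unfolding V_def by linarith
  have "V i < (sym i + 1) * N" using Psi_in[OF i] N by (auto simp: V_def)
  also have "\<dots> \<le> (\<sigma> + 1) * N" using s by (intro mult_right_mono) auto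
  finally show "V i < (\<sigma> + 1) * N" .
qed

lemma V_mono: "i \<in> {1..n} \<Longrightarrow> j \<in> {1..n} \<Longrightarrow> i < j \<Longrightarrow> V i < V j"
proof -
  assume a: "i \<in> {1..n}" "j \<in> {1..n}" "i < j"
  show ?thesis
  proof (cases "sym i < sym j")
    case True
    have "V i < (sym i + 1) * N" using Psi_in[OF a(1)] N by (auto simp: V_def)
    also have "\<dots> \<le> sym j * N" using True by (intro mult_right_mono) auto
    also have "\<dots> \<le> V j" by (simp add: V_def)
    finally show ?thesis .
  next
    case False
    then show ?thesis using sym_Psi_mono[OF a] a by (auto simp: V_def)
  qed
qed

definition starts :: "nat set" where
  "starts = {i \<in> {1..n}. i = 1 \<or> V i \<noteq> V (i - 1) + 1}"

lemma V_Suc_iff: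
  assumes "i \<in> {1..<n}"
  shows "V (i + 1) = V i + 1 \<longleftrightarrow> sym (i + 1) = sym i \<and> Psi T (i + 1) = Psi T i + 1"
proof (cases "sym (i + 1) = sym i")
  case True
  then have "i \<noteq> 1" using sym_1_less[of 2] assms by (auto simp: numeral_2_eq_2)
  then show ?thesis using True assms by (auto simp: V_def)
next
  case False
  then have "sym i < sym (i + 1)" using sym_Psi_mono[of i "i + 1"] assms by auto
  then have "(sym i + 1) * N \<le> sym (i + 1) * N" by (intro mult_right_mono) auto
  moreover have "V i < (sym i + 1) * N" "Psi T (i + 1) \<ge> 1"
    using Psi_in[of i] Psi_in[of "i + 1"] N assms by (auto simp: V_def)
  ultimately show ?thesis using False assms by (auto simp: V_def[of "i + 1"] V_def[of "Suc i"])
qed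

lemma consecutive_interval_iff:
  "consecutive_interval T a b \<longleftrightarrow> 1 \<le> a \<and> a \<le> b \<and> b \<le> n \<and> (\<forall>j\<in>{a<..b}. j \<notin> starts)"
proof -
  have ns: "Suc j \<notin> starts \<longleftrightarrow> sym (j + 1) = sym j \<and> Psi T (j + 1) = Psi T j + 1"
    if "j \<in> {1..<n}" for j
    using that V_Suc_iff[OF that] by (auto simp: starts_def)
  show ?thesis
  proof
    assume c: "consecutive_interval T a b"
    then obtain c where ab: "a \<le> b" and s: "{a..b} \<subseteq> sym_interval T c"
      and P: "\<forall>j\<in>{a..<b}. Psi T (j + 1) = Psi T j + 1" by (auto simp: consecutive_interval_def)
    have r: "1 \<le> a" "b \<le> n" using s ab by (auto simp: sym_interval_def n)
    have "j \<notin> starts" if "j \<in> {a<..b}" for j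
    proof -
      have "j > 0" using that by simp
      then obtain i where i: "j = Suc i" by (cases j) auto
      have "i \<in> sym_interval T c" "i + 1 \<in> sym_interval T c"
        using that i by (auto intro!: subsetD[OF s])
      then have "sym i = c" "sym (i + 1) = c" by (auto simp: sym_interval_def sym_def)
      then show ?thesis using ns[of i] P that r i by auto
    qed
    then show "1 \<le> a \<and> a \<le> b \<and> b \<le> n \<and> (\<forall>j\<in>{a<..b}. j \<notin> starts)" using ab r by auto
  next
    assume a: "1 \<le> a \<and> a \<le> b \<and> b \<le> n \<and> (\<forall>j\<in>{a<..b}. j \<notin> starts)"
    have l: "sym (j + 1) = sym j \<and> Psi T (j + 1) = Psi T j + 1" if "j \<in> {a..<b}" for j
      using ns[of j] a that by auto
    have same: "sym j = sym a" if "a \<le> j" "j \<le> b" for j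
      using that by (induction j rule: dec_induct) (use l in auto)
    have "j \<in> sym_interval T (sym a)" if "j \<in> {a..b}" for j
      using same[of j] a that by (simp add: sym_interval_def flip: sym_def n)
    then show "consecutive_interval T a b" using a l unfolding consecutive_interval_def by blast
  qed
qed

lemma starts_sub: "starts \<subseteq> {1..n}" and finite_starts: "finite starts" and one_in_starts: "1 \<in> starts"
  using n_pos by (auto simp: starts_def)

lemma interval_extend:
  "consecutive_interval T a b \<Longrightarrow> a \<notin> starts \<Longrightarrow> consecutive_interval T (a - 1) b"
proof -
  assume a: "consecutive_interval T a b" "a \<notin> starts"
  then have "a \<noteq> 1" using one_in_starts by auto
  moreover have "j \<notin> starts" if "j \<in> {a - 1<..b}" for j
    using a that by (cases "j = a") (auto simp: consecutive_interval_iff)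
  ultimately show ?thesis using a(1) by (auto simp: consecutive_interval_iff)
qed

lemma card_Psi_runs: "card (Psi_runs T) = card starts"
proof (rule bij_betw_same_card)
  show "bij_betw fst (Psi_runs T) starts"
  proof (rule bij_betw_imageI)
    show "inj_on fst (Psi_runs T)"
    proof (rule inj_onI, clarsimp)
      fix a b b' assume r: "(a, b) \<in> Psi_runs T" "(a, b') \<in> Psi_runs T"
      then have ci: "consecutive_interval T a b" "consecutive_interval T a b'"
        by (auto simp: Psi_runs_def)
      then have le: "a \<le> b" "a \<le> b'" by (auto simp: consecutive_interval_iff)
      have "{a..b} = {a..b'}"
      proof (cases "b \<le> b'")
        case True
        have "consecutive_interval T a b' \<and> {a..b} \<subseteq> {a..b'} \<longrightarrow> {a..b'} = {a..b}"
          using r(1) unfolding Psi_runs_def by blast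
        with True ci show ?thesis by auto
      next
        case False
        have "consecutive_interval T a b \<and> {a..b'} \<subseteq> {a..b} \<longrightarrow> {a..b} = {a..b'}"
          using r(2) unfolding Psi_runs_def by blast
        with False ci show ?thesis by auto
      qed
      then show "b = b'" using le by (simp add: Icc_eq_Icc)
    qed
    show "fst ` Psi_runs T = starts"
    proof (intro equalityI subsetI)
      fix a assume "a \<in> fst ` Psi_runs T"
      then obtain b where ab: "(a, b) \<in> Psi_runs T" by auto
      then have ci: "consecutive_interval T a b" by (simp add: Psi_runs_def)
      show "a \<in> starts"
      proof (rule ccontr)
        assume "a \<notin> starts"
        then have "consecutive_interval T (a - 1) b" using interval_extend ci by blast
        moreover have "{a..b} \<subseteq> {a - 1..b}" by auto
        moreover have "consecutive_interval T (a - 1) b \<and> {a..b} \<subseteq> {a - 1..b} \<longrightarrow>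
            {a - 1..b} = {a..b}" using ab unfolding Psi_runs_def by blast
        ultimately have "{a - 1..b} = {a..b}" by blast
        moreover have "1 \<le> a" "a \<le> b" using ci by (auto simp: consecutive_interval_iff)
        ultimately show False by (auto simp: Icc_eq_Icc)
      qed
    next
      fix a assume a: "a \<in> starts"
      define B where "B = {b. consecutive_interval T a b}"
      have fin: "finite B" by (rule finite_subset[of _ "{..n}"]) (auto simp: B_def consecutive_interval_iff)
      have "a \<in> B" using a starts_sub by (auto simp: B_def consecutive_interval_iff)
      define b where "b = Max B"
      have b: "consecutive_interval T a b" using Max_in[OF fin] \<open>a \<in> B\<close> by (auto simp: b_def B_def)
      have "{a'..b'} = {a..b}" if ci: "consecutive_interval T a' b'" "{a..b} \<subseteq> {a'..b'}" for a' b'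
      proof -
        have le: "a' \<le> a" "b \<le> b'" using ci b by (auto simp: consecutive_interval_iff)
        have "a \<le> b" using b by (auto simp: consecutive_interval_iff)
        have "\<not> a' < a" using ci(1) a le \<open>a \<le> b\<close> by (auto simp: consecutive_interval_iff)
        then have "a' = a" using le by simp
        then have "b' \<le> b" using ci(1) Max_ge[OF fin] by (simp add: b_def B_def)
        with \<open>a' = a\<close> le show ?thesis by simp
      qed
      then have "(a, b) \<in> Psi_runs T" using b by (auto simp: Psi_runs_def)
      then show "a \<in> fst ` Psi_runs T" by force
    qed
  qed
qed

definition rank :: "nat \<Rightarrow> nat \<Rightarrow> bool" where
  "rank v x \<longleftrightarrow> x \<le> n \<and> (\<forall>i\<in>{1..n}. V i < v \<longleftrightarrow> i \<le> x)"

definition matches :: "nat list \<Rightarrow> nat set" where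
  "matches X = {i \<in> {1..n}. SA T i \<in> occurrences T X}"

lemma occurrences_Cons:
  "q \<in> occurrences T (c # X) \<longleftrightarrow> q \<in> {1..n} \<and> sym_at T q = c \<and> (X = [] \<or> q + 1 \<in> occurrences T X)"
  by (auto simp: occurrences_def n less_Suc_eq_0_disj)

lemma matches_Cons:
  assumes "X = [] \<and> lo = 0 \<and> hi = N \<or> X \<noteq> [] \<and> 1 \<le> lo \<and> hi \<le> n + 1 \<and> matches X = {lo..<hi}"
  shows "matches (c # X) = {i \<in> {1..n}. c * N + lo \<le> V i \<and> V i < c * N + hi}"
proof -
  define \<psi> where "\<psi> i = (if i = 1 then N - 1 else Psi T i)" for i
  have V: "V i = sym i * N + \<psi> i" "\<psi> i < N" if "i \<in> {1..n}" for i
    using Psi_in[OF that] N by (auto simp: V_def \<psi>_def)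
  have hi: "hi \<le> N" using assms N by auto
  have iff: "c * N + lo \<le> V i \<and> V i < c * N + hi \<longleftrightarrow> sym i = c \<and> lo \<le> \<psi> i \<and> \<psi> i < hi"
    if i: "i \<in> {1..n}" for i
  proof
    assume a: "c * N + lo \<le> V i \<and> V i < c * N + hi"
    then have "c * N \<le> V i" "V i < (c + 1) * N" using hi by auto
    then have "V i div N = c"
      by (metis Suc_eq_plus1 div_nat_eqI mult.commute)
    then have "sym i = c" using V_div[OF i] by simp
    then show "sym i = c \<and> lo \<le> \<psi> i \<and> \<psi> i < hi" using a V[OF i] by simp
  qed (use V[OF i] in auto)
  have "SA T i \<in> occurrences T (c # X) \<longleftrightarrow> sym i = c \<and> lo \<le> \<psi> i \<and> \<psi> i < hi" if i: "i \<in> {1..n}" for i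
  proof (cases "X = []")
    case True
    then show ?thesis using assms V(2)[OF i] SA_in[OF i] by (simp add: occurrences_Cons sym_def)
  next
    case False
    with assms have r: "1 \<le> lo" "hi \<le> n + 1" "matches X = {lo..<hi}" by auto
    show ?thesis
    proof (cases "i = 1")
      case True
      have "n + 1 \<notin> occurrences T X" using False by (auto simp: occurrences_def n)
      moreover have "\<not> \<psi> i < hi" using True r(2) N by (simp add: \<psi>_def)
      ultimately show ?thesis using True False by (simp add: occurrences_Cons SA_1[simplified])
    next
      case ne: False
      then have i2: "i \<in> {2..n}" using i by auto
      have "SA T i + 1 \<in> occurrences T X \<longleftrightarrow> Psi T i \<in> matches X"
        using SA_Psi[OF i2] Psi_in[OF i] by (simp add: matches_def)
      then show ?thesis using SA_in[OF i] False ne r(3)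
        by (simp add: occurrences_Cons sym_def \<psi>_def)
    qed
  qed
  then show ?thesis using iff by (auto simp: matches_def)
qed

lemma matches_rank:
  assumes "matches X = {i \<in> {1..n}. u \<le> V i \<and> V i < v}" "rank u x" "rank v y"
  shows "matches X = {x + 1..<y + 1}"
proof (rule set_eqI)
  fix i
  show "i \<in> matches X \<longleftrightarrow> i \<in> {x + 1..<y + 1}"
  proof (cases "i \<in> {1..n}")
    case True
    then have "V i < u \<longleftrightarrow> i \<le> x" "V i < v \<longleftrightarrow> i \<le> y" using assms(2,3) by (auto simp: rank_def)
    then have "u \<le> V i \<longleftrightarrow> x + 1 \<le> i" "V i < v \<longleftrightarrow> i < y + 1" by linarith+
    then show ?thesis unfolding assms(1) using True by simp
  next
    case False
    moreover have "y \<le> n" using assms(3) by (simp add: rank_def)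
    ultimately show ?thesis unfolding assms(1) by auto
  qed
qed

lemma rank_mono: "rank u x \<Longrightarrow> rank v y \<Longrightarrow> u \<le> v \<Longrightarrow> x \<le> y"
  unfolding rank_def by (cases "x = 0") (auto dest!: bspec[of _ _ x])

lemma occurrences_image: "X \<noteq> [] \<Longrightarrow> occurrences T X = SA T ` matches X"
proof -
  assume "X \<noteq> []"
  then have "occurrences T X \<subseteq> {1..n}" by (cases X) (auto simp: occurrences_Cons)
  then have "q = SA T (SA_inv T q) \<and> SA_inv T q \<in> matches X" if "q \<in> occurrences T X" for q
    using that SA_SA_inv[of q] SA_inv_in[of q] unfolding matches_def by auto
  then show ?thesis by (auto simp: matches_def)
qed

definition ends :: "nat set" where
  "ends = {e \<in> {1..n}. e = n \<or> e + 1 \<in> starts}"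

lemma one_in_ends: "1 \<in> ends"
proof (cases "n = 1")
  case False
  then have "2 \<in> {2..n}" using n_pos by auto
  then have "sym 1 < sym 2" by (rule sym_1_less)
  then have "V (1 + 1) \<noteq> V 1 + 1" using V_Suc_iff[of 1] False n_pos by (simp add: numeral_2_eq_2)
  then show ?thesis using False n_pos by (auto simp: ends_def starts_def numeral_2_eq_2)
next
  case True
  then show ?thesis unfolding ends_def by auto
qed

text \<open>Inside a run, the suffix-array neighbours of the text positions \<open>q\<close> and \<open>q + 1\<close> differ by one
  as well. Hence the offset from \<open>q\<close> to its neighbour is the same as at the next position that
  lies at the end of a run.\<close>

lemma SA_Suc:
  assumes "i \<in> {1..<n}" "e \<in> ends" "SA T i \<le> SA T e"
    and "\<And>e'. e' \<in> ends \<Longrightarrow> SA T i \<le> SA T e' \<Longrightarrow> SA T e \<le> SA T e'"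
  shows "e < n \<and> SA T (i + 1) + (SA T e - SA T i) = SA T (e + 1)"
  using assms
proof (induction "SA T e - SA T i" arbitrary: i)
  case 0
  then have "i = e" using SA_inj[of i e] by (auto simp: ends_def)
  then show ?case using 0 by auto
next
  case (Suc d)
  have "i \<notin> ends" using Suc.prems(4)[of i] Suc.hyps(2) by auto
  then have i: "i \<in> {2..n}" "i + 1 \<in> {2..n}" using Suc.prems(1) one_in_ends by (cases "i = 1"; auto)+
  have "i + 1 \<notin> starts" using \<open>i \<notin> ends\<close> Suc.prems(1) by (auto simp: ends_def)
  then have "V (i + 1) = V i + 1" using Suc.prems(1) by (auto simp: starts_def)
  then have psi: "Psi T (i + 1) = Psi T i + 1" using V_Suc_iff Suc.prems(1) by blast
  have S: "SA T (Psi T i) = SA T i + 1" "SA T (Psi T i + 1) = SA T (i + 1) + 1"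
    using SA_Psi[OF i(1)] SA_Psi[OF i(2)] psi by auto
  have "Psi T i \<in> {1..<n}" using Psi_in[of i] Psi_in[of "i + 1"] psi i by auto
  moreover have "SA T e \<le> SA T e'" if "e' \<in> ends" "SA T (Psi T i) \<le> SA T e'" for e'
    using Suc.prems(4)[of e'] that S by simp
  ultimately have "e < n \<and> SA T (Psi T i + 1) + (SA T e - SA T (Psi T i)) = SA T (e + 1)"
  proof (intro Suc.hyps(1))
    show "d = SA T e - SA T (Psi T i)" "SA T (Psi T i) \<le> SA T e" using S Suc.hyps(2) by auto
  qed (use Suc.prems(2) in auto)
  then show ?case using S Suc.hyps(2) by linarith
qed

end

section \<open>The record table of a text\<close>

locale sampled_text = indexed_text \<sigma> T n N for \<sigma> T n N +
  fixes xs :: "nat list" and K :: nat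
  assumes xs_sorted: "sorted_wrt (<) xs" and xs_sub: "set xs \<subseteq> {1..n}" and K_pos: "K > 0"
begin

definition r :: nat where
  "r = card starts"

abbreviation N0 :: nat where
  "N0 \<equiv> length xs"

definition st :: "nat \<Rightarrow> nat" where
  "st k = (if k < r then sorted_list_of_set starts ! k else n + 1)"

definition sval :: "nat \<Rightarrow> nat" where
  "sval j = (if j < N0 then xs ! j else V (st (j - N0)))"

definition slen :: "nat \<Rightarrow> nat" where
  "slen j = (if j < N0 then 1 else st (Suc (j - N0)) - st (j - N0))"

lemma r_pos: "r > 0"
  using one_in_starts finite_starts by (auto simp: r_def card_gt_0_iff)

lemma length_starts: "length (sorted_list_of_set starts) = r"
  by (simp add: r_def)

lemma st_in: "k < r \<Longrightarrow> st k \<in> starts"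
  using nth_mem[of k "sorted_list_of_set starts"] finite_starts by (simp add: st_def r_def)

lemma st_range: "k < r \<Longrightarrow> st k \<in> {1..n}"
  using st_in starts_sub by blast

lemma st_last: "st r = n + 1"
  by (simp add: st_def)

lemma st_less: "i < j \<Longrightarrow> j \<le> r \<Longrightarrow> st i < st j"
proof -
  assume a: "i < j" "j \<le> r"
  show ?thesis
  proof (cases "j = r")
    case True then show ?thesis using st_range[of i] a by (simp add: st_last)
  next
    case False
    then show ?thesis using sorted_wrt_nth_less[OF strict_sorted_list_of_set, of i j starts] a
      by (simp add: st_def r_def)
  qed
qed

lemma st_le: "i \<le> j \<Longrightarrow> j \<le> r \<Longrightarrow> st i \<le> st j"
  using st_less[of i j] by (cases "i = j") auto

lemma starts_st: "a \<in> starts \<Longrightarrow> \<exists>k<r. a = st k"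
proof -
  assume "a \<in> starts"
  then have "a \<in> set (sorted_list_of_set starts)" using finite_starts by simp
  then obtain k where "k < r" "a = sorted_list_of_set starts ! k"
    unfolding in_set_conv_nth length_starts by auto
  then show ?thesis unfolding st_def by auto
qed

lemma st_0: "st 0 = 1"
proof -
  obtain k where k: "k < r" "1 = st k" using starts_st one_in_starts by blast
  then have "st 0 \<le> 1" using st_le[of 0 k] by simp
  then show ?thesis using st_range[of 0] r_pos by simp
qed

lemma V_diff: "a \<le> b \<Longrightarrow> 1 \<le> a \<Longrightarrow> b \<le> n \<Longrightarrow> V a + (b - a) \<le> V b"
proof (induction b rule: dec_induct)
  case (step b)
  then have "V b < V (Suc b)" by (intro V_mono) auto
  with step show ?case by simp
qed simp

lemma run_of:
  assumes i: "i \<in> {1..n}"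
  obtains k where "k < r" "st k \<le> i" "i < st (Suc k)" "V i = V (st k) + (i - st k)"
proof -
  define k where "k = Max {k. k < r \<and> st k \<le> i}"
  have fin: "finite {k. k < r \<and> st k \<le> i}" by simp
  have "0 \<in> {k. k < r \<and> st k \<le> i}" using r_pos st_0 i by simp
  then have "k \<in> {k. k < r \<and> st k \<le> i}" unfolding k_def using Max_in[OF fin] by blast
  then have k: "k < r" "st k \<le> i" by auto
  have lt: "i < st (Suc k)"
  proof (cases "Suc k < r")
    case True
    show ?thesis
    proof (rule ccontr)
      assume "\<not> ?thesis"
      then have "Suc k \<le> k" unfolding k_def[symmetric] using True Max_ge[OF fin, of "Suc k"] by (simp add: k_def)
      then show False by simp
    qed
  next
    case False then show ?thesis using k i by (simp add: st_def)
  qed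
  have run: "V j = V (st k) + (j - st k)" if "st k \<le> j" "j \<le> i" for j
    using that
  proof (induction j rule: dec_induct)
    case (step j)
    have "Suc j \<notin> starts"
    proof
      assume "Suc j \<in> starts"
      then obtain k' where k': "k' < r" "Suc j = st k'" using starts_st by blast
      show False
      proof (cases "k' \<le> k")
        case True then show False using st_le[of k' k] k k' step by simp
      next
        case False then show False using st_le[of "Suc k" k'] k' step lt by simp
      qed
    qed
    then have "V (Suc j) = V j + 1" using step i st_range[OF k(1)] by (auto simp: starts_def)
    then show ?case using step by simp
  qed simp
  show thesis using that[OF k lt run[OF k(2) order.refl]] .
qed

lemma xs_less: "i < j \<Longrightarrow> j < N0 \<Longrightarrow> xs ! i < xs ! j"
  using xs_sorted by (rule sorted_wrt_nth_less)

lemma xs_range: "j < N0 \<Longrightarrow> xs ! j \<in> {1..n}"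
  using xs_sub nth_mem by blast

sublocale records K "N0 + r" sval slen
proof
  show "K > 0" by (rule K_pos)
  show "N0 + r > 0" using r_pos by simp
  show "slen j > 0" if "j < N0 + r" for j
    using st_less[of "j - N0" "Suc (j - N0)"] that by (auto simp: slen_def)
  show "sval j + slen j \<le> sval (Suc j)" if "Suc j < N0 + r" for j
  proof (cases "Suc j < N0")
    case True
    then show ?thesis using xs_less[of j "Suc j"] by (simp add: sval_def slen_def)
  next
    case False
    show ?thesis
    proof (cases "j < N0")
      case True
      then have "Suc j - N0 = 0" "xs ! j \<le> n" using False xs_range[of j] by auto
      moreover have "N < V (st 0)" using V_bounds st_range r_pos by blast
      ultimately show ?thesis using True False N by (simp add: sval_def slen_def)
    next
      case f: False
      define k where "k = j - N0"
      have k: "Suc k < r" "Suc j - N0 = Suc k" using that f by (auto simp: k_def)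
      then show ?thesis
        using V_diff[of "st k" "st (Suc k)"] st_less[of k "Suc k"] st_range[of k] st_range[of "Suc k"] f
        by (simp add: sval_def slen_def flip: k_def)
    qed
  qed
qed

lemma ps_aux: "j \<le> N0 \<Longrightarrow> ps j = j"
  unfolding ps_def by (simp add: slen_def)

lemma ps_run: "k \<le> r \<Longrightarrow> ps (N0 + k) = N0 + st k - 1"
proof (induction k)
  case 0 then show ?case by (simp add: ps_aux st_0)
next
  case (Suc k)
  then show ?case using st_less[of k "Suc k"] st_range[of k] by (simp add: ps_Suc slen_def[of "N0 + k"])
qed

lemma ps_R: "ps (N0 + r) = N0 + n"
  by (simp add: ps_run st_last)

lemma ve_run: "k < r \<Longrightarrow> ve (Suc (N0 + k)) = V (st k) + (st (Suc k) - st k)"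
  by (simp add: ve_Suc sval_def[of "N0 + k"] slen_def[of "N0 + k"])

lemma ve_aux: "j < N0 \<Longrightarrow> ve (Suc j) = xs ! j + 1"
  by (simp add: ve_Suc sval_def[of j] slen_def[of j])

lemma V_less_ve: "k < r \<Longrightarrow> st k \<le> i \<Longrightarrow> i < st (Suc k) \<Longrightarrow> V i = V (st k) + (i - st k) \<Longrightarrow>
  V i < ve (Suc (N0 + k))"
  by (simp add: ve_run)

lemma ve_R: "ve (N0 + r) \<le> (\<sigma> + 1) * N"
proof -
  obtain k where k: "r = Suc k" using r_pos by (cases r) auto
  have "V (st k) + (n - st k) \<le> V n" using V_diff st_range[of k] k by simp
  moreover have "V n < (\<sigma> + 1) * N" using V_bounds(2)[of n] n_pos by simp
  moreover have "ve (N0 + r) = V (st k) + (n + 1 - st k)"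
    using ve_run[of k] st_last k by simp
  ultimately show ?thesis using st_range[of k] k by auto
qed

lemma found_run:
  assumes f: "found p v j" and p: "ps (N0 + r) \<le> p" and v: "N \<le> v"
  shows "N0 \<le> j" "j < N0 + r" "Suc j = N0 + r \<or> v < ve (Suc j)"
proof -
  show j: "j < N0 + r" using f by (simp add: found_def)
  have "ps (Suc j) \<le> p" using ps_mono[of "Suc j" "N0 + r"] p j by simp
  then show *: "Suc j = N0 + r \<or> v < ve (Suc j)" using f by (auto simp: found_def)
  show "N0 \<le> j"
  proof (rule ccontr)
    assume "\<not> ?thesis"
    then have "ve (Suc j) \<le> n + 1" "Suc j \<noteq> N0 + r"
      using xs_range[of j] r_pos by (auto simp: ve_aux)
    then show False using * v N by simp
  qed
qed

definition clamp :: "nat \<Rightarrow> nat \<Rightarrow> nat" where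
  "clamp v j = (if v < sval j then sval j else if ve (Suc j) < v then ve (Suc j) else v)"

lemma found_rank:
  assumes f: "found p v j" and p: "ps (N0 + r) \<le> p" and v: "N \<le> v"
  shows "rank v (clamp v j - sval j + ps j - N0)"
proof -
  note j = found_run[OF assms]
  define k a b where "k = j - N0" and "a = st k" and "b = st (Suc k)"
  have k: "k < r" "j = N0 + k" using j by (auto simp: k_def)
  have ab: "a < b" "1 \<le> a" "b \<le> n + 1"
    using st_less[of k "Suc k"] st_range[of k] st_le[of "Suc k" r] k by (auto simp: a_def b_def st_last)
  have sj: "sval j = V a" "ve (Suc j) = V a + (b - a)"
    using k ve_run[of k] by (auto simp: sval_def a_def b_def)
  define x where "x = clamp v j - sval j + ps j - N0"
  have "ps j = N0 + a - 1" using ps_run[of k] k by (simp add: a_def)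
  then have x: "x = a - 1 + (clamp v j - V a)" using ab by (simp add: x_def sj(1))
  have cl: "clamp v j - V a \<le> b - a" by (auto simp: clamp_def sj)
  have "V i < v \<longleftrightarrow> i \<le> x" if i: "i \<in> {1..n}" for i
  proof -
    obtain k' where k': "k' < r" "st k' \<le> i" "i < st (Suc k')" "V i = V (st k') + (i - st k')"
      using run_of[OF i] by blast
    consider "k' < k" | "k' = k" | "k' > k" by linarith
    then show ?thesis
    proof cases
      case 1
      have "ve (Suc (N0 + k')) \<le> v" using f 1 k by (simp add: found_def)
      moreover have "st (Suc k') \<le> a" using st_le[of "Suc k'" k] 1 k by (simp add: a_def)
      ultimately show ?thesis using V_less_ve[OF k'] x k' by simp
    next
      case 2
      then have *: "a \<le> i" "i < b" "V i = V a + (i - a)" using k' by (auto simp: a_def b_def)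
      show ?thesis
      proof (cases "v < V a")
        case True
        then have "clamp v j = V a" by (simp add: clamp_def sj)
        then show ?thesis using True * x ab by auto
      next
        case nl: False
        show ?thesis
        proof (cases "V a + (b - a) < v")
          case True
          then have "clamp v j - V a = b - a" using nl by (simp add: clamp_def sj)
          then show ?thesis using True * x ab by auto
        next
          case False
          then have "clamp v j = v" using nl by (simp add: clamp_def sj)
          then show ?thesis using False nl * x ab by auto
        qed
      qed
    next
      case 3
      then have "Suc j \<noteq> N0 + r" using k k' by simp
      then have "v < ve (Suc j)" using j by simp
      also have "\<dots> \<le> ve (N0 + k')" using 3 k k' by (intro ve_mono) auto
      also have "\<dots> \<le> sval (N0 + k')" using k' by (intro ve_le_sv) simp
      also have "\<dots> \<le> V i" using k' by (simp add: sval_def)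
      finally have "v < V i" .
      moreover have "b \<le> i" using st_le[of "Suc k" k'] 3 k' by (simp add: b_def)
      ultimately show ?thesis using x cl ab by auto
    qed
  qed
  moreover have "x \<le> n" using x cl ab by simp
  ultimately show ?thesis by (simp add: rank_def flip: x_def)
qed

lemma found_hit:
  assumes f: "found p v j" and p: "ps (N0 + r) \<le> p" and v: "N \<le> v"
    and i: "i = clamp v j - sval j + ps j - N0 + 1" "i \<le> n"
  shows "v < sval j \<Longrightarrow> i = st (j - N0)" "\<not> v < sval j \<Longrightarrow> V i = v"
proof -
  note j = found_run[OF f p v]
  define k where "k = j - N0"
  have k: "k < r" "j = N0 + k" using j by (auto simp: k_def)
  have ab: "st k < st (Suc k)" "1 \<le> st k" using st_less[of k "Suc k"] st_range[of k] k by auto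
  have i': "i = st k + (clamp v j - sval j)"
    using i(1) ps_run[of k] k ab by simp
  show "v < sval j \<Longrightarrow> i = st (j - N0)" using i' by (simp add: clamp_def k_def)
  assume nl: "\<not> v < sval j"
  have sj: "sval j = V (st k)" "ve (Suc j) = V (st k) + (st (Suc k) - st k)"
    using k ve_run[of k] by (auto simp: sval_def)
  have lt: "v < ve (Suc j)"
  proof (rule ccontr)
    assume a: "\<not> v < ve (Suc j)"
    then have "Suc k = r" using j k by simp
    moreover have "clamp v j = ve (Suc j)" using a nl by (simp add: clamp_def)
    ultimately show False using i' i(2) sj ab by (simp add: st_last)
  qed
  then have i'': "i = st k + (v - V (st k))" "i < st (Suc k)"
    using i' nl sj ab by (auto simp: clamp_def)
  have "i \<in> {1..n}" using i(2) i'' ab by simp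
  then obtain k' where k': "k' < r" "st k' \<le> i" "i < st (Suc k')" "V i = V (st k') + (i - st k')"
    by (rule run_of)
  have "k' = k"
  proof (rule ccontr)
    assume "k' \<noteq> k"
    then consider "Suc k' \<le> k" | "Suc k \<le> k'" by linarith
    then show False
      using st_le[of "Suc k'" k] st_le[of "Suc k" k'] k k' i'' by cases auto
  qed
  then show "V i = v" using k' i'' nl sj by simp
qed

lemma found_position:
  assumes f: "found p v j" and v: "ve (N0 + r) \<le> v" and i: "i \<in> {1..n}" "p = N0 + i - 1"
  shows "j < N0 + r" "ps j \<le> p" "sval j + (p - ps j) = V i"
proof -
  show j: "j < N0 + r" using f by (simp add: found_def)
  obtain k where k: "k < r" "st k \<le> i" "i < st (Suc k)" "V i = V (st k) + (i - st k)"
    using run_of[OF i(1)] by blast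
  have 1: "ps (N0 + k) \<le> p" "p < ps (Suc (N0 + k))"
    using ps_run[of k] ps_run[of "Suc k"] k i st_range[of k] by auto
  have "j = N0 + k"
  proof (rule ccontr)
    assume "j \<noteq> N0 + k"
    then consider "N0 + k < j" | "j < N0 + k" by linarith
    then show False
    proof cases
      case 1
      then show False using f \<open>p < _\<close> by (auto simp: found_def)
    next
      case 2
      have "ve (Suc j) \<le> v" using ve_mono[of "Suc j" "N0 + r"] v j by simp
      moreover have "ps (Suc j) \<le> p" using ps_mono[of "Suc j" "N0 + k"] 2 1 by simp
      ultimately show False using f 2 k by (auto simp: found_def)
    qed
  qed
  then show "ps j \<le> p" "sval j + (p - ps j) = V i"
    using 1 ps_run[of k] k i st_range[of k] by (auto simp: sval_def)
qed

lemma found_aux: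
  assumes f: "found p v j" and p: "ps (N0 + r) \<le> p" and y: "y \<in> set xs" "v \<le> y"
  shows "j < N0" "sval j = xs ! j" "v \<le> xs ! j" "\<And>y. y \<in> set xs \<Longrightarrow> v \<le> y \<Longrightarrow> xs ! j \<le> y"
proof -
  have jk: "j \<le> k" if "k < N0" "v \<le> xs ! k" for k
  proof (rule ccontr)
    assume "\<not> j \<le> k"
    then have "k < j" by simp
    then have "ve (Suc k) \<le> v" using f unfolding found_def by blast
    then show False using that by (simp add: ve_aux)
  qed
  obtain k where "k < N0" "y = xs ! k" using y by (auto simp: in_set_conv_nth)
  then show j: "j < N0" using jk[of k] y by simp
  then show "sval j = xs ! j" by (simp add: sval_def)
  have "ps (Suc j) \<le> p" using ps_mono[of "Suc j" "N0 + r"] p j by simp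
  then have "v < ve (Suc j)" using f j r_pos by (auto simp: found_def)
  then show "v \<le> xs ! j" using j by (simp add: ve_aux)
  show "xs ! j \<le> y" if yy: "y \<in> set xs" "v \<le> y" for y
  proof -
    obtain k where k: "k < N0" "y = xs ! k" using yy by (auto simp: in_set_conv_nth)
    then have "j \<le> k" using jk yy by simp
    then show ?thesis using k xs_less[of j k] by (cases "j = k") auto
  qed
qed

lemma found_aux_hit:
  assumes f: "found p v j" and p: "ps (N0 + r) \<le> p" and v: "v \<le> n"
  shows "sval j = v \<longleftrightarrow> v \<in> set xs" "v \<in> set xs \<Longrightarrow> j < N0 \<and> xs ! j = v"
proof -
  show *: "j < N0 \<and> xs ! j = v" if "v \<in> set xs"
    using found_aux[OF f p that] that by fastforce
  have j: "j < N0 + r" using f by (simp add: found_def)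
  show "sval j = v \<longleftrightarrow> v \<in> set xs"
  proof
    assume a: "sval j = v"
    have "j < N0"
    proof (rule ccontr)
      assume "\<not> j < N0"
      then have "sval j > N" using V_bounds(1)[OF st_range[of "j - N0"]] j by (simp add: sval_def)
      then show False using a v N by simp
    qed
    then show "v \<in> set xs" using a nth_mem[of j xs] by (simp add: sval_def)
  qed (use * in \<open>auto simp: sval_def\<close>)
qed

end

section \<open>Layout of the index\<close>

lemma drop_concat_map:
  "j < m \<Longrightarrow> \<exists>rest'. drop (\<Sum>i<j. length (f i)) (concat (map f [0..<m]) @ rest) = f j @ rest'"
proof -
  assume j: "j < m"
  have "[0..<m] = [0..<j] @ [j..<m]" using j by (metis le_add_diff_inverse less_imp_le upt_add_eq_append zero_le)
  then have u: "[0..<m] = [0..<j] @ j # [Suc j..<m]" using j by (simp add: upt_conv_Cons)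
  have "length (concat (map f [0..<j])) = (\<Sum>i<j. length (f i))"
    by (simp add: length_concat comp_def interv_sum_list_conv_sum_set_nat atLeast0LessThan)
  then show ?thesis unfolding u by simp
qed

lemma drop_concat_const:
  assumes "j < m" "\<And>i. i < m \<Longrightarrow> length (f i) = l"
  shows "\<exists>rest'. drop (j * l) (concat (map f [0..<m]) @ rest) = f j @ rest'"
proof -
  have "(\<Sum>i<j. length (f i)) = j * l" using assms by simp
  then show ?thesis using drop_concat_map[OF assms(1), of f rest] by simp
qed

lemma length_concat_const:
  assumes "\<And>i. i < m \<Longrightarrow> length (f i) = l"
  shows "length (concat (map f [0..<m])) = m * l"
proof -
  have "length (concat (map f [0..<m])) = (\<Sum>i<m. length (f i))"
    by (simp add: length_concat comp_def interv_sum_list_conv_sum_set_nat atLeast0LessThan)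
  then show ?thesis using assms by simp
qed

locale layout = sampled_text \<sigma> T n N xs K for \<sigma> T n N xs K +
  fixes l lam L BS mode :: nat and arr perm :: "nat list"
  assumes N_eq: "N = 2 ^ l" and BS: "0 < BS" and L_pos: "0 < L"
    and arr: "length arr = N0" "\<And>a. a \<in> set arr \<Longrightarrow> a < N"
    and perm: "length perm = N0" "\<And>p. p \<in> set perm \<Longrightarrow> p < N0 \<and> p < 2 ^ lam"
begin

abbreviation R :: nat where
  "R \<equiv> N0 + r"

definition blocks :: nat where
  "blocks = (R - 1) div BS"

definition params :: "nat list" where
  "params = [l, N0, R, mode, lam, L, BS]"

definition header :: "bool list" where
  "header = concat (map (chunk_code K) params)"

definition block_head :: "nat \<Rightarrow> bool list" where
  "block_head b = fixed_code L (ve (b * BS)) @ fixed_code L (ps (b * BS)) @ fixed_code L (so (b * BS))"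

definition body :: "bool list" where
  "body = concat (map (\<lambda>k. fixed_code lam (perm ! k)) [0..<N0]) @
     concat (map (\<lambda>k. fixed_code l (arr ! k)) [0..<N0]) @
     concat (map (\<lambda>b. block_head (Suc b)) [0..<blocks]) @ concat (map rec_code [0..<R])"

definition csa_bits :: "bool list" where
  "csa_bits = header @ body"

definition offA :: nat where "offA = N0 * lam"
definition offH :: nat where "offH = N0 * l + offA"
definition offS :: nat where "offS = blocks * (3 * L) + offH"

lemma length_block_head: "length (block_head b) = 3 * L"
  by (simp add: block_head_def)

lemma drop_body: "drop (length header + p) csa_bits = drop p body"
  by (simp add: csa_bits_def)

lemma drop_perm:
  "k < N0 \<Longrightarrow> \<exists>rest. drop (length header + k * lam) csa_bits = fixed_code lam (perm ! k) @ rest"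
  unfolding drop_body body_def by (rule drop_concat_const) auto

lemma drop_arr:
  "k < N0 \<Longrightarrow> \<exists>rest. drop (length header + (k * l + offA)) csa_bits = fixed_code l (arr ! k) @ rest"
proof -
  assume "k < N0"
  have "drop (k * l + offA) body = drop (k * l) (concat (map (\<lambda>k. fixed_code l (arr ! k)) [0..<N0]) @
     concat (map (\<lambda>b. block_head (Suc b)) [0..<blocks]) @ concat (map rec_code [0..<R]))"
    unfolding body_def by (subst drop_drop[symmetric]) (simp add: length_concat_const offA_def)
  then show ?thesis unfolding drop_body
    using drop_concat_const[OF \<open>k < N0\<close>, of "\<lambda>k. fixed_code l (arr ! k)" l] by (simp only: length_fixed_code)
qed

lemma drop_heads:
  "b < blocks \<Longrightarrow> \<exists>rest. drop (length header + offH + b * (3 * L)) csa_bits = block_head (Suc b) @ rest"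
proof -
  assume b: "b < blocks"
  have "drop (offH + b * (3 * L)) body = drop (b * (3 * L)) (
     concat (map (\<lambda>b. block_head (Suc b)) [0..<blocks]) @ concat (map rec_code [0..<R]))"
    unfolding body_def offH_def
    by (subst add.commute, subst drop_drop[symmetric]) (simp add: length_concat_const offA_def add.commute)
  then show ?thesis unfolding add.assoc drop_body
    using drop_concat_const[OF b, of "\<lambda>b. block_head (Suc b)" "3 * L"] by (simp add: length_block_head)
qed

lemma drop_stream:
  "j < R \<Longrightarrow> \<exists>rest. drop (length header + offS + so j) csa_bits = rec_code j @ rest"
proof -
  assume j: "j < R"
  have "drop (offS + so j) body = drop (so j) (concat (map rec_code [0..<R]))"
    unfolding body_def offS_def offH_def
    by (subst add.commute, subst drop_drop[symmetric])
       (simp add: length_concat_const length_block_head offA_def add_ac)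
  then show ?thesis unfolding add.assoc drop_body
    using drop_concat_map[OF j, of rec_code "[]"] by (simp add: so_def)
qed

lemma length_csa_bits:
  "length csa_bits = length header + N0 * (lam + l) + blocks * (3 * L) + so R"
proof -
  have "length (concat (map rec_code [0..<R])) = so R"
    by (simp add: length_concat comp_def interv_sum_list_conv_sum_set_nat atLeast0LessThan so_def)
  then show ?thesis
    by (simp add: csa_bits_def body_def length_concat_const length_block_head algebra_simps)
qed

end

locale csa = layout \<sigma> T n N xs K l lam L BS mode arr perm
  for \<sigma> T n N xs K l lam L BS mode arr perm +
  fixes w rate :: nat and P :: "nat list"
  assumes small_values: "(\<sigma> + 1) * N < 2 ^ L" "N0 + n < 2 ^ L" "so R < 2 ^ L"
      "\<And>x. x \<in> set params \<Longrightarrow> x < 2 ^ L"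
    and word_size: "2 * L + K + 3 \<le> w" "length csa_bits < 2 ^ (w - 1)"
    and codes_fit: "\<And>x. x < 2 ^ L \<Longrightarrow> length (chunk_code K x) < w"
    and text_samples: "mode \<noteq> 0 \<Longrightarrow> set xs = {i \<in> {1..n}. (n - SA T i) mod (rate + 1) = 0} \<and>
      (\<forall>k<N0. arr ! (perm ! k) = SA T (xs ! k))"
    and run_samples: "mode = 0 \<Longrightarrow> set xs = SA T ` ends \<and> N0 = r \<and> (\<forall>j<r. arr ! j = SA T (st j)) \<and>
      (\<forall>k<N0. \<forall>e\<in>ends. e < n \<longrightarrow> xs ! k = SA T e \<longrightarrow> arr ! (perm ! k) = SA T (e + 1))"
    and pattern: "P \<noteq> []" "set P \<subseteq> {1..\<sigma>}"
begin

sublocale table w csa_bits P K R sval slen BS L "length header" offH offS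
proof unfold_locales
  fix b assume "b > 0" "b * BS < R"
  then have "b * BS \<le> R - 1" by simp
  then have "b - 1 < blocks" using \<open>b > 0\<close> BS by (auto simp: blocks_def less_eq_div_iff_mult_less_eq Suc_le_eq[symmetric])
  from drop_heads[OF this] show "\<exists>rest. drop (length header + offH + (b - 1) * (3 * L)) csa_bits =
       fixed_code L (ve (b * BS)) @ fixed_code L (ps (b * BS)) @ fixed_code L (so (b * BS)) @ rest"
    using \<open>b > 0\<close> by (simp add: block_head_def)
qed (use BS L_pos small_values word_size codes_fit drop_stream ve_R ps_R in auto)

lemma nb_blocks: "nb = blocks"
  by (simp add: nb_def blocks_def)

definition regs :: "(nat \<Rightarrow> nat) \<Rightarrow> bool" where
  "regs M \<longleftrightarrow> table_regs M \<and> M 50 = N \<and> M 51 = l \<and> M 52 = N0 \<and> M 53 = lam \<and> M 54 = 2 ^ lam \<and>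
     M 55 = offA \<and> M 56 = mode"

lemma regs_cong: "regs M \<Longrightarrow> (\<forall>a. a < 10 \<or> a \<in> {40..<60} \<longrightarrow> M' a = M a) \<Longrightarrow> regs M'"
  unfolding regs_def table_regs_def base_regs_def by simp

lemma base_regsD: "regs M \<Longrightarrow> M 0 = w \<and> M 1 = 1 \<and> M 2 = 2 ^ (w - 1) \<and> M 3 = 0"
  by (simp add: regs_def table_regs_def base_regs_def)

end

text \<open>Cells: 0 to 3 hold constants, 10 to 39 are scratch space, 40 to 56 hold the parameters of the
  index, and the cells from 60 on hold the variables of the search.\<close>

definition read_params :: "nat \<Rightarrow> nat list \<Rightarrow> instr list" where
  "read_params K cs = concat (map (\<lambda>c. decode_code K @ [Compute Add c 16 3]) cs)"

definition init_code :: "nat \<Rightarrow> instr list" where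
  "init_code K =
    [Literal 1 1, Compute Sub 4 0 1, Compute Shl 2 1 4, Literal 10 0, Literal 11 1] @
    read_params K [51, 52, 49, 56, 53, 44, 48] @
    [Compute Shl 50 1 51, Compute Shl 54 1 53, Compute Shl 46 1 44, Compute Add 40 10 3,
     Compute Add 41 11 3, Compute Sub 47 49 1, Compute Div 47 47 48, Literal 45 3,
     Compute Mul 45 45 44, Compute Mul 55 52 53, Compute Mul 42 52 51, Compute Add 42 42 55,
     Compute Mul 43 47 45, Compute Add 43 43 42]"

context csa
begin

lemma read_params:
  assumes "base_regs M" "at_pos M p"
    and "drop p csa_bits = concat (map (chunk_code K) vs) @ rest"
    and "length cs = length vs" "distinct cs" "\<forall>c\<in>set cs. c \<ge> 20" "\<forall>x\<in>set vs. x < 2 ^ L"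
  shows "\<exists>M'. fold ex (read_params K cs) (M, out) = (M', out) \<and>
    at_pos M' (p + length (concat (map (chunk_code K) vs))) \<and>
    (\<forall>i<length vs. M' (cs ! i) = vs ! i) \<and> (\<forall>a. a < 10 \<or> a \<ge> 20 \<and> a \<notin> set cs \<longrightarrow> M' a = M a)"
  using assms
proof (induction vs arbitrary: cs M p)
  case Nil
  then show ?case by (simp add: read_params_def)
next
  case (Cons v vs)
  then obtain c cs' where cs: "cs = c # cs'" by (cases cs) auto
  have "drop p csa_bits = chunk_code K v @ concat (map (chunk_code K) vs) @ rest"
    using Cons.prems(3) by simp
  note d = this
  have "length (chunk_code K v) < w" using codes_fit Cons.prems(7) by simp
  from decode[OF Cons.prems(1,2) d D_less K this, of out]
  obtain M1 where M1: "fold ex (decode_code K) (M, out) = (M1, out)" "M1 16 = v"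
    "at_pos M1 (p + length (chunk_code K v))" "\<forall>a. a < 10 \<or> a \<ge> 20 \<longrightarrow> M1 a = M a" by blast
  define M2 where "M2 = M1(c := v)"
  have "v < 2 ^ w" using less_word Cons.prems(7) by simp
  moreover have "M1 3 = 0" using M1(4) Cons.prems(1) by (simp add: base_regs_def)
  ultimately have c: "fold ex [Compute Add c 16 3] (M1, out) = (M2, out)"
    using M1(2) by (simp add: M2_def alu_add)
  have c20: "c \<ge> 20" using Cons.prems(6) cs by simp
  have "base_regs M2" "at_pos M2 (p + length (chunk_code K v))"
    using M1(3,4) Cons.prems(1) c20 by (auto simp: M2_def base_regs_def at_pos_def)
  from Cons.IH[OF this drop_later[OF d], of cs'] Cons.prems(4-7) cs
  obtain M3 where M3: "fold ex (read_params K cs') (M2, out) = (M3, out)"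
    "at_pos M3 (p + length (chunk_code K v) + length (concat (map (chunk_code K) vs)))"
    "\<forall>i<length vs. M3 (cs' ! i) = vs ! i" "\<forall>a. a < 10 \<or> a \<ge> 20 \<and> a \<notin> set cs' \<longrightarrow> M3 a = M2 a"
    by auto
  have "M3 c = v" using M3(4) c20 Cons.prems(5) cs by (simp add: M2_def)
  then have "\<forall>i<length (v # vs). M3 (cs ! i) = (v # vs) ! i"
    using M3(3) by (auto simp: cs less_Suc_eq_0_disj)
  moreover have "fold ex (read_params K cs) (M, out) = (M3, out)"
    using M1(1) c M3(1) by (simp add: read_params_def cs)
  moreover have "\<forall>a. a < 10 \<or> a \<ge> 20 \<and> a \<notin> set cs \<longrightarrow> M3 a = M a"
    using M3(4) M1(4) c20 by (auto simp: cs M2_def)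
  ultimately show ?case using M3(2) by (auto simp: add.assoc)
qed

lemma params_less: "l < 2 ^ L" "N0 < 2 ^ L" "R < 2 ^ L" "mode < 2 ^ L" "lam < 2 ^ L" "L < 2 ^ L" "BS < 2 ^ L"
  using small_values(4) by (simp_all add: params_def)

lemma offsets_less: "offS < 2 ^ w" "offH < 2 ^ w" "offA < 2 ^ w" "length header < 2 ^ w"
  "N0 * l < 2 ^ w" "blocks * (3 * L) < 2 ^ w"
proof -
  have "length header + offS \<le> length csa_bits"
    by (simp add: length_csa_bits offS_def offH_def offA_def algebra_simps)
  then show "offS < 2 ^ w" "offH < 2 ^ w" "offA < 2 ^ w" "length header < 2 ^ w"
    "N0 * l < 2 ^ w" "blocks * (3 * L) < 2 ^ w"
    using D_less by (simp_all add: offS_def offH_def)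
qed

lemma l_less: "l < w"
proof -
  have "1 * N \<le> (\<sigma> + 1) * N" by (intro mult_right_mono) auto
  then have "N < 2 ^ L" using small_values(1) by linarith
  then have "(2::nat) ^ l < 2 ^ L" using N_eq by simp
  then show ?thesis using word_size by simp
qed

lemma init_regs:
  assumes lam: "lam < w"
  shows "\<exists>M. fold ex (init_code K) ((\<lambda>_. 0)(0 := w), []) = (M, []) \<and> regs M"
proof -
  define M1 where "M1 = ((\<lambda>_. 0)(0 := w, 1 := 1, 4 := w - 1, 2 := 2 ^ (w - 1), 10 := 0, 11 := 1) :: nat \<Rightarrow> nat)"
  have w: "w < 2 ^ w" "1 < (2::nat) ^ w" "(2::nat) ^ (w - 1) < 2 ^ w"
    using w_pos one_less_power[of "2::nat" w] by auto
  have c1: "fold ex [Literal 1 1, Compute Sub 4 0 1, Compute Shl 2 1 4, Literal 10 0, Literal 11 1]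
      ((\<lambda>_. 0)(0 := w), []) = (M1, [])"
    using w w_pos by (simp add: M1_def alu_sub)
  have b1: "base_regs M1" "at_pos M1 0" using w_pos by (simp_all add: M1_def base_regs_def at_pos_def)
  have "drop 0 csa_bits = concat (map (chunk_code K) params) @ body"
    by (simp add: csa_bits_def header_def)
  from read_params[OF b1 this, of "[51, 52, 49, 56, 53, 44, 48]" "[]"] small_values(4)
  obtain M2 where M2: "fold ex (read_params K [51, 52, 49, 56, 53, 44, 48]) (M1, []) = (M2, [])"
    "at_pos M2 (length header)"
    "\<forall>i<length params. M2 ([51, 52, 49, 56, 53, 44, 48] ! i) = params ! i"
    "\<forall>a. a < 10 \<or> a \<ge> 20 \<and> a \<notin> set [51, 52, 49, 56, 53, 44, 48] \<longrightarrow> M2 a = M1 a"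
    by (auto simp: header_def params_def)
  have v2: "M2 51 = l" "M2 52 = N0" "M2 49 = R" "M2 56 = mode" "M2 53 = lam" "M2 44 = L" "M2 48 = BS"
    using M2(3)[rule_format, of 0] M2(3)[rule_format, of 1] M2(3)[rule_format, of 2]
      M2(3)[rule_format, of 3] M2(3)[rule_format, of 4] M2(3)[rule_format, of 5]
      M2(3)[rule_format, of 6] by (simp_all add: params_def)
  have b2: "M2 0 = w" "M2 1 = 1" "M2 2 = 2 ^ (w - 1)" "M2 3 = 0"
    using M2(4) by (simp_all add: M1_def)
  have p2: "M2 10 = length header div w" "M2 11 = 2 ^ (length header mod w)"
    using M2(2) by (simp_all add: at_pos_def)
  define M3 where "M3 = M2(50 := N, 54 := 2 ^ lam, 46 := 2 ^ L, 40 := length header div w,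
     41 := 2 ^ (length header mod w), 47 := blocks, 45 := 3 * L, 55 := offA, 42 := offH, 43 := offS)"
  have less: "length header div w < 2 ^ w" "(2::nat) ^ (length header mod w) < 2 ^ w"
    "(2::nat) ^ L < 2 ^ w" "(2::nat) ^ l < 2 ^ w" "(2::nat) ^ lam < 2 ^ w" "3 * L < 2 ^ w" "3 < (2::nat) ^ w"
  proof -
    show "length header div w < 2 ^ w" using offsets_less(4) by (meson div_le_dividend le_less_trans)
    show "(2::nat) ^ (length header mod w) < 2 ^ w" using w_pos by simp
    show "(2::nat) ^ L < 2 ^ w" "(2::nat) ^ l < 2 ^ w" "(2::nat) ^ lam < 2 ^ w"
      using word_size l_less lam by simp_all
    have "3 * L < 2 * w" using word_size by simp
    also have "2 * w \<le> 2 ^ w"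
    proof -
      have "(2::nat) ^ w = 2 * 2 ^ (w - 1)" using w_pos by (simp flip: power_Suc)
      moreover have "w - 1 < 2 ^ (w - 1)" by (rule less_exp)
      ultimately show ?thesis by linarith
    qed
    finally show "3 * L < 2 ^ w" .
    have "(2::nat) ^ 2 \<le> 2 ^ w" using word_size by (intro power_increasing) auto
    then show "3 < (2::nat) ^ w" by simp
  qed
  have Rw: "R - 1 < 2 ^ w" "R < 2 ^ w" using params_less(3) less_word by (meson less_imp_diff_less)+
  have c3: "fold ex [Compute Shl 50 1 51, Compute Shl 54 1 53, Compute Shl 46 1 44, Compute Add 40 10 3,
     Compute Add 41 11 3, Compute Sub 47 49 1, Compute Div 47 47 48, Literal 45 3,
     Compute Mul 45 45 44, Compute Mul 55 52 53, Compute Mul 42 52 51, Compute Add 42 42 55,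
     Compute Mul 43 47 45, Compute Add 43 43 42] (M2, []) = (M3, [])"
  proof -
    have "alu w Shl 1 l = N" using less(4) by (simp flip: N_eq)
    moreover have "alu w Sub R 1 = R - 1" using Rw R by (intro alu_sub) (simp_all add: Suc_le_eq)
    moreover have "alu w Div (R - 1) BS = blocks" by (simp add: blocks_def)
    moreover have "alu w Shl 1 lam = 2 ^ lam" "alu w Shl 1 L = 2 ^ L"
      "alu w Add (length header div w) 0 = length header div w"
      "alu w Add (2 ^ (length header mod w)) 0 = 2 ^ (length header mod w)"
      "3 mod 2 ^ w = (3::nat)"
      "alu w Mul 3 L = 3 * L" "alu w Mul N0 lam = offA" "alu w Mul N0 l = N0 * l"
      "alu w Add (N0 * l) offA = offH" "alu w Mul blocks (3 * L) = blocks * (3 * L)"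
      "alu w Add (blocks * (3 * L)) offH = offS"
      using less offsets_less
      by (simp_all add: alu_add alu_mul flip: blocks_def offA_def offH_def offS_def)
    ultimately show ?thesis using v2 b2 p2 by (simp add: M3_def del: alu.simps One_nat_def)
  qed
  have "regs M3"
    using v2 b2 by (simp add: regs_def table_regs_def base_regs_def M3_def nb_blocks)
  moreover have "fold ex (init_code K) ((\<lambda>_. 0)(0 := w), []) = (M3, [])"
    by (simp only: init_code_def fold_append comp_apply c1 M2(1) c3)
  ultimately show ?thesis by blast
qed

end

section \<open>Time-bounded Hoare triples\<close>

context word_ram
begin

definition triple :: "(state \<Rightarrow> bool) \<Rightarrow> com \<Rightarrow> nat \<Rightarrow> (state \<Rightarrow> bool) \<Rightarrow> bool" where
  "triple I c b Q \<longleftrightarrow> (\<forall>s. I s \<longrightarrow> ok c (\<lambda>t s'. t \<le> b \<and> Q s') s)"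

lemma triple_Code:
  "(\<And>M out. I (M, out) \<Longrightarrow> Q (fold ex is (M, out))) \<Longrightarrow> length is \<le> b \<Longrightarrow> triple I (Code is) b Q"
  unfolding triple_def by (auto intro!: ok_Code)

lemma triple_Seq: "triple I c a J \<Longrightarrow> triple J d b Q \<Longrightarrow> triple I (c ;; d) (a + b) Q"
  unfolding triple_def
proof (intro allI impI, rule ok_Seq, goal_cases)
  case (1 s)
  then have "ok c (\<lambda>t s'. t \<le> a \<and> J s') s" by blast
  then show ?case
  proof (rule ok_mono)
    fix t s' assume t: "t \<le> a \<and> J s'"
    with 1 have "ok d (\<lambda>t s'. t \<le> b \<and> Q s') s'" by blast
    then show "ok d (\<lambda>t'. (\<lambda>t s'. t \<le> a + b \<and> Q s') (t + t')) s'" by (rule ok_mono) (use t in auto)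
  qed
qed

lemma triple_When:
  "triple (\<lambda>s. I s \<and> fst s a \<noteq> 0) c b Q \<Longrightarrow> (\<And>s. I s \<Longrightarrow> fst s a = 0 \<Longrightarrow> Q s) \<Longrightarrow>
   triple I (When a c) (b + 1) Q"
  unfolding triple_def
proof (intro allI impI, rule ok_When, goal_cases)
  case (2 s)
  then have "ok c (\<lambda>t s'. t \<le> b \<and> Q s') s" by blast
  then show ?case by (rule ok_mono) simp
qed simp

lemma triple_Rep:
  assumes "\<And>k. triple (I k) c b (\<lambda>s. if fst s a = 0 then k > 0 \<and> I (k - 1) s else Q s)"
  shows "triple (I k) (Rep c a) ((k + 1) * (b + 1)) Q"
  unfolding triple_def
proof (intro allI impI)
  fix s assume "I k s"
  then show "ok (Rep c a) (\<lambda>t s'. t \<le> (k + 1) * (b + 1) \<and> Q s') s"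
    by (rule ok_Rep[where I = I]) (use assms in \<open>unfold triple_def, blast\<close>)
qed

lemma triple_weaken:
  "triple I c b Q \<Longrightarrow> (\<And>s. I' s \<Longrightarrow> I s) \<Longrightarrow> b \<le> b' \<Longrightarrow> (\<And>s. Q s \<Longrightarrow> Q' s) \<Longrightarrow> triple I' c b' Q'"
  unfolding triple_def
proof (intro allI impI, goal_cases)
  case (1 s)
  then have "ok c (\<lambda>t s'. t \<le> b \<and> Q s') s" by blast
  then show ?case by (rule ok_mono) (use 1 in auto)
qed

lemma triple_pointwise:
  "(\<And>M out. I (M, out) \<Longrightarrow> triple (\<lambda>s. s = (M, out)) c b Q) \<Longrightarrow> triple I c b Q"
  unfolding triple_def by auto

end

definition sample_code :: "instr list" where
  "sample_code = [Compute Mul 16 22 53] @ fetch_code 54 @ [Compute Mul 16 16 51, Compute Add 16 16 55] @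
     fetch_code 50"

definition start_code :: "instr list" where
  "start_code = [Compute Sub 16 22 52, Compute Mul 16 16 51, Compute Add 16 16 55] @ fetch_code 50"

definition lower :: "nat \<Rightarrow> com" where
  "lower K = query K ;;
     Code [Compute Add 32 26 3, Compute Less 31 26 23, Compute Less 33 20 26] ;;
     When 31 (Code [Compute Add 32 23 3]) ;;
     When 33 (Code [Compute Add 32 20 3]) ;;
     Code [Compute Sub 32 32 23, Compute Add 32 32 24, Compute Sub 32 32 52, Compute Add 32 32 1]"

lemma length_sample_code: "length sample_code = 45"
  by (simp add: sample_code_def length_fetch_code)

lemma length_start_code: "length start_code = 24"
  by (simp add: start_code_def length_fetch_code)

context csa
begin

lemma stream_in_bits: "length header + offS < length csa_bits"
proof -
  have "so R > 0"
  proof -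
    have "length (rec_code 0) \<le> so R" unfolding so_def using R by (intro member_le_sum) auto
    moreover have "length (rec_code 0) > 0" by (simp add: rec_code_def chunk_code_def)
    ultimately show ?thesis by linarith
  qed
  then show ?thesis by (simp add: length_csa_bits offS_def offH_def offA_def algebra_simps)
qed

lemma fetch_arr:
  assumes "regs M" "M 16 = k * l + offA" "k < N0"
  shows "\<exists>M'. fold ex (fetch_code 50) (M, out) = (M', out) \<and> M' 16 = arr ! k \<and>
    (\<forall>a. a < 10 \<or> a \<ge> 20 \<longrightarrow> M' a = M a)"
proof -
  obtain rest where rest: "drop (length header + (k * l + offA)) csa_bits = fixed_code l (arr ! k) @ rest"
    using drop_arr[OF assms(3)] by blast
  have "k * l \<le> N0 * l" using assms(3) by simp
  then have "length header + (k * l + offA) < length csa_bits"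
    using stream_in_bits unfolding offS_def offH_def by linarith
  moreover have "arr ! k < 2 ^ l" using arr assms(3) N_eq by simp
  moreover have "M 50 = 2 ^ l" using assms(1) by (simp add: regs_def flip: N_eq)
  ultimately show ?thesis
    using assms(1,2) l_less D_less w_pos
    by (intro fetch[OF _ _ _ _ _ _ _ _ rest]) (auto simp: regs_def table_regs_def)
qed

lemma sample:
  assumes M: "regs M" and lam: "lam < w"
  shows "\<exists>M'. fold ex sample_code (M, out) = (M', out) \<and> (\<forall>a. a < 10 \<or> a \<ge> 20 \<longrightarrow> M' a = M a) \<and>
    (M 22 < N0 \<longrightarrow> M' 16 = arr ! (perm ! M 22))"
proof (cases "M 22 < N0")
  case False
  have "list_all (quiet {10..<20}) sample_code"
    using quiet_codes by (simp add: sample_code_def)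
  from fold_quiet[OF this, of M out] False show ?thesis by force
next
  case True
  define k where "k = M 22"
  have k: "k < N0" using True by (simp add: k_def)
  define q where "q = perm ! k"
  have q: "q < N0" "q < 2 ^ lam" using perm k by (auto simp: q_def)
  have kl: "k * lam \<le> offA" "q * l \<le> N0 * l" using k q by (auto simp: offA_def)
  then have kw: "k * lam < 2 ^ w" "q * l < 2 ^ w" "q * l + offA < 2 ^ w"
    using offsets_less(2,3) unfolding offH_def by linarith+
  have r: "M 51 = l" "M 53 = lam" "M 54 = 2 ^ lam" "M 55 = offA" using M by (auto simp: regs_def)
  define M1 where "M1 = M(16 := k * lam)"
  have c1: "fold ex [Compute Mul 16 22 53] (M, out) = (M1, out)"
    using r kw by (simp add: M1_def alu_mul k_def)
  obtain rest where rest: "drop (length header + k * lam) csa_bits = fixed_code lam q @ rest"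
    using drop_perm[OF k] by (auto simp: q_def)
  have "length header + k * lam < length csa_bits"
    using stream_in_bits kl unfolding offS_def offH_def by linarith
  then have "\<exists>M'. fold ex (fetch_code 54) (M1, out) = (M', out) \<and> M' 16 = q \<and>
    (\<forall>a. a < 10 \<or> a \<ge> 20 \<longrightarrow> M' a = M1 a)"
    using M q lam D_less w_pos r
    by (intro fetch[OF _ _ _ _ _ _ _ _ rest]) (auto simp: M1_def regs_def table_regs_def base_regs_def)
  then obtain M2 where M2: "fold ex (fetch_code 54) (M1, out) = (M2, out)" "M2 16 = q"
    "\<forall>a. a < 10 \<or> a \<ge> 20 \<longrightarrow> M2 a = M1 a" by blast
  define M3 where "M3 = M2(16 := q * l + offA)"
  have c3: "fold ex [Compute Mul 16 16 51, Compute Add 16 16 55] (M2, out) = (M3, out)"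
    using M2 r kw by (simp add: M3_def M1_def alu_mul alu_add)
  have "regs M3" using M M2(3) by (elim regs_cong) (auto simp: M3_def M1_def)
  from fetch_arr[OF this _ q(1), of out] obtain M4 where
    "fold ex (fetch_code 50) (M3, out) = (M4, out)" "M4 16 = arr ! q"
    "\<forall>a. a < 10 \<or> a \<ge> 20 \<longrightarrow> M4 a = M3 a" by (auto simp: M3_def)
  then show ?thesis using c1 M2 c3 by (auto simp: sample_code_def q_def k_def M3_def M1_def)
qed

lemma start:
  assumes M: "regs M"
  shows "\<exists>M'. fold ex start_code (M, out) = (M', out) \<and> (\<forall>a. a < 10 \<or> a \<ge> 20 \<longrightarrow> M' a = M a) \<and>
    (N0 \<le> M 22 \<and> M 22 < R \<and> M 22 - N0 < N0 \<longrightarrow> M' 16 = arr ! (M 22 - N0))"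
proof (cases "N0 \<le> M 22 \<and> M 22 < R \<and> M 22 - N0 < N0")
  case False
  have "list_all (quiet {10..<20}) start_code"
    using quiet_codes by (simp add: start_code_def)
  from fold_quiet[OF this, of M out] False show ?thesis by force
next
  case True
  define k where "k = M 22 - N0"
  have k: "k < N0" "N0 \<le> M 22" "M 22 < 2 ^ w"
    using True params_less(3) less_word[of "M 22"] by (auto simp: k_def)
  have "k * l \<le> N0 * l" using k by simp
  then have kw: "k * l < 2 ^ w" "k * l + offA < 2 ^ w" 
    using offsets_less(2) unfolding offH_def by linarith+
  have r: "M 51 = l" "M 52 = N0" "M 55 = offA" using M by (auto simp: regs_def)
  define M1 where "M1 = M(16 := k * l + offA)"
  have c1: "fold ex [Compute Sub 16 22 52, Compute Mul 16 16 51, Compute Add 16 16 55] (M, out) = (M1, out)"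
    using r kw k by (simp add: M1_def alu_mul alu_add alu_sub flip: k_def)
  have "regs M1" using M by (elim regs_cong) (auto simp: M1_def)
  from fetch_arr[OF this _ k(1), of out] obtain M4 where
    "fold ex (fetch_code 50) (M1, out) = (M4, out)" "M4 16 = arr ! k"
    "\<forall>a. a < 10 \<or> a \<ge> 20 \<longrightarrow> M4 a = M1 a" by (auto simp: M1_def)
  then show ?thesis using c1 by (auto simp: start_code_def k_def M1_def)
qed

lemma query_triple:
  assumes "regs M" "nb < 2 ^ Suc k"
  shows "triple (\<lambda>s. s = (M, out)) (query K) (query_time k) (\<lambda>s. snd s = out \<and> query_post M (fst s))"
  using query_ok[of M k out] assms by (simp add: triple_def regs_def)

lemma clamp_bounds: "j < R \<Longrightarrow> sval j \<le> clamp v j" "j < R \<Longrightarrow> clamp v j \<le> ve (Suc j)"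
  unfolding clamp_def ve_Suc by auto

lemma big_bounds: "ps R \<le> 2 ^ (w - 1)" "ve R \<le> 2 ^ (w - 1)" "(2::nat) ^ (w - 1) < 2 ^ w"
proof -
  have "(2::nat) ^ L \<le> 2 ^ (w - 1)" using word_size by (intro power_increasing) auto
  then show "ps R \<le> 2 ^ (w - 1)" "ve R \<le> 2 ^ (w - 1)" using small by linarith+
  show "(2::nat) ^ (w - 1) < 2 ^ w" using w_pos by simp
qed

lemma lower_triple:
  assumes M: "regs M" "M 25 = 2 ^ (w - 1)" "N \<le> M 26" "M 26 < 2 ^ L" and k: "nb < 2 ^ Suc k"
  shows "triple (\<lambda>s. s = (M, out)) (lower K) (query_time k + 11)
    (\<lambda>s. snd s = out \<and> query_post M (fst s) \<and>
       fst s 32 = clamp (M 26) (fst s 22) - sval (fst s 22) + ps (fst s 22) - N0 + 1)"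
proof -
  let ?code1 = "[Compute Add 32 26 3, Compute Less 31 26 23, Compute Less 33 20 26]"
  let ?code2 = "[Compute Sub 32 32 23, Compute Add 32 32 24, Compute Sub 32 32 52,
      Compute Add 32 32 1]"
  define v where "v = M 26"
  define Q where "Q s \<longleftrightarrow> snd s = out \<and> query_post M (fst s)" for s :: state
  have fr: "query_post M (M'(a := x))" if q: "query_post M M'" and a: "a \<in> {31, 32, 33}" for M' a x
  proof -
    have "frame M (M'(a := x))" unfolding frame_def
    proof (intro allI impI)
      fix b :: nat assume b: "b < 10 \<or> b \<ge> 40 \<or> b \<in> {25, 26}"
      then have "b \<noteq> a" using a by auto
      moreover have "M' b = M b" using q b unfolding query_post_def frame_def by blast
      ultimately show "(M'(a := x)) b = M b" by simp
    qed
    moreover have "a \<noteq> 20" "a \<noteq> 22" "a \<noteq> 23" "a \<noteq> 24" using a by auto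
    ultimately show ?thesis using q unfolding query_post_def by simp
  qed
  have Qf: "M' 26 = v" "M' 3 = 0" "M' 1 = 1" "M' 52 = N0" "M' 23 = sval (M' 22)" "M' 24 = ps (M' 22)"
      "M' 20 = ve (Suc (M' 22))" "found (2 ^ (w - 1)) v (M' 22)" "M' 22 < R" "N0 \<le> M' 22"
    if "query_post M M'" for M'
  proof -
    show f: "found (2 ^ (w - 1)) v (M' 22)"
      using that unfolding query_post_def M(2) v_def by blast
    show "N0 \<le> M' 22" "M' 22 < R" 
      using found_run[OF f big_bounds(1)] M(3) unfolding v_def by blast+
    show "M' 23 = sval (M' 22)" "M' 24 = ps (M' 22)" "M' 20 = ve (Suc (M' 22))"
      using that unfolding query_post_def by blast+
    have fr': "M' a = M a" if "a < 10 \<or> a \<ge> 40 \<or> a \<in> {25, 26}" for a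
      using that \<open>query_post M M'\<close> unfolding query_post_def frame_def by blast
    show "M' 26 = v" "M' 3 = 0" "M' 1 = 1" using fr'[of 26] fr'[of 3] fr'[of 1] base_regsD[OF M(1)]
      by (simp_all add: v_def)
    have "M 52 = N0" using M(1) unfolding regs_def by blast
    then show "M' 52 = N0" using fr'[of 52] by simp
  qed
  have vw: "v < 2 ^ w" using less_word[OF M(4)] by (simp add: v_def)
  have vew: "sval j \<le> ve (Suc j)" "ve (Suc j) < 2 ^ L" "sval j < 2 ^ w" "ve (Suc j) < 2 ^ w"
     "ps j + ve (Suc j) + 1 < 2 ^ w" if "j < R" for j
  proof -
    show 1: "sval j \<le> ve (Suc j)" by (simp add: ve_Suc)
    have "ve (Suc j) \<le> ve R" "ps j \<le> ps R" using that by (auto intro!: ve_mono ps_mono)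
    then have 2: "ve (Suc j) < 2 ^ L" "ps j < 2 ^ L" using small by auto
    then have "ps j + ve (Suc j) + 1 < 2 ^ Suc L" by simp
    also have "(2::nat) ^ Suc L \<le> 2 ^ w" using word_size by (intro power_increasing) auto
    finally show "ps j + ve (Suc j) + 1 < 2 ^ w" .
    show "ve (Suc j) < 2 ^ L" by fact
    show "sval j < 2 ^ w" "ve (Suc j) < 2 ^ w" using 1 2 by (auto intro!: less_word)
  qed
  have t1: "triple Q (Code ?code1) 3
    (\<lambda>s. Q s \<and> fst s 32 = v \<and> fst s 31 = of_bool (v < sval (fst s 22)) \<and>
       fst s 33 = of_bool (ve (Suc (fst s 22)) < v))"
  proof (rule triple_Code)
    fix M' out' assume "Q (M', out')"
    then have q: "query_post M M'" "out' = out" by (auto simp: Q_def)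
    show "Q (fold ex ?code1 (M', out')) \<and>
      fst (fold ex ?code1 (M', out')) 32 = v \<and>
      fst (fold ex ?code1 (M', out')) 31 =
        of_bool (v < sval (fst (fold ex ?code1 (M', out')) 22)) \<and>
      fst (fold ex ?code1 (M', out')) 33 =
        of_bool (ve (Suc (fst (fold ex ?code1 (M', out')) 22)) < v)"
      using Qf[OF q(1)] q vw by (simp add: alu_add Q_def fr)
  qed simp
  have t2: "triple (\<lambda>s. Q s \<and> fst s 32 = v \<and> fst s 31 = of_bool (v < sval (fst s 22)) \<and>
       fst s 33 = of_bool (ve (Suc (fst s 22)) < v)) (When 31 (Code [Compute Add 32 23 3])) (1 + 1)
    (\<lambda>s. Q s \<and> fst s 32 = max v (sval (fst s 22)) \<and> fst s 33 = of_bool (ve (Suc (fst s 22)) < v))"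
    by (rule triple_When, rule triple_Code)
       (auto simp: Q_def alu_add fr Qf vew of_bool_eq_0_iff)
  have t3: "triple (\<lambda>s. Q s \<and> fst s 32 = max v (sval (fst s 22)) \<and> fst s 33 = of_bool (ve (Suc (fst s 22)) < v))
     (When 33 (Code [Compute Add 32 20 3])) (1 + 1)
     (\<lambda>s. Q s \<and> fst s 32 = clamp v (fst s 22))"
  proof (rule triple_When, rule triple_Code)
    fix M' out' assume a: "((Q (M', out') \<and> fst (M', out') 32 = max v (sval (fst (M', out') 22)) \<and>
      fst (M', out') 33 = of_bool (ve (Suc (fst (M', out') 22)) < v)) \<and> fst (M', out') 33 \<noteq> 0)"
    then have "ve (Suc (M' 22)) < v" "query_post M M'" "out' = out" by (auto simp: Q_def)
    then show "Q (fold ex [Compute Add 32 20 3] (M', out')) \<and>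
       fst (fold ex [Compute Add 32 20 3] (M', out')) 32 = clamp v (fst (fold ex [Compute Add 32 20 3] (M', out')) 22)"
      using Qf[of M'] vew[of "M' 22"] by (simp add: Q_def alu_add fr clamp_def)
  qed (auto simp: clamp_def)
  have t4: "triple (\<lambda>s. Q s \<and> fst s 32 = clamp v (fst s 22))
     (Code ?code2) 4
     (\<lambda>s. Q s \<and> fst s 32 = clamp v (fst s 22) - sval (fst s 22) + ps (fst s 22) - N0 + 1)"
  proof (rule triple_Code)
    fix M' out' assume "Q (M', out') \<and> fst (M', out') 32 = clamp v (fst (M', out') 22)"
    then have q: "query_post M M'" "out' = out" "M' 32 = clamp v (M' 22)" by (auto simp: Q_def)
    define j where "j = M' 22"
    note f = Qf[OF q(1), folded j_def]
    have c: "sval j \<le> clamp v j" "clamp v j \<le> ve (Suc j)" using clamp_bounds f by auto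
    have "N0 \<le> ps j" using ps_mono[of N0 j] ps_aux[of N0] f by simp
    then have "alu w Sub (clamp v j) (sval j) = clamp v j - sval j"
      "alu w Add (clamp v j - sval j) (ps j) = clamp v j - sval j + ps j"
      "alu w Sub (clamp v j - sval j + ps j) N0 = clamp v j - sval j + ps j - N0"
      "alu w Add (clamp v j - sval j + ps j - N0) 1 = clamp v j - sval j + ps j - N0 + 1"
      using c vew[OF f(9)] by (auto simp: alu_add alu_sub)
    then have "fold ex ?code2
        (M', out') = (M'(32 := clamp v j - sval j + ps j - N0 + 1), out)"
      using f q by (simp flip: j_def)
    then show "Q (fold ex ?code2 (M', out')) \<and>
      fst (fold ex ?code2 (M', out')) 32 =
      clamp v (fst (fold ex ?code2 (M', out')) 22) -
      sval (fst (fold ex ?code2 (M', out')) 22) +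
      ps (fst (fold ex ?code2 (M', out')) 22) - N0 + 1"
      using q by (simp only:) (simp add: Q_def fr j_def)
  qed simp
  have t0: "triple (\<lambda>s. s = (M, out)) (query K) (query_time k) Q"
    using query_triple[OF M(1) k] by (simp add: Q_def[abs_def])
  have "triple (\<lambda>s. s = (M, out)) (lower K) (query_time k + (3 + ((1 + 1) + ((1 + 1) + 4))))
     (\<lambda>s. Q s \<and> fst s 32 = clamp v (fst s 22) - sval (fst s 22) + ps (fst s 22) - N0 + 1)"
    unfolding lower_def by (intro triple_Seq[OF t0] triple_Seq[OF t1] triple_Seq[OF t2] triple_Seq[OF t3] t4)
  then show ?thesis by (rule triple_weaken) (auto simp: Q_def v_def)
qed

end

section \<open>Backward search\<close>

definition search_body :: "nat \<Rightarrow> com" where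
  "search_body K =
     Code [Compute Sub 60 60 1, Read_Pattern 61 60, Compute Mul 66 61 50, Compute Add 25 2 3,
           Compute Add 26 66 63] ;;
     lower K ;;
     Code [Compute Add 63 32 3, Compute Add 26 66 62] ;;
     lower K ;;
     Code [Compute Add 62 32 3, Compute Less 65 26 23, Compute Equal 67 65 3] ;;
     When 67 (Code [Compute Sub 64 64 1]) ;;
     When 65 (Code (start_code @ [Compute Add 64 16 3])) ;;
     Code [Compute Equal 65 60 3]"

context word_ram
begin

lemma triple_Code_ex:
  "(\<And>M out. I (M, out) \<Longrightarrow> \<exists>s'. fold ex is (M, out) = s' \<and> Q s') \<Longrightarrow> length is \<le> b \<Longrightarrow>
   triple I (Code is) b Q"
  by (rule triple_Code) auto

end

context csa
begin

lemma frameD: "frame M M' \<Longrightarrow> a < 10 \<or> a \<ge> 40 \<or> a = 25 \<or> a = 26 \<Longrightarrow> M' a = M a"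
  unfolding frame_def by blast

lemma frame_regs: "frame M M' \<Longrightarrow> regs M \<Longrightarrow> regs M'"
  by (erule regs_cong) (auto simp: frameD)

definition range_of :: "nat list \<Rightarrow> nat \<Rightarrow> nat \<Rightarrow> bool" where
  "range_of X lo hi \<longleftrightarrow> lo \<le> hi \<and> (X = [] \<and> lo = 0 \<and> hi = N \<or>
     X \<noteq> [] \<and> 1 \<le> lo \<and> hi \<le> n + 1 \<and> matches X = {lo..<hi})"

definition toehold :: "nat list \<Rightarrow> nat \<Rightarrow> nat \<Rightarrow> nat \<Rightarrow> bool" where
  "toehold X lo hi q \<longleftrightarrow> (mode = 0 \<and> X \<noteq> [] \<and> lo < hi \<longrightarrow> q = SA T lo)"

lemma range_step:
  assumes X: "range_of X lo hi" and c: "c \<ge> 1"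
    and x: "rank (c * N + hi) x" and f: "found (2 ^ (w - 1)) (c * N + lo) j"
    and y: "y = clamp (c * N + lo) j - sval j + ps j - N0"
  shows "range_of (c # X) (y + 1) (x + 1)"
    and "mode = 0 \<Longrightarrow> y < x \<Longrightarrow> c * N + lo < sval j \<Longrightarrow>
      N0 \<le> j \<and> j < R \<and> j - N0 < N0 \<and> arr ! (j - N0) = SA T (y + 1)"
    and "y < x \<Longrightarrow> \<not> c * N + lo < sval j \<Longrightarrow> X \<noteq> [] \<and> lo < hi \<and> SA T lo = SA T (y + 1) + 1"
proof -
  have "N * 1 \<le> N * c" using c by (intro mult_left_mono) auto
  then have v: "N \<le> c * N + lo" using mult.commute[of N c] by linarith
  have ry: "rank (c * N + lo) y" unfolding y by (rule found_rank[OF f big_bounds(1) v])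
  have le: "lo \<le> hi" using X by (simp add: range_of_def)
  have "y \<le> x" using rank_mono[OF ry x] le by simp
  moreover have "x \<le> n" using x by (simp add: rank_def)
  moreover have "matches (c # X) = {y + 1..<x + 1}"
    using matches_rank[OF matches_Cons ry x] X unfolding range_of_def by blast
  ultimately show "range_of (c # X) (y + 1) (x + 1)" by (simp add: range_of_def)
  assume lt: "y < x"
  have i: "y + 1 \<le> n" "y + 1 \<in> {1..n}" using lt \<open>x \<le> n\<close> by auto
  note hit = found_hit[OF f big_bounds(1) v _ i(1), unfolded y[symmetric], OF refl]
  note run = found_run[OF f big_bounds(1) v]
  {
    assume m: "mode = 0" and a: "c * N + lo < sval j"
    have "N0 = r" "\<forall>j<r. arr ! j = SA T (st j)" using run_samples[OF m] by auto
    then show "N0 \<le> j \<and> j < R \<and> j - N0 < N0 \<and> arr ! (j - N0) = SA T (y + 1)"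
      using run hit(1)[OF a] by auto
  next
    assume a: "\<not> c * N + lo < sval j"
    have Vy: "V (y + 1) = c * N + lo" using hit(2)[OF a] .
    have "V (y + 1) < c * N + hi" using x i lt by (auto simp: rank_def)
    then have lh: "lo < hi" using Vy by simp
    have "lo < N" using X lh N by (auto simp: range_of_def)
    then have lo: "lo = (if y + 1 = 1 then N - 1 else Psi T (y + 1))"
      using V_mod[OF i(2)] Vy by simp
    have "X \<noteq> []"
    proof
      assume "X = []"
      then have "lo = 0" using X by (auto simp: range_of_def)
      then show False using lo Psi_in[OF i(2)] N by (auto split: if_splits)
    qed
    then have "lo \<le> n" using X lh by (auto simp: range_of_def)
    then have "y + 1 \<noteq> 1" using lo N by (auto split: if_splits)
    then have "SA T (Psi T (y + 1)) = SA T (y + 1) + 1" using i by (intro SA_Psi) auto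
    moreover have "Psi T (y + 1) = lo" using lo \<open>y + 1 \<noteq> 1\<close> by simp
    ultimately show "X \<noteq> [] \<and> lo < hi \<and> SA T lo = SA T (y + 1) + 1"
      using lh \<open>X \<noteq> []\<close> by simp
  }
qed

definition search_inv :: "nat \<Rightarrow> state \<Rightarrow> bool" where
  "search_inv m s \<longleftrightarrow> snd s = [] \<and> regs (fst s) \<and> fst s 60 = m \<and>
     range_of (drop m P) (fst s 62) (fst s 63) \<and> toehold (drop m P) (fst s 62) (fst s 63) (fst s 64)"

lemma SA_word: "i \<in> {1..n} \<Longrightarrow> SA T i < 2 ^ w"
  using SA_in[of i] small_values(2) by (intro less_word) auto

lemma range_less: "range_of X lo hi \<Longrightarrow> lo \<le> N \<and> hi \<le> N"
  using N by (auto simp: range_of_def)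

lemma search_body_triple:
  assumes k: "nb < 2 ^ Suc k" and m: "Suc m \<le> length P" "length P \<le> N"
  shows "triple (search_inv (Suc m)) (search_body K) (2 * query_time k + 62)
    (\<lambda>s. search_inv m s \<and> fst s 65 = of_bool (m = 0))"
proof (rule triple_pointwise)
  let ?code1 = "[Compute Sub 60 60 1, Read_Pattern 61 60, Compute Mul 66 61 50,
      Compute Add 25 2 3, Compute Add 26 66 63]"
  let ?code2 = "[Compute Add 63 32 3, Compute Add 26 66 62]"
  let ?code3 = "[Compute Add 62 32 3, Compute Less 65 26 23, Compute Equal 67 65 3]"
  fix M0 out0 assume "search_inv (Suc m) (M0, out0)"
  define X c lo hi q where "X = drop (Suc m) P" and "c = P ! m" and "lo = M0 62" and "hi = M0 63"
    and "q = M0 64"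
  have M0: "out0 = []" "regs M0" "M0 60 = Suc m" "range_of X lo hi" "toehold X lo hi q"
    using \<open>search_inv _ _\<close> by (auto simp: search_inv_def X_def lo_def hi_def q_def)
  have dropm: "drop m P = c # X" using m by (simp add: X_def c_def Cons_nth_drop_Suc)
  have "c \<in> set P" using m by (simp add: c_def)
  then have c: "c \<ge> 1" "c \<le> \<sigma>" using pattern by auto
  have lh: "lo \<le> N" "hi \<le> N" using range_less[OF M0(4)] by auto
  have "(c + 1) * N \<le> (\<sigma> + 1) * N" using c by (intro mult_right_mono) auto
  moreover have "c * N + N = (c + 1) * N" by simp
  ultimately have cN: "c * N + N < 2 ^ L" using small_values(1) by linarith
  have "N * 1 \<le> N * c" using c by (intro mult_left_mono) auto
  then have Nc: "N \<le> c * N" using mult.commute[of N c] by linarith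
  have less: "c * N < 2 ^ w" "c * N + hi < 2 ^ w" "c * N + lo < 2 ^ w" "Suc m < 2 ^ w"
    using less_word[OF cN] lh m Nc by auto
  have b0: "M0 1 = 1" "M0 2 = 2 ^ (w - 1)" "M0 3 = 0" "M0 50 = N"
    using base_regsD[OF M0(2)] M0(2) by (auto simp: regs_def)
  define M1 where "M1 = M0(60 := m, 61 := c, 66 := c * N, 25 := 2 ^ (w - 1), 26 := c * N + hi)"
  have c1: "fold ex ?code1 (M0, out0) = (M1, [])"
    using M0(1,3) b0 less m big_bounds(3)
    by (simp add: M1_def alu_add alu_sub alu_mul pattern_word_def flip: c_def hi_def)
  have r1: "regs M1" using M0(2) by (rule regs_cong) (auto simp: M1_def)
  define J where "J v x s \<longleftrightarrow> snd s = [] \<and> regs (fst s) \<and> fst s 25 = 2 ^ (w - 1) \<and> fst s 26 = v \<and>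
     fst s 60 = m \<and> fst s 62 = lo \<and> fst s 63 = x \<and> fst s 64 = q \<and> fst s 66 = c * N" for v x and s :: state
  define A where "A v s \<longleftrightarrow> found (2 ^ (w - 1)) v (fst s 22) \<and> fst s 23 = sval (fst s 22) \<and>
    fst s 32 = clamp v (fst s 22) - sval (fst s 22) + ps (fst s 22) - N0 + 1" for v and s :: state
  have low: "triple (J v x) (lower K) (query_time k + 11) (\<lambda>s. J v x s \<and> A v s)"
    if v: "N \<le> v" "v < 2 ^ L" for v x
  proof (rule triple_pointwise)
    fix M out assume "J v x (M, out)"
    then have J: "out = []" "regs M" "M 25 = 2 ^ (w - 1)" "M 26 = v" "M 60 = m" "M 62 = lo" "M 63 = x"
      "M 64 = q" "M 66 = c * N" unfolding J_def by auto
    show "triple (\<lambda>s. s = (M, out)) (lower K) (query_time k + 11) (\<lambda>s. J v x s \<and> A v s)"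
    proof (rule triple_weaken[OF lower_triple[OF J(2,3) _ _ k]])
      show "N \<le> M 26" "M 26 < 2 ^ L" using v J(4) by auto
      fix s assume s: "snd s = out \<and> query_post M (fst s) \<and>
         fst s 32 = clamp (M 26) (fst s 22) - sval (fst s 22) + ps (fst s 22) - N0 + 1"
      then have f: "frame M (fst s)" "found (M 25) (M 26) (fst s 22)" "fst s 23 = sval (fst s 22)"
        unfolding query_post_def by blast+
      have "J v x s" unfolding J_def using s J frameD[OF f(1)] frame_regs[OF f(1) J(2)] by simp
      moreover have "A v s" unfolding A_def using s f J(3,4) by simp
      ultimately show "J v x s \<and> A v s" ..
    qed auto
  qed
  have J1: "J (c * N + hi) hi (M1, [])"
    using r1 by (simp add: J_def M1_def lo_def hi_def q_def)
  have t1: "triple (\<lambda>s. s = (M0, out0)) (Code ?code1) 5 (J (c * N + hi) hi)"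
    by (rule triple_Code) (use c1 J1 in auto)
  have Nv: "N \<le> c * N + hi" "c * N + hi < 2 ^ L" "N \<le> c * N + lo" "c * N + lo < 2 ^ L"
    using Nc cN lh by linarith+
  define J2 where "J2 s \<longleftrightarrow> (\<exists>x. rank (c * N + hi) x \<and> J (c * N + lo) (x + 1) s)" for s
  have t3: "triple (\<lambda>s. J (c * N + hi) hi s \<and> A (c * N + hi) s)
     (Code ?code2) 2 J2"
  proof (rule triple_Code_ex)
    fix M out assume a: "J (c * N + hi) hi (M, out) \<and> A (c * N + hi) (M, out)"
    define x where "x = clamp (c * N + hi) (M 22) - sval (M 22) + ps (M 22) - N0"
    have f: "found (2 ^ (w - 1)) (c * N + hi) (M 22)" and M32: "M 32 = x + 1"
      using a by (auto simp: A_def x_def)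
    have x: "rank (c * N + hi) x" unfolding x_def by (rule found_rank[OF f big_bounds(1) Nv(1)])
    then have "x \<le> n" by (simp add: rank_def)
    then have xw: "x + 1 < 2 ^ w" using less N Nc by linarith
    have J: "out = []" "regs M" "M 25 = 2 ^ (w - 1)" "M 60 = m" "M 62 = lo" "M 64 = q" "M 66 = c * N"
      using a by (auto simp: J_def)
    have e: "fold ex ?code2 (M, out) =
       (M(63 := x + 1, 26 := c * N + lo), [])"
      using J M32 xw less base_regsD[OF J(2)] by (simp add: alu_add)
    have "regs (M(63 := x + 1, 26 := c * N + lo))" using J(2) by (rule regs_cong) auto
    then have "J (c * N + lo) (x + 1) (M(63 := x + 1, 26 := c * N + lo), [])"
      using J by (simp add: J_def)
    then show "\<exists>s'. fold ex ?code2 (M, out) = s' \<and> J2 s'"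
      using e x unfolding J2_def by blast
  qed simp
  have t4: "triple J2 (lower K) (query_time k + 11) (\<lambda>s. J2 s \<and> A (c * N + lo) s)"
  proof (rule triple_pointwise)
    fix M out assume "J2 (M, out)"
    then obtain x where x: "rank (c * N + hi) x" "J (c * N + lo) (x + 1) (M, out)" by (auto simp: J2_def)
    show "triple (\<lambda>s. s = (M, out)) (lower K) (query_time k + 11) (\<lambda>s. J2 s \<and> A (c * N + lo) s)"
      by (rule triple_weaken[OF low[OF Nv(3,4), of "x + 1"]]) (use x in \<open>auto simp: J2_def\<close>)
  qed
  define G where "G s \<longleftrightarrow> (\<exists>x y. snd s = [] \<and> regs (fst s) \<and> fst s 60 = m \<and> fst s 62 = y + 1 \<and>
     fst s 63 = x + 1 \<and> range_of (c # X) (y + 1) (x + 1) \<and>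
     (mode = 0 \<and> y < x \<and> fst s 65 \<noteq> 0 \<longrightarrow> N0 \<le> fst s 22 \<and> fst s 22 < R \<and> fst s 22 - N0 < N0 \<and>
        arr ! (fst s 22 - N0) = SA T (y + 1)) \<and>
     (mode = 0 \<and> y < x \<and> fst s 67 \<noteq> 0 \<longrightarrow> fst s 64 = SA T (y + 1) + 1 \<and> fst s 64 < 2 ^ w) \<and>
     fst s 67 = of_bool (fst s 65 = 0))" for s :: state
  have t5: "triple (\<lambda>s. J2 s \<and> A (c * N + lo) s)
     (Code ?code3) 3 G"
  proof (rule triple_Code_ex)
    fix M out assume a: "J2 (M, out) \<and> A (c * N + lo) (M, out)"
    then obtain x where x: "rank (c * N + hi) x" "J (c * N + lo) (x + 1) (M, out)" by (auto simp: J2_def)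
    define j y where "j = M 22" and "y = clamp (c * N + lo) (M 22) - sval (M 22) + ps (M 22) - N0"
    have f: "found (2 ^ (w - 1)) (c * N + lo) j" and M32: "M 32 = y + 1" and M23: "M 23 = sval j"
      using a by (auto simp: A_def y_def j_def)
    note st = range_step[OF M0(4) c(1) x(1) f y_def[folded j_def]]
    have "y + 1 \<le> n + 1" using st(1) by (auto simp: range_of_def)
    then have yw: "y + 1 < 2 ^ w" using less N Nc by linarith
    have J: "out = []" "regs M" "M 60 = m" "M 62 = lo" "M 63 = x + 1" "M 64 = q" "M 26 = c * N + lo"
      using x(2) by (auto simp: J_def)
    define b where "b \<longleftrightarrow> c * N + lo < sval j"
    define M' where "M' = M(62 := y + 1, 65 := of_bool b, 67 := of_bool (\<not> b))"
    have e: "fold ex ?code3 (M, out) = (M', [])"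
      using J M32 M23 yw base_regsD[OF J(2)] by (simp add: alu_add M'_def b_def)
    have r: "regs M'" using J(2) by (rule regs_cong) (auto simp: M'_def)
    have q: "q = SA T (y + 1) + 1 \<and> q < 2 ^ w" if "mode = 0" "y < x" "\<not> b"
    proof -
      have h: "X \<noteq> []" "lo < hi" "SA T lo = SA T (y + 1) + 1"
        using st(3) that by (auto simp: b_def)
      then have "q = SA T lo" using M0(5) that unfolding toehold_def by blast
      moreover have "lo \<in> {1..n}" using M0(4) h by (auto simp: range_of_def)
      ultimately show ?thesis using h(3) SA_word[of lo] by simp
    qed
    have impl: "mode = 0 \<and> y < x \<and> \<not> b \<longrightarrow> q = SA T (y + 1) + 1 \<and> q < 2 ^ w"
      "mode = 0 \<and> y < x \<and> b \<longrightarrow> N0 \<le> j \<and> j < R \<and> j - N0 < N0 \<and> arr ! (j - N0) = SA T (y + 1)"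
      using q st(2) unfolding b_def by blast+
    have v': "M' 60 = m" "M' 62 = y + 1" "M' 63 = x + 1" "M' 65 \<noteq> 0 \<longleftrightarrow> b" "M' 67 \<noteq> 0 \<longleftrightarrow> \<not> b" "M' 64 = q"
      "M' 22 = j" "M' 67 = of_bool (M' 65 = 0)"
      using J by (simp_all add: M'_def j_def)
    have "G (M', [])" unfolding G_def fst_conv snd_conv
      by (rule exI[of _ x], rule exI[of _ y]) (use r st(1) v' impl in \<open>simp only: simp_thms\<close>)
    with e show "\<exists>s'. fold ex ?code3 (M, out) = s' \<and> G s'"
      by blast
  qed simp
  define G2 where "G2 s \<longleftrightarrow> (\<exists>x y. snd s = [] \<and> regs (fst s) \<and> fst s 60 = m \<and> fst s 62 = y + 1 \<and>
     fst s 63 = x + 1 \<and> range_of (c # X) (y + 1) (x + 1) \<and>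
     (mode = 0 \<and> y < x \<and> fst s 65 \<noteq> 0 \<longrightarrow> N0 \<le> fst s 22 \<and> fst s 22 < R \<and> fst s 22 - N0 < N0 \<and>
        arr ! (fst s 22 - N0) = SA T (y + 1)) \<and>
     (mode = 0 \<and> y < x \<and> fst s 65 = 0 \<longrightarrow> fst s 64 = SA T (y + 1)))" for s :: state
  have t6: "triple G (When 67 (Code [Compute Sub 64 64 1])) (1 + 1) G2"
  proof (rule triple_When, rule triple_Code_ex)
    fix M out assume "G (M, out) \<and> fst (M, out) 67 \<noteq> 0"
    then obtain x y where g: "out = []" "regs M" "M 60 = m" "M 62 = y + 1" "M 63 = x + 1"
      "range_of (c # X) (y + 1) (x + 1)"
      "mode = 0 \<and> y < x \<longrightarrow> M 64 = SA T (y + 1) + 1 \<and> M 64 < 2 ^ w"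
      and "M 67 \<noteq> 0" "M 67 = of_bool (M 65 = 0)"
      unfolding G_def fst_conv snd_conv by blast
    then have M65: "M 65 = 0" by (cases "M 65 = 0") auto
    have sub: "mode = 0 \<and> y < x \<longrightarrow> alu w Sub (M 64) 1 = SA T (y + 1)"
      using g(7) alu_sub[of 1 "M 64" w] by auto
    have e: "fold ex [Compute Sub 64 64 1] (M, out) = (M(64 := alu w Sub (M 64) 1), [])"
      using g base_regsD[OF g(2)] by simp
    have "regs (M(64 := alu w Sub (M 64) 1))" using g(2) by (rule regs_cong) auto
    note r' = this
    have "G2 (M(64 := alu w Sub (M 64) 1), [])" unfolding G2_def
      by (rule exI[of _ x], rule exI[of _ y]) (use g(1-6) sub M65 r' in \<open>simp add: alu_sub\<close>)
    with e show "\<exists>s'. fold ex [Compute Sub 64 64 1] (M, out) = s' \<and> G2 s'" by blast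
  next
    fix s assume "G s" "fst s 67 = 0"
    then show "G2 s" unfolding G_def G2_def by fastforce
  qed simp
  define G3 where "G3 s \<longleftrightarrow> (\<exists>x y. snd s = [] \<and> regs (fst s) \<and> fst s 60 = m \<and> fst s 62 = y + 1 \<and>
     fst s 63 = x + 1 \<and> range_of (c # X) (y + 1) (x + 1) \<and>
     (mode = 0 \<and> y < x \<longrightarrow> fst s 64 = SA T (y + 1)))" for s :: state
  have t7: "triple G2 (When 65 (Code (start_code @ [Compute Add 64 16 3]))) (25 + 1) G3"
  proof (rule triple_When, rule triple_Code_ex)
    fix M out assume "G2 (M, out) \<and> fst (M, out) 65 \<noteq> 0"
    then obtain x y where g: "out = []" "regs M" "M 60 = m" "M 62 = y + 1" "M 63 = x + 1"
      "range_of (c # X) (y + 1) (x + 1)"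
      "mode = 0 \<and> y < x \<longrightarrow> N0 \<le> M 22 \<and> M 22 < R \<and> M 22 - N0 < N0 \<and> arr ! (M 22 - N0) = SA T (y + 1)"
      unfolding G2_def fst_conv snd_conv by blast
    obtain M' where M': "fold ex start_code (M, out) = (M', out)" "\<forall>a. a < 10 \<or> a \<ge> 20 \<longrightarrow> M' a = M a"
      "N0 \<le> M 22 \<and> M 22 < R \<and> M 22 - N0 < N0 \<longrightarrow> M' 16 = arr ! (M 22 - N0)"
      using start[OF g(2), of out] by blast
    have fetched: "mode = 0 \<and> y < x \<longrightarrow> M' 16 = SA T (y + 1) \<and> M' 16 < 2 ^ w"
    proof
      assume a: "mode = 0 \<and> y < x"
      then have "M' 16 = SA T (y + 1)" using M'(3) g(7) by simp
      moreover have "y + 1 \<in> {1..n}" using a g(6) by (auto simp: range_of_def)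
      ultimately show "M' 16 = SA T (y + 1) \<and> M' 16 < 2 ^ w" using SA_word[of "y + 1"] by simp
    qed
    have add: "mode = 0 \<and> y < x \<longrightarrow> alu w Add (M' 16) 0 = SA T (y + 1)"
      using fetched alu_add[of "M' 16" 0 w] by auto
    have "M' 3 = 0" using M'(2) base_regsD[OF g(2)] by simp
    then have e: "fold ex (start_code @ [Compute Add 64 16 3]) (M, out) = (M'(64 := alu w Add (M' 16) 0), [])"
      using M'(1) g(1) by simp
    have "regs (M'(64 := alu w Add (M' 16) 0))" using g(2) by (rule regs_cong) (use M'(2) in auto)
    note r' = this
    have "G3 (M'(64 := alu w Add (M' 16) 0), [])" unfolding G3_def
      by (rule exI[of _ x], rule exI[of _ y]) (use g(1-6) add M'(2) r' in \<open>simp add: alu_add\<close>)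
    with e show "\<exists>s'. fold ex (start_code @ [Compute Add 64 16 3]) (M, out) = s' \<and> G3 s'" by blast
  next
    fix s assume "G2 s" "fst s 65 = 0"
    then show "G3 s" unfolding G2_def G3_def by fastforce
  qed (simp add: length_start_code)
  have t8: "triple G3 (Code [Compute Equal 65 60 3]) 1 (\<lambda>s. search_inv m s \<and> fst s 65 = of_bool (m = 0))"
  proof (rule triple_Code_ex)
    fix M out assume "G3 (M, out)"
    then obtain x y where g: "out = []" "regs M" "M 60 = m" "M 62 = y + 1" "M 63 = x + 1"
      "range_of (c # X) (y + 1) (x + 1)" "mode = 0 \<and> y < x \<longrightarrow> M 64 = SA T (y + 1)"
      unfolding G3_def fst_conv snd_conv by blast
    have e: "fold ex [Compute Equal 65 60 3] (M, out) = (M(65 := of_bool (m = 0)), [])"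
      using g base_regsD[OF g(2)] by simp
    have "regs (M(65 := of_bool (m = 0)))" using g(2) by (rule regs_cong) auto
    then have "search_inv m (M(65 := of_bool (m = 0)), [])"
      using g by (simp add: search_inv_def dropm toehold_def)
    with e show "\<exists>s'. fold ex [Compute Equal 65 60 3] (M, out) = s' \<and>
      (search_inv m s' \<and> fst s' 65 = of_bool (m = 0))" by simp
  qed simp
  have "triple (\<lambda>s. s = (M0, out0)) (search_body K)
     (5 + ((query_time k + 11) + (2 + ((query_time k + 11) + (3 + ((1 + 1) + ((25 + 1) + 1)))))))
     (\<lambda>s. search_inv m s \<and> fst s 65 = of_bool (m = 0))"
    unfolding search_body_def
    by (intro triple_Seq[OF t1] triple_Seq[OF low[OF Nv(1,2)]] triple_Seq[OF t3] triple_Seq[OF t4]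
        triple_Seq[OF t5] triple_Seq[OF t6] triple_Seq[OF t7] t8)
  then show "triple (\<lambda>s. s = (M0, out0)) (search_body K) (2 * query_time k + 62)
     (\<lambda>s. search_inv m s \<and> fst s 65 = of_bool (m = 0))"
    by (rule triple_weaken) auto
qed

end

section \<open>Reporting occurrences\<close>

definition walk_body :: "nat \<Rightarrow> com" where
  "walk_body K =
     Code [Compute Add 25 2 3, Compute Add 26 68 3] ;;
     query K ;;
     Code [Compute Equal 70 23 26, Compute Equal 73 70 3] ;;
     When 73 (Code [Compute Add 25 68 52, Compute Sub 25 25 1, Compute Add 26 2 3] ;;
              query K ;;
              Code [Compute Sub 25 25 24, Compute Add 25 25 23, Compute Mod 68 25 50,
                    Compute Add 69 69 1])"

definition text_body :: "nat \<Rightarrow> com" where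
  "text_body K =
     Code [Compute Add 68 62 3, Literal 69 0] ;;
     Rep (walk_body K) 70 ;;
     Code (sample_code @ [Compute Sub 71 16 69, Emit 71, Compute Add 62 62 1, Compute Equal 72 62 63])"

definition run_body :: "nat \<Rightarrow> com" where
  "run_body K =
     Code [Emit 64, Compute Add 25 2 3, Compute Add 26 64 3] ;;
     query K ;;
     Code (sample_code @ [Compute Sub 75 23 64, Compute Sub 64 16 75, Compute Sub 74 74 1,
                          Compute Equal 72 74 3])"

context csa
begin

lemma query_regs:
  assumes "regs M" "nb < 2 ^ Suc k"
  shows "triple (\<lambda>s. s = (M, out)) (query K) (query_time k)
    (\<lambda>s. snd s = out \<and> regs (fst s) \<and> frame M (fst s) \<and> found (M 25) (M 26) (fst s 22) \<and>
       fst s 23 = sval (fst s 22) \<and> fst s 24 = ps (fst s 22))"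
proof (rule triple_weaken[OF query_triple[OF assms]])
  fix s assume "snd s = out \<and> query_post M (fst s)"
  then show "snd s = out \<and> regs (fst s) \<and> frame M (fst s) \<and> found (M 25) (M 26) (fst s 22) \<and>
       fst s 23 = sval (fst s 22) \<and> fst s 24 = ps (fst s 22)"
    using frame_regs[OF _ assms(1), of "fst s"] unfolding query_post_def by blast
qed auto

lemma pos_word: "x \<le> n \<Longrightarrow> x + N0 < 2 ^ w"
  using small_values(2) by (intro less_word) linarith

lemma N0_pos: "mode \<noteq> 0 \<Longrightarrow> 1 \<in> set xs"
  using text_samples SA_1 n_pos by auto

definition walk_inv :: "nat \<Rightarrow> nat \<Rightarrow> nat list \<Rightarrow> nat \<Rightarrow> state \<Rightarrow> bool" where
  "walk_inv i hi out k s \<longleftrightarrow> snd s = out \<and> regs (fst s) \<and> fst s 62 = i \<and> fst s 63 = hi \<and>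
     fst s 76 = 0 \<and> fst s 68 \<in> {1..n} \<and> SA T (fst s 68) = SA T i + fst s 69 \<and>
     (n - SA T (fst s 68)) mod (rate + 1) = k"

definition walk_end :: "nat \<Rightarrow> nat \<Rightarrow> nat list \<Rightarrow> state \<Rightarrow> bool" where
  "walk_end i hi out s \<longleftrightarrow> (\<exists>x. snd s = out \<and> regs (fst s) \<and> fst s 62 = i \<and> fst s 63 = hi \<and>
     fst s 76 = 0 \<and> x \<in> {1..n} \<and> SA T x = SA T i + fst s 69 \<and> fst s 22 < N0 \<and> xs ! (fst s 22) = x)"

lemma walk_body_triple:
  assumes m: "mode \<noteq> 0" and k: "nb < 2 ^ Suc k"
  shows "triple (walk_inv i hi out j) (walk_body K) (2 * query_time k + 12)
     (\<lambda>s. if fst s 70 = 0 then j > 0 \<and> walk_inv i hi out (j - 1) s else walk_end i hi out s)"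
proof (rule triple_pointwise)
  let ?code1 = "[Compute Add 25 2 3, Compute Add 26 68 3]"
  let ?code2 = "[Compute Equal 70 23 26, Compute Equal 73 70 3]"
  let ?code3 = "[Compute Add 25 68 52, Compute Sub 25 25 1, Compute Add 26 2 3]"
  let ?code4 = "[Compute Sub 25 25 24, Compute Add 25 25 23, Compute Mod 68 25 50,
      Compute Add 69 69 1]"
  fix M0 out0 assume "walk_inv i hi out j (M0, out0)"
  define x d where "x = M0 68" and "d = M0 69"
  have M0: "out0 = out" "regs M0" "M0 62 = i" "M0 63 = hi" "M0 76 = 0" "x \<in> {1..n}"
     "SA T x = SA T i + d" "(n - SA T x) mod (rate + 1) = j"
    using \<open>walk_inv _ _ _ _ _\<close> by (auto simp: walk_inv_def x_def d_def)
  note b0 = base_regsD[OF M0(2)]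
  have xw: "x < 2 ^ w" "x + N0 < 2 ^ w" using pos_word[of x] M0(6) by auto
  have xset: "x \<in> set xs \<longleftrightarrow> j = 0" using text_samples[OF m] M0(6,8) by auto
  define C where "C s \<longleftrightarrow> snd s = out \<and> regs (fst s) \<and> fst s 62 = i \<and> fst s 63 = hi \<and> fst s 76 = 0 \<and>
     fst s 68 = x \<and> fst s 69 = d" for s :: state
  define M1 where "M1 = M0(25 := 2 ^ (w - 1), 26 := x)"
  have c1: "fold ex ?code1 (M0, out0) = (M1, out)"
    using M0(1) b0 xw big_bounds(3) by (simp add: M1_def alu_add flip: x_def)
  have C1: "C (M1, out)" using M0 regs_cong[OF M0(2), of M1] by (simp add: C_def M1_def x_def d_def)
  then have r1: "regs M1" by (simp add: C_def)
  have t1: "triple (\<lambda>s. s = (M0, out0)) (Code ?code1) 2 (\<lambda>s. s = (M1, out))"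
    by (rule triple_Code) (use c1 in auto)
  define Q where "Q s \<longleftrightarrow> C s \<and> fst s 26 = x \<and> found (2 ^ (w - 1)) x (fst s 22) \<and> fst s 23 = sval (fst s 22)"
    for s :: state
  have t2: "triple (\<lambda>s. s = (M1, out)) (query K) (query_time k) Q"
  proof (rule triple_weaken[OF query_regs[OF r1 k]])
    fix s assume s: "snd s = out \<and> regs (fst s) \<and> frame M1 (fst s) \<and> found (M1 25) (M1 26) (fst s 22) \<and>
       fst s 23 = sval (fst s 22) \<and> fst s 24 = ps (fst s 22)"
    then have f: "frame M1 (fst s)" by blast
    show "Q s" unfolding Q_def C_def using s frameD[OF f] C1 by (simp add: C_def M1_def)
  qed auto
  define W where "W s \<longleftrightarrow> C s \<and> fst s 70 = of_bool (j = 0) \<and> fst s 73 = of_bool (j > 0) \<and>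
     (j = 0 \<longrightarrow> fst s 22 < N0 \<and> xs ! (fst s 22) = x)" for s :: state
  have t3: "triple Q (Code ?code2) 2 W"
  proof (rule triple_Code_ex)
    fix M out' assume "Q (M, out')"
    then have q: "C (M, out')" "M 26 = x" "found (2 ^ (w - 1)) x (M 22)" "M 23 = sval (M 22)"
      by (auto simp: Q_def)
    have h: "sval (M 22) = x \<longleftrightarrow> j = 0" "j = 0 \<Longrightarrow> M 22 < N0 \<and> xs ! M 22 = x"
      using found_aux_hit[OF q(3) big_bounds(1)] M0(6) xset by auto
    have r: "regs M" using q(1) by (simp add: C_def)
    define M' where "M' = M(70 := of_bool (j = 0), 73 := of_bool (j > 0))"
    have e: "fold ex ?code2 (M, out') = (M', out')"
      using q h(1) base_regsD[OF r] by (simp add: M'_def)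
    have "regs M'" using r by (rule regs_cong) (auto simp: M'_def)
    then have "W (M', out')" using q(1) h(2) by (simp add: W_def C_def M'_def)
    with e show "\<exists>s'. fold ex ?code2 (M, out') = s' \<and> W s'" by blast
  qed simp
  define Z where "Z s \<longleftrightarrow> (if fst s 70 = 0 then j > 0 \<and> walk_inv i hi out (j - 1) s else walk_end i hi out s)"
    for s :: state
  define C2 where "C2 s \<longleftrightarrow> C s \<and> fst s 70 = 0 \<and> fst s 25 = N0 + x - 1 \<and> fst s 26 = 2 ^ (w - 1)" for s :: state
  have u1: "triple (\<lambda>s. W s \<and> fst s 73 \<noteq> 0) (Code ?code3) 3
     (\<lambda>s. C2 s \<and> j > 0)"
  proof (rule triple_Code_ex)
    fix M out' assume "W (M, out') \<and> fst (M, out') 73 \<noteq> 0"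
    then have q: "C (M, out')" "j > 0" "M 70 = 0" by (auto simp: W_def split: if_splits)
    have r: "regs M" "M 68 = x" "M 52 = N0" using q(1) by (auto simp: C_def regs_def)
    define M' where "M' = M(25 := N0 + x - 1, 26 := 2 ^ (w - 1))"
    have e: "fold ex ?code3 (M, out') = (M', out')"
      using r base_regsD[OF r(1)] xw M0(6) big_bounds(3)
      by (simp add: M'_def alu_add alu_sub add.commute)
    have "regs M'" using r(1) by (rule regs_cong) (auto simp: M'_def)
    then have "C2 (M', out')" using q by (simp add: C2_def C_def M'_def)
    with e q(2) show "\<exists>s'. fold ex ?code3 (M, out') = s' \<and>
      (C2 s' \<and> j > 0)" by blast
  qed simp
  define C3 where "C3 s \<longleftrightarrow> C2 s \<and> j > 0 \<and> found (N0 + x - 1) (2 ^ (w - 1)) (fst s 22) \<and>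
     fst s 23 = sval (fst s 22) \<and> fst s 24 = ps (fst s 22)" for s :: state
  have u2: "triple (\<lambda>s. C2 s \<and> j > 0) (query K) (query_time k) C3"
  proof (rule triple_pointwise)
    fix M out' assume a: "C2 (M, out') \<and> j > 0"
    then have r: "regs M" by (simp add: C2_def C_def)
    show "triple (\<lambda>s. s = (M, out')) (query K) (query_time k) C3"
    proof (rule triple_weaken[OF query_regs[OF r k]])
      fix s assume s: "snd s = out' \<and> regs (fst s) \<and> frame M (fst s) \<and> found (M 25) (M 26) (fst s 22) \<and>
         fst s 23 = sval (fst s 22) \<and> fst s 24 = ps (fst s 22)"
      then have f: "frame M (fst s)" by blast
      show "C3 s" unfolding C3_def C2_def C_def using s frameD[OF f] a by (simp add: C2_def C_def)
    qed auto
  qed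
  have u3: "triple C3 (Code ?code4) 4 Z"
  proof (rule triple_Code_ex)
    fix M out' assume "C3 (M, out')"
    then have q: "C (M, out')" "M 70 = 0" "M 25 = N0 + x - 1" "j > 0"
      "found (N0 + x - 1) (2 ^ (w - 1)) (M 22)" "M 23 = sval (M 22)" "M 24 = ps (M 22)"
      by (auto simp: C3_def C2_def)
    note f = found_position[OF q(5) big_bounds(2) M0(6) refl]
    have r: "regs M" "M 69 = d" "M 50 = N" using q(1) by (auto simp: C_def regs_def)
    have x1: "x \<noteq> 1" using xset q(4) N0_pos[OF m] by auto
    then have x2: "x \<in> {2..n}" using M0(6) by auto
    have Vx: "V x mod N = Psi T x" using V_mod[OF M0(6)] x1 by simp
    have Vw: "V x < 2 ^ w" using V_bounds(2)[OF M0(6)] small_values(1) by (intro less_word) linarith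
    have SAx: "SA T x \<in> {1..<n}" using SA_less[OF x2] .
    have dw: "d + 1 < 2 ^ w"
    proof -
      have "d + 1 \<le> n" using M0(7) SAx by auto
      then show ?thesis using pos_word[of "d + 1"] by linarith
    qed
    define M' where "M' = M(25 := V x, 68 := Psi T x, 69 := d + 1)"
    have pw: "N0 + x - 1 < 2 ^ w" using xw by linarith
    have a1: "alu w Sub (N0 + x - 1) (ps (M 22)) = N0 + x - 1 - ps (M 22)"
      using f(2) pw by (rule alu_sub)
    have a2: "alu w Add (N0 + x - 1 - ps (M 22)) (sval (M 22)) = V x"
      using f(3) Vw by (subst alu_add) (simp_all add: add.commute)
    have a3: "alu w Add d 1 = d + 1" using dw by (rule alu_add)
    have e: "fold ex ?code4
        (M, out') = (M', out')"
      using q r base_regsD[OF r(1)] a1 a2 a3 Vx by (simp add: M'_def)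
    have "regs M'" using r(1) by (rule regs_cong) (auto simp: M'_def)
    moreover have "SA T (Psi T x) = SA T x + 1" using SA_Psi[OF x2] .
    moreover have "Psi T x \<in> {1..n}" using Psi_in[OF M0(6)] .
    moreover have "(n - (SA T x + 1)) mod (rate + 1) = j - 1"
    proof -
      define y where "y = n - (SA T x + 1)"
      have "Suc y mod (rate + 1) = j" using M0(8) SAx by (simp add: y_def Suc_diff_Suc)
      then have "Suc (y mod (rate + 1)) = j" using q(4) by (auto simp: mod_Suc split: if_splits)
      then show ?thesis by (simp add: y_def)
    qed
    ultimately have "Z (M', out')"
      using q(1,2,4) M0(7) by (simp add: Z_def walk_inv_def M'_def C_def)
    with e show "\<exists>s'. fold ex ?code4 (M, out') = s' \<and> Z s'" by blast
  qed simp
  have WZ: "Z s" if "W s" "fst s 73 = 0" for s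
  proof -
    have j0: "j = 0" using that by (simp add: W_def)
    then show ?thesis using that(1) M0(6,7) unfolding Z_def W_def walk_end_def C_def by auto
  qed
  have t4: "triple W (When 73 (Code ?code3 ;;
              query K ;;
              Code ?code4)) (3 + (query_time k + 4) + 1) Z"
    by (rule triple_When[OF triple_Seq[OF u1 triple_Seq[OF u2 u3]] WZ])
  have "triple (\<lambda>s. s = (M0, out0)) (walk_body K)
     (2 + (query_time k + (2 + (3 + (query_time k + 4) + 1)))) Z"
    unfolding walk_body_def by (rule triple_Seq[OF t1 triple_Seq[OF t2 triple_Seq[OF t3 t4]]])
  then show "triple (\<lambda>s. s = (M0, out0)) (walk_body K) (2 * query_time k + 12)
     (\<lambda>s. if fst s 70 = 0 then j > 0 \<and> walk_inv i hi out (j - 1) s else walk_end i hi out s)"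
    by (rule triple_weaken) (auto simp: Z_def)
qed

definition text_inv :: "nat \<Rightarrow> nat \<Rightarrow> nat \<Rightarrow> state \<Rightarrow> bool" where
  "text_inv lo hi k s \<longleftrightarrow> regs (fst s) \<and> fst s 62 + Suc k = hi \<and> fst s 63 = hi \<and> fst s 76 = 0 \<and>
     lo \<le> fst s 62 \<and> snd s = map (SA T) [lo..<fst s 62]"

definition listed :: "nat \<Rightarrow> nat \<Rightarrow> state \<Rightarrow> bool" where
  "listed lo hi s \<longleftrightarrow> snd s = map (SA T) [lo..<hi]"

lemma text_body_triple:
  assumes m: "mode \<noteq> 0" and lam: "lam < w" and k: "nb < 2 ^ Suc k" and b: "1 \<le> lo" "hi \<le> n + 1"
  shows "triple (text_inv lo hi j) (text_body K) ((rate + 1) * (2 * query_time k + 13) + 51)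
     (\<lambda>s. if fst s 72 = 0 then j > 0 \<and> text_inv lo hi (j - 1) s else listed lo hi s \<and> fst s 76 = 0)"
proof (rule triple_pointwise)
  let ?code1 = "[Compute Add 68 62 3, Literal 69 0]"
  let ?code2 = "[Compute Sub 71 16 69, Emit 71, Compute Add 62 62 1, Compute Equal 72 62 63]"
  fix M0 out assume "text_inv lo hi j (M0, out)"
  define i where "i = M0 62"
  have M0: "regs M0" "i + Suc j = hi" "M0 63 = hi" "M0 76 = 0" "lo \<le> i" "out = map (SA T) [lo..<i]"
    using \<open>text_inv _ _ _ _\<close> by (auto simp: text_inv_def i_def)
  have i: "i \<in> {1..n}" using M0 b by auto
  have iw: "i < 2 ^ w" "i + 1 < 2 ^ w"
  proof -
    show "i < 2 ^ w" using pos_word[of i] i by auto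
    have "1 \<le> N0" using N0_pos[OF m] by (cases xs) auto
    then show "i + 1 < 2 ^ w" using pos_word[of i] i by auto
  qed
  define a where "a = (n - SA T i) mod (rate + 1)"
  have t1: "triple (\<lambda>s. s = (M0, out)) (Code ?code1) 2 (walk_inv i hi out a)"
  proof (rule triple_Code_ex)
    fix M out' assume "(M, out') = (M0, out)"
    then have MM: "M = M0" "out' = out" by auto
    define M' where "M' = M0(68 := i, 69 := 0)"
    have e: "fold ex ?code1 (M, out') = (M', out)"
      using MM base_regsD[OF M0(1)] iw by (simp add: M'_def alu_add flip: i_def)
    have "regs M'" using M0(1) by (rule regs_cong) (auto simp: M'_def)
    then have "walk_inv i hi out a (M', out)" using M0 i by (simp add: walk_inv_def M'_def a_def i_def)
    with e show "\<exists>s'. fold ex ?code1 (M, out') = s' \<and> walk_inv i hi out a s'"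
      by blast
  qed simp
  have rep: "triple (walk_inv i hi out a) (Rep (walk_body K) 70) ((a + 1) * (2 * query_time k + 12 + 1)) (walk_end i hi out)"
    by (rule triple_Rep[OF walk_body_triple[OF m k]])
  have "a < rate + 1" by (simp add: a_def)
  then have le: "(a + 1) * (2 * query_time k + 12 + 1) \<le> (rate + 1) * (2 * query_time k + 13)"
    by (intro mult_mono) auto
  have t2: "triple (walk_inv i hi out a) (Rep (walk_body K) 70) ((rate + 1) * (2 * query_time k + 13))
      (walk_end i hi out)" by (rule triple_weaken[OF rep _ le]) auto
  have t3: "triple (walk_end i hi out)
     (Code (sample_code @ ?code2)) 49
     (\<lambda>s. if fst s 72 = 0 then j > 0 \<and> text_inv lo hi (j - 1) s else listed lo hi s \<and> fst s 76 = 0)"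
  proof (rule triple_Code_ex)
    fix M out' assume "walk_end i hi out (M, out')"
    then obtain x where q: "out' = out" "regs M" "M 62 = i" "M 63 = hi" "M 76 = 0" "x \<in> {1..n}"
      "SA T x = SA T i + M 69" "M 22 < N0" "xs ! M 22 = x" by (auto simp: walk_end_def)
    obtain M1 where M1: "fold ex sample_code (M, out) = (M1, out)" "\<forall>a. a < 10 \<or> a \<ge> 20 \<longrightarrow> M1 a = M a"
      "M 22 < N0 \<longrightarrow> M1 16 = arr ! (perm ! M 22)"
      using sample[OF q(2) lam, of out] by blast
    have M16: "M1 16 = SA T x" using M1(3) q(8,9) text_samples[OF m] by auto
    have sub: "alu w Sub (SA T x) (M 69) = SA T i" using q(7) SA_word[OF q(6)] by (subst alu_sub) auto
    define M2 where "M2 = M1(71 := SA T i, 62 := i + 1, 72 := of_bool (i + 1 = hi))"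
    have M1v: "M1 69 = M 69" "M1 62 = i" "M1 63 = hi" "M1 1 = 1"
      using M1(2) q base_regsD[OF q(2)] by auto
    have f2: "fold ex ?code2 (M1, out) =
        (M2, out @ [SA T i])"
      using M16 sub M1v iw by (simp add: M2_def alu_add)
    have e: "fold ex (sample_code @ ?code2)
       (M, out') = (M2, out @ [SA T i])"
      by (simp only: fold_append comp_apply q(1) M1(1) f2)
    have r2: "regs M2" using q(2) by (rule regs_cong) (use M1(2) in \<open>auto simp: M2_def\<close>)
    have o: "out @ [SA T i] = map (SA T) [lo..<i + 1]" using M0(5,6) by simp
    have v2: "M2 72 = of_bool (i + 1 = hi)" "M2 76 = 0" "M2 63 = hi" "M2 62 = i + 1"
      using M1(2) q by (auto simp: M2_def)
    have post: "if M2 72 = 0 then j > 0 \<and> text_inv lo hi (j - 1) (M2, out @ [SA T i])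
       else listed lo hi (M2, out @ [SA T i]) \<and> M2 76 = 0"
    proof (cases "i + 1 = hi")
      case True
      then show ?thesis using v2 o by (simp add: listed_def)
    next
      case False
      then have "j > 0" using M0(2) by simp
      then show ?thesis using False v2 o r2 M0(2,5) by (simp add: text_inv_def)
    qed
    show "\<exists>s'. fold ex (sample_code @ ?code2)
       (M, out') = s' \<and> (if fst s' 72 = 0 then j > 0 \<and> text_inv lo hi (j - 1) s' else listed lo hi s' \<and> fst s' 76 = 0)"
      by (rule exI, rule conjI, rule e, unfold fst_conv, rule post)
  qed (simp add: length_sample_code)
  have "triple (\<lambda>s. s = (M0, out)) (text_body K) (2 + ((rate + 1) * (2 * query_time k + 13) + 49))
     (\<lambda>s. if fst s 72 = 0 then j > 0 \<and> text_inv lo hi (j - 1) s else listed lo hi s \<and> fst s 76 = 0)"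
    unfolding text_body_def by (rule triple_Seq[OF t1 triple_Seq[OF t2 t3]])
  then show "triple (\<lambda>s. s = (M0, out)) (text_body K) ((rate + 1) * (2 * query_time k + 13) + 51)
     (\<lambda>s. if fst s 72 = 0 then j > 0 \<and> text_inv lo hi (j - 1) s else listed lo hi s \<and> fst s 76 = 0)"
    by (rule triple_weaken) auto
qed

definition run_inv :: "nat \<Rightarrow> nat \<Rightarrow> nat \<Rightarrow> state \<Rightarrow> bool" where
  "run_inv lo hi k s \<longleftrightarrow> regs (fst s) \<and> fst s 74 = Suc k \<and> Suc k \<le> hi - lo \<and>
     fst s 64 = SA T (hi - Suc k) \<and> snd s = map (SA T) [lo..<hi - Suc k]"

lemma run_body_triple:
  assumes m: "mode = 0" and lam: "lam < w" and k: "nb < 2 ^ Suc k" and b: "1 \<le> lo" "hi \<le> n + 1"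
  shows "triple (run_inv lo hi j) (run_body K) (query_time k + 52)
     (\<lambda>s. if fst s 72 = 0 then j > 0 \<and> run_inv lo hi (j - 1) s else listed lo hi s)"
proof (rule triple_pointwise)
  let ?code1 = "[Emit 64, Compute Add 25 2 3, Compute Add 26 64 3]"
  let ?code2 = "[Compute Sub 75 23 64, Compute Sub 64 16 75, Compute Sub 74 74 1,
      Compute Equal 72 74 3]"
  fix M0 out assume "run_inv lo hi j (M0, out)"
  define i where "i = hi - Suc j"
  have M0: "regs M0" "M0 74 = Suc j" "Suc j \<le> hi - lo" "M0 64 = SA T i" "out = map (SA T) [lo..<i]"
    using \<open>run_inv _ _ _ _\<close> by (auto simp: run_inv_def i_def)
  have i: "i \<in> {1..n}" "lo \<le> i" "i + Suc j = hi" using M0(3) b by (auto simp: i_def)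
  define q where "q = SA T i"
  have q: "q \<in> {1..n}" "q < 2 ^ w" using SA_in[OF i(1)] SA_word[OF i(1)] by (auto simp: q_def)
  have jw: "Suc j < 2 ^ w"
  proof -
    have "Suc j \<le> n" using i(1,3) b by auto
    then show ?thesis using pos_word[of "Suc j"] by linarith
  qed
  define out1 where "out1 = map (SA T) [lo..<i + 1]"
  have o: "out @ [q] = out1" using M0(5) i(2) by (simp add: out1_def q_def)
  define M1 where "M1 = M0(25 := 2 ^ (w - 1), 26 := q)"
  have c1: "fold ex ?code1 (M0, out) = (M1, out1)"
    using base_regsD[OF M0(1)] M0(4) q o big_bounds(3) by (simp add: M1_def alu_add flip: q_def)
  have r1: "regs M1" using M0(1) by (rule regs_cong) (auto simp: M1_def)
  have t1: "triple (\<lambda>s. s = (M0, out)) (Code ?code1) 3 (\<lambda>s. s = (M1, out1))"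
    by (rule triple_Code) (use c1 in auto)
  define Q where "Q s \<longleftrightarrow> snd s = out1 \<and> regs (fst s) \<and> fst s 74 = Suc j \<and> fst s 64 = q \<and>
     found (2 ^ (w - 1)) q (fst s 22) \<and> fst s 23 = sval (fst s 22)" for s :: state
  have t2: "triple (\<lambda>s. s = (M1, out1)) (query K) (query_time k) Q"
  proof (rule triple_weaken[OF query_regs[OF r1 k]])
    fix s assume s: "snd s = out1 \<and> regs (fst s) \<and> frame M1 (fst s) \<and> found (M1 25) (M1 26) (fst s 22) \<and>
       fst s 23 = sval (fst s 22) \<and> fst s 24 = ps (fst s 22)"
    then have f: "frame M1 (fst s)" by blast
    show "Q s" unfolding Q_def using s frameD[OF f] M0(2,4) by (simp add: M1_def q_def)
  qed auto
  have t3: "triple Q (Code (sample_code @ ?code2)) 49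
     (\<lambda>s. if fst s 72 = 0 then j > 0 \<and> run_inv lo hi (j - 1) s else listed lo hi s)"
  proof (rule triple_Code_ex)
    fix M out' assume "Q (M, out')"
    then have Q: "out' = out1" "regs M" "M 74 = Suc j" "M 64 = q" "found (2 ^ (w - 1)) q (M 22)"
      "M 23 = sval (M 22)" by (auto simp: Q_def)
    have xs: "set xs = SA T ` ends" using run_samples[OF m] by blast
    have "n \<in> set xs" using xs one_in_ends SA_1 by force
    moreover have "q \<le> n" using q by simp
    ultimately have f: "M 22 < N0" "sval (M 22) = xs ! M 22" "q \<le> xs ! M 22"
      "\<And>y. y \<in> set xs \<Longrightarrow> q \<le> y \<Longrightarrow> xs ! M 22 \<le> y"
      using found_aux[OF Q(5) big_bounds(1), of n] by blast+
    define y where "y = xs ! M 22"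
    have "y \<in> set xs" using f(1) by (simp add: y_def)
    then obtain e where e: "e \<in> ends" "y = SA T e" using xs by auto
    have yw: "y < 2 ^ w" using e SA_word[of e] by (auto simp: ends_def)
    obtain M1 where M1: "fold ex sample_code (M, out1) = (M1, out1)" "\<forall>a. a < 10 \<or> a \<ge> 20 \<longrightarrow> M1 a = M a"
      "M 22 < N0 \<longrightarrow> M1 16 = arr ! (perm ! M 22)"
      using sample[OF Q(2) lam, of out1] by blast
    define M2 where "M2 = M1(75 := y - q, 64 := alu w Sub (M1 16) (y - q), 74 := j, 72 := of_bool (j = 0))"
    have M1v: "M1 23 = y" "M1 64 = q" "M1 74 = Suc j" "M1 1 = 1" "M1 3 = 0"
      using M1(2) Q f(2) base_regsD[OF Q(2)] by (auto simp: y_def)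
    have a1: "alu w Sub y q = y - q" using f(3) yw by (intro alu_sub) (auto simp: y_def)
    have a2: "alu w Sub (Suc j) 1 = j" using jw by (subst alu_sub) auto
    have f2: "fold ex ?code2
       (M1, out1) = (M2, out1)"
      using M1v a1 a2 by (simp add: M2_def)
    have e1: "fold ex (sample_code @ ?code2) (M, out') = (M2, out1)"
      by (simp only: fold_append comp_apply Q(1) M1(1) f2)
    have r2: "regs M2" using Q(2) by (rule regs_cong) (use M1(2) in \<open>auto simp: M2_def\<close>)
    have post: "if M2 72 = 0 then j > 0 \<and> run_inv lo hi (j - 1) (M2, out1) else listed lo hi (M2, out1)"
    proof (cases "j = 0")
      case True
      then show ?thesis using i by (simp add: M2_def listed_def out1_def)
    next
      case False
      then have il: "i \<in> {1..<n}" using i b by auto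
      have "e < n \<and> SA T (i + 1) + (SA T e - SA T i) = SA T (e + 1)"
      proof (rule SA_Suc[OF il e(1)])
        show "SA T i \<le> SA T e" using f(3) e(2) by (simp add: y_def q_def)
        show "SA T e \<le> SA T e'" if "e' \<in> ends" "SA T i \<le> SA T e'" for e'
          using f(4)[of "SA T e'"] xs that e(2) by (simp add: y_def q_def)
      qed
      then have en: "e < n" "SA T (i + 1) + (y - q) = SA T (e + 1)" using e(2) by (auto simp: q_def)
      have "M1 16 = SA T (e + 1)"
        using M1(3) f(1) run_samples[OF m] e en(1) by (auto simp: y_def)
      moreover have "SA T (e + 1) < 2 ^ w" using SA_word[of "e + 1"] en by simp
      ultimately have "alu w Sub (M1 16) (y - q) = SA T (i + 1)"
        using en(2) by (subst alu_sub) auto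
      moreover have "hi - Suc (j - 1) = i + 1" using i(3) False by simp
      ultimately show ?thesis using False r2 M0(3) by (simp add: M2_def run_inv_def out1_def)
    qed
    show "\<exists>s'. fold ex (sample_code @ ?code2) (M, out') = s' \<and>
       (if fst s' 72 = 0 then j > 0 \<and> run_inv lo hi (j - 1) s' else listed lo hi s')"
      by (rule exI, rule conjI, rule e1, unfold fst_conv, rule post)
  qed (simp add: length_sample_code)
  have "triple (\<lambda>s. s = (M0, out)) (run_body K) (3 + (query_time k + 49))
     (\<lambda>s. if fst s 72 = 0 then j > 0 \<and> run_inv lo hi (j - 1) s else listed lo hi s)"
    unfolding run_body_def by (rule triple_Seq[OF t1 triple_Seq[OF t2 t3]])
  then show "triple (\<lambda>s. s = (M0, out)) (run_body K) (query_time k + 52)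
     (\<lambda>s. if fst s 72 = 0 then j > 0 \<and> run_inv lo hi (j - 1) s else listed lo hi s)"
    by (rule triple_weaken) auto
qed

end

section \<open>The query program\<close>

definition length_body :: com where
  "length_body = Code [Read_Pattern 61 60, Compute Add 60 60 1, Compute Equal 67 61 3,
     Compute Less 65 50 60, Compute Or 65 65 67]"

definition report :: "nat \<Rightarrow> com" where
  "report K = When 56 (Rep (text_body K) 72) ;; When 76 (Rep (run_body K) 72)"

definition search_and_report :: "nat \<Rightarrow> com" where
  "search_and_report K =
     Code [Compute Sub 60 60 1, Literal 62 0, Compute Add 63 50 3, Literal 64 0] ;;
     Rep (search_body K) 65 ;;
     Code [Compute Less 65 62 63, Compute Equal 76 56 3, Compute Sub 74 63 62] ;;
     When 65 (report K)"

text \<open>Patterns longer than \<open>N\<close>, which may even exceed the address range, are detected while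
  the pattern is measured; they have no occurrences.\<close>

definition csa_program :: "nat \<Rightarrow> com" where
  "csa_program K =
     Code (init_code K @ [Literal 60 0]) ;;
     Rep length_body 65 ;;
     When 67 (search_and_report K)"

lemma well_formed_csa_program: "well_formed (csa_program K)"
proof -
  have "list_all jump_free (read_params K cs)" for cs
    by (induction cs) (simp_all add: read_params_def)
  then show ?thesis
    by (simp add: csa_program_def search_and_report_def report_def length_body_def init_code_def
        search_body_def lower_def query_def bsearch_body_def scan_body_def text_body_def run_body_def
        walk_body_def sample_code_def start_code_def)
qed

lemma length_init_code: "length (init_code K) = 7 * K + 187"
  by (simp add: init_code_def read_params_def length_decode_code)

context csa
begin

lemma length_body_triple:
  "triple (\<lambda>s. snd s = [] \<and> regs (fst s) \<and> fst s 60 + k = min (length P) N) length_body 5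
    (\<lambda>s. if fst s 65 = 0 then k > 0 \<and> (snd s = [] \<and> regs (fst s) \<and> fst s 60 + (k - 1) = min (length P) N)
       else snd s = [] \<and> regs (fst s) \<and> (fst s 67 \<noteq> 0 \<longleftrightarrow> length P \<le> N) \<and>
         (length P \<le> N \<longrightarrow> fst s 60 = length P + 1))"
  unfolding length_body_def
proof (rule triple_Code_ex)
  let ?code = "[Read_Pattern 61 60, Compute Add 60 60 1, Compute Equal 67 61 3,
      Compute Less 65 50 60, Compute Or 65 65 67]"
  fix M :: "nat \<Rightarrow> nat" and out :: "nat list" assume "snd (M, out) = [] \<and> regs (fst (M, out)) \<and> fst (M, out) 60 + k = min (length P) N"
  then have r: "out = []" "regs M" "M 60 + k = min (length P) N" by auto
  define m where "m = M 60"
  have m: "m \<le> length P" "m \<le> N" "m + k = min (length P) N" using r(3) by (auto simp: m_def)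
  have pz: "pattern_word P m = 0 \<longleftrightarrow> m = length P"
  proof (cases "m < length P")
    case True
    then have "P ! m \<in> {1..\<sigma>}" using pattern(2) nth_mem by blast
    then show ?thesis using True by (simp add: pattern_word_def)
  next
    case False
    then show ?thesis using m(1) by (simp add: pattern_word_def)
  qed
  have "N < 2 ^ L"
  proof -
    have "1 * N \<le> (\<sigma> + 1) * N" by (intro mult_right_mono) auto
    then show ?thesis using small_values(1) by linarith
  qed
  then have "m + 1 < 2 ^ Suc L" using m(2) by simp
  also have "(2::nat) ^ Suc L \<le> 2 ^ w" using word_size by (intro power_increasing) auto
  finally have mw: "m + 1 < 2 ^ w" .
  have b: "M 1 = 1" "M 3 = 0" "M 50 = N" using base_regsD[OF r(2)] r(2) by (auto simp: regs_def)
  define M' where "M' = M(61 := pattern_word P m, 60 := m + 1, 67 := of_bool (m = length P),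
    65 := of_bool (N < m + 1 \<or> m = length P))"
  have e: "fold ex ?code (M, out) = (M', [])"
    using r(1) b mw pz by (simp add: M'_def alu_add flip: m_def)
  have r': "regs M'" using r(2) by (rule regs_cong) (auto simp: M'_def)
  have v: "M' 65 = of_bool (N < m + 1 \<or> m = length P)" "M' 67 = of_bool (m = length P)" "M' 60 = m + 1"
    by (simp_all add: M'_def)
  have post: "if M' 65 = 0 then k > 0 \<and> (([] :: nat list) = [] \<and> regs M' \<and> M' 60 + (k - 1) = min (length P) N)
       else ([] :: nat list) = [] \<and> regs M' \<and> (M' 67 \<noteq> 0 \<longleftrightarrow> length P \<le> N) \<and> (length P \<le> N \<longrightarrow> M' 60 = length P + 1)"
  proof (cases "N < m + 1 \<or> m = length P")
    case True
    then show ?thesis using v r' m by auto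
  next
    case False
    then have "k > 0" using m by (cases k) auto
    then show ?thesis using False v r' m(3) by simp
  qed
  show "\<exists>s'. fold ex ?code (M, out) = s' \<and>
     (if fst s' 65 = 0 then k > 0 \<and> (snd s' = [] \<and> regs (fst s') \<and> fst s' 60 + (k - 1) = min (length P) N)
       else snd s' = [] \<and> regs (fst s') \<and> (fst s' 67 \<noteq> 0 \<longleftrightarrow> length P \<le> N) \<and>
         (length P \<le> N \<longrightarrow> fst s' 60 = length P + 1))"
    by (rule exI, rule conjI, rule e, unfold fst_conv snd_conv, rule post)
qed simp

definition report_time :: "nat \<Rightarrow> nat" where
  "report_time k = (rate + 1) * (2 * query_time k + 13) + 53"

lemma report_triple:
  assumes lam: "lam < w" and k: "nb < 2 ^ Suc k" and b: "1 \<le> lo" "hi \<le> n + 1" "lo < hi"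
  shows "triple (\<lambda>s. snd s = [] \<and> regs (fst s) \<and> fst s 62 = lo \<and> fst s 63 = hi \<and> fst s 74 = hi - lo \<and>
      fst s 76 = of_bool (mode = 0) \<and> (mode = 0 \<longrightarrow> fst s 64 = SA T lo))
     (report K) ((hi - lo) * report_time k + 2) (listed lo hi)"
proof (cases "mode = 0")
  case m: True
  let ?I = "\<lambda>s :: state. snd s = [] \<and> regs (fst s) \<and> fst s 62 = lo \<and> fst s 63 = hi \<and> fst s 74 = hi - lo \<and>
      fst s 76 = of_bool (mode = 0) \<and> (mode = 0 \<longrightarrow> fst s 64 = SA T lo)"
  have rep: "triple (run_inv lo hi (hi - lo - 1)) (Rep (run_body K) 72)
      ((hi - lo - 1 + 1) * (query_time k + 52 + 1)) (listed lo hi)"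
    by (rule triple_Rep[OF run_body_triple[OF m lam k b(1,2)]])
  have le: "(hi - lo - 1 + 1) * (query_time k + 52 + 1) \<le> (hi - lo) * report_time k"
  proof -
    have "query_time k + 52 + 1 \<le> 1 * (2 * query_time k + 13) + 53" by simp
    also have "\<dots> \<le> (rate + 1) * (2 * query_time k + 13) + 53" by (intro add_mono mult_right_mono) auto
    finally have "query_time k + 52 + 1 \<le> report_time k" by (simp only: report_time_def)
    then show ?thesis using b(3) by (intro mult_mono) auto
  qed
  have t: "triple (\<lambda>s. ?I s \<and> fst s 76 \<noteq> 0) (Rep (run_body K) 72) ((hi - lo) * report_time k) (listed lo hi)"
  proof (rule triple_weaken[OF rep _ le])
    fix s :: state assume "?I s \<and> fst s 76 \<noteq> 0"
    then show "run_inv lo hi (hi - lo - 1) s" unfolding run_inv_def using b m by auto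
  qed
  have t1: "triple ?I (When 56 (Rep (text_body K) 72)) (0 + 1) ?I"
  proof (rule triple_When)
    have "\<not> (?I s \<and> fst s 56 \<noteq> 0)" for s :: state using m unfolding regs_def by auto
    then show "triple (\<lambda>s. ?I s \<and> fst s 56 \<noteq> 0) (Rep (text_body K) 72) 0 ?I" unfolding triple_def by blast
  qed
  have t2: "triple ?I (When 76 (Rep (run_body K) 72)) ((hi - lo) * report_time k + 1) (listed lo hi)"
    by (rule triple_When[OF t]) (use m in simp)
  show ?thesis unfolding report_def by (rule triple_weaken[OF triple_Seq[OF t1 t2]]) auto
next
  case m: False
  let ?I = "\<lambda>s :: state. snd s = [] \<and> regs (fst s) \<and> fst s 62 = lo \<and> fst s 63 = hi \<and> fst s 74 = hi - lo \<and>
      fst s 76 = of_bool (mode = 0) \<and> (mode = 0 \<longrightarrow> fst s 64 = SA T lo)"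
  let ?Q = "\<lambda>s :: state. listed lo hi s \<and> fst s 76 = 0"
  have rep: "triple (text_inv lo hi (hi - lo - 1)) (Rep (text_body K) 72)
      ((hi - lo - 1 + 1) * ((rate + 1) * (2 * query_time k + 13) + 51 + 1)) ?Q"
    by (rule triple_Rep[OF text_body_triple[OF m lam k b(1,2)]])
  have le: "(hi - lo - 1 + 1) * ((rate + 1) * (2 * query_time k + 13) + 51 + 1) \<le> (hi - lo) * report_time k"
    using b(3) by (intro mult_mono) (auto simp: report_time_def)
  have t: "triple (\<lambda>s. ?I s \<and> fst s 56 \<noteq> 0) (Rep (text_body K) 72) ((hi - lo) * report_time k) ?Q"
    by (rule triple_weaken[OF rep _ le]) (use b m in \<open>auto simp: text_inv_def\<close>)
  have t1: "triple ?I (When 56 (Rep (text_body K) 72)) ((hi - lo) * report_time k + 1) ?Q"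
    by (rule triple_When[OF t]) (use m in \<open>auto simp: regs_def\<close>)
  have t2: "triple ?Q (When 76 (Rep (run_body K) 72)) (0 + 1) (listed lo hi)"
  proof (rule triple_When)
    show "triple (\<lambda>s. ?Q s \<and> fst s 76 \<noteq> 0) (Rep (run_body K) 72) 0 (listed lo hi)"
      unfolding triple_def by auto
  qed simp
  show ?thesis unfolding report_def by (rule triple_weaken[OF triple_Seq[OF t1 t2]]) auto
qed

definition correct :: "state \<Rightarrow> bool" where
  "correct s \<longleftrightarrow> distinct (snd s) \<and> set (snd s) = occurrences T P"

lemma listed_correct:
  assumes "range_of P lo hi" "listed lo hi s"
  shows "correct s"
proof -
  have r: "1 \<le> lo" "hi \<le> n + 1" "matches P = {lo..<hi}" using assms(1) pattern by (auto simp: range_of_def)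
  have sub: "{lo..<hi} \<subseteq> {1..n}" using r by auto
  have "inj_on (SA T) {lo..<hi}" using SA_bij sub by (meson bij_betw_def inj_on_subset)
  then show ?thesis
    using assms(2) occurrences_image[OF pattern(1)] r(3) by (simp add: correct_def listed_def distinct_map)
qed

lemma card_occurrences: "range_of P lo hi \<Longrightarrow> card (occurrences T P) = hi - lo"
proof -
  assume "range_of P lo hi"
  then have r: "1 \<le> lo" "hi \<le> n + 1" "matches P = {lo..<hi}" using pattern by (auto simp: range_of_def)
  have sub: "{lo..<hi} \<subseteq> {1..n}" using r by auto
  have "inj_on (SA T) {lo..<hi}" using SA_bij sub by (meson bij_betw_def inj_on_subset)
  then show ?thesis using occurrences_image[OF pattern(1)] r(3) by (simp add: card_image)
qed

lemma search_and_report_triple: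
  assumes lam: "lam < w" and k: "nb < 2 ^ Suc k" and P: "length P \<le> N"
  shows "triple (\<lambda>s. snd s = [] \<and> regs (fst s) \<and> fst s 60 = length P + 1) (search_and_report K)
    (length P * (2 * query_time k + 63) + card (occurrences T P) * report_time k + 10) correct"
proof -
  let ?code1 = "[Compute Sub 60 60 1, Literal 62 0, Compute Add 63 50 3, Literal 64 0]"
  let ?code2 = "[Compute Less 65 62 63, Compute Equal 76 56 3, Compute Sub 74 63 62]"
  define p where "p = length P"
  have p: "p > 0" "p \<le> N" using pattern P by (auto simp: p_def)
  have "N < 2 ^ L"
  proof -
    have "1 * N \<le> (\<sigma> + 1) * N" by (intro mult_right_mono) auto
    then show ?thesis using small_values(1) by linarith
  qed
  then have Nw: "N < 2 ^ w" "p + 1 < 2 ^ w"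
  proof -
    show "N < 2 ^ w" using \<open>N < 2 ^ L\<close> by (rule less_word)
    have "p + 1 < 2 ^ Suc L" using p \<open>N < 2 ^ L\<close> by simp
    also have "(2::nat) ^ Suc L \<le> 2 ^ w" using word_size by (intro power_increasing) auto
    finally show "p + 1 < 2 ^ w" .
  qed
  have t1: "triple (\<lambda>s. snd s = [] \<and> regs (fst s) \<and> fst s 60 = length P + 1)
     (Code ?code1) 4 (search_inv p)"
  proof (rule triple_Code_ex)
    fix M :: "nat \<Rightarrow> nat" and out :: "nat list" assume "snd (M, out) = [] \<and> regs (fst (M, out)) \<and> fst (M, out) 60 = length P + 1"
    then have r: "out = []" "regs M" "M 60 = p + 1" by (auto simp: p_def)
    define M' where "M' = M(60 := p, 62 := 0, 63 := N, 64 := 0)"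
    have b: "M 1 = 1" "M 3 = 0" "M 50 = N" using base_regsD[OF r(2)] r(2) by (auto simp: regs_def)
    have e: "fold ex ?code1 (M, out) = (M', [])"
      using r b Nw by (simp add: M'_def alu_add alu_sub)
    have "regs M'" using r(2) by (rule regs_cong) (auto simp: M'_def)
    then have "search_inv p (M', [])"
      by (simp add: search_inv_def M'_def p_def range_of_def toehold_def)
    with e show "\<exists>s'. fold ex ?code1 (M, out) = s' \<and>
      search_inv p s'" by blast
  qed simp
  have body: "triple (\<lambda>s. search_inv (Suc m) s \<and> Suc m \<le> p) (search_body K) (2 * query_time k + 62)
     (\<lambda>s. if fst s 65 = 0 then m > 0 \<and> (search_inv (Suc (m - 1)) s \<and> Suc (m - 1) \<le> p) else search_inv 0 s)" for m
  proof (rule triple_pointwise)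
    fix M :: "nat \<Rightarrow> nat" and out :: "nat list" assume a: "search_inv (Suc m) (M, out) \<and> Suc m \<le> p"
    then have "Suc m \<le> length P" by (simp add: p_def)
    from search_body_triple[OF k this P]
    show "triple (\<lambda>s. s = (M, out)) (search_body K) (2 * query_time k + 62)
     (\<lambda>s. if fst s 65 = 0 then m > 0 \<and> (search_inv (Suc (m - 1)) s \<and> Suc (m - 1) \<le> p) else search_inv 0 s)"
      by (rule triple_weaken) (use a in auto)
  qed
  have "triple (\<lambda>s. search_inv (Suc (p - 1)) s \<and> Suc (p - 1) \<le> p) (Rep (search_body K) 65)
     ((p - 1 + 1) * (2 * query_time k + 62 + 1)) (search_inv 0)"
    by (rule triple_Rep[where I = "\<lambda>m s. search_inv (Suc m) s \<and> Suc m \<le> p", OF body])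
  then have t2: "triple (search_inv p) (Rep (search_body K) 65) (p * (2 * query_time k + 63)) (search_inv 0)"
    by (rule triple_weaken) (use p in auto)
  let ?S = "\<lambda>lo hi s. range_of P lo hi \<and> snd s = [] \<and> regs (fst s) \<and> fst s 62 = lo \<and> fst s 63 = hi \<and>
      fst s 74 = hi - lo \<and> fst s 76 = of_bool (mode = 0) \<and> (mode = 0 \<and> lo < hi \<longrightarrow> fst s 64 = SA T lo) \<and>
      fst s 65 = of_bool (lo < hi)"
  have t3: "triple (search_inv 0) (Code ?code2) 3
     (\<lambda>s. \<exists>lo hi. ?S lo hi s)"
  proof (rule triple_Code_ex)
    fix M :: "nat \<Rightarrow> nat" and out :: "nat list" assume "search_inv 0 (M, out)"
    define lo hi where "lo = M 62" and "hi = M 63"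
    have r: "out = []" "regs M" "range_of P lo hi" "toehold P lo hi (M 64)"
      using \<open>search_inv 0 (M, out)\<close> by (auto simp: search_inv_def lo_def hi_def)
    have lh: "lo \<le> hi" "hi < 2 ^ w" using r(3) range_less[OF r(3)] Nw by (auto simp: range_of_def)
    have b: "M 3 = 0" "M 56 = mode" using base_regsD[OF r(2)] r(2) by (auto simp: regs_def)
    define M' where "M' = M(65 := of_bool (lo < hi), 76 := of_bool (mode = 0), 74 := hi - lo)"
    have e: "fold ex ?code2 (M, out) = (M', [])"
      using r b lh by (simp add: M'_def alu_sub flip: lo_def hi_def)
    have "regs M'" using r(2) by (rule regs_cong) (auto simp: M'_def)
    moreover have "mode = 0 \<and> lo < hi \<longrightarrow> M 64 = SA T lo" using r(4) pattern(1) unfolding toehold_def by blast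
    ultimately have "?S lo hi (M', [])" using r(3) by (simp add: M'_def lo_def hi_def)
    with e show "\<exists>s'. fold ex ?code2 (M, out) = s' \<and>
      (\<exists>lo hi. ?S lo hi s')" by blast
  qed simp
  have t4: "triple (\<lambda>s. \<exists>lo hi. ?S lo hi s) (When 65 (report K)) (card (occurrences T P) * report_time k + 2 + 1) correct"
  proof (rule triple_When)
    show "triple (\<lambda>s. (\<exists>lo hi. ?S lo hi s) \<and> fst s 65 \<noteq> 0) (report K) (card (occurrences T P) * report_time k + 2) correct"
    proof (rule triple_pointwise)
      fix M :: "nat \<Rightarrow> nat" and out :: "nat list" assume "(\<exists>lo hi. ?S lo hi (M, out)) \<and> fst (M, out) 65 \<noteq> 0"
      then obtain lo hi where S: "?S lo hi (M, out)" and "fst (M, out) 65 \<noteq> 0" by blast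
      then have lh: "lo < hi" by (auto split: if_splits)
      have r: "range_of P lo hi" using S by blast
      then have b: "1 \<le> lo" "hi \<le> n + 1" using pattern by (auto simp: range_of_def)
      show "triple (\<lambda>s. s = (M, out)) (report K) (card (occurrences T P) * report_time k + 2) correct"
        by (rule triple_weaken[OF report_triple[OF lam k b lh]])
          (use S lh card_occurrences[OF r] listed_correct[OF r] in auto)
    qed
  next
    fix s :: state assume "\<exists>lo hi. ?S lo hi s" "fst s 65 = 0"
    then obtain lo hi where S: "?S lo hi s" by blast
    then have "\<not> lo < hi" using \<open>fst s 65 = 0\<close> by (cases "lo < hi") auto
    then have "listed lo hi s" using S by (simp add: listed_def)
    then show "correct s" using listed_correct S by blast
  qed
  have "triple (\<lambda>s. snd s = [] \<and> regs (fst s) \<and> fst s 60 = length P + 1) (search_and_report K)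
    (4 + (p * (2 * query_time k + 63) + (3 + (card (occurrences T P) * report_time k + 2 + 1)))) correct"
    unfolding search_and_report_def by (rule triple_Seq[OF t1 triple_Seq[OF t2 triple_Seq[OF t3 t4]]])
  then show ?thesis by (rule triple_weaken) (auto simp: p_def)
qed

theorem csa_program_ok:
  assumes lam: "lam < w" and k: "nb < 2 ^ Suc k"
  shows "ok (csa_program K) (\<lambda>t s. t \<le> 7 * K + 200 + (length P + 1) * 6 +
      length P * (2 * query_time k + 63) + card (occurrences T P) * report_time k \<and> correct s)
     ((\<lambda>_. 0)(0 := w), [])"
proof -
  define m where "m = min (length P) N"
  have t1: "triple (\<lambda>s. s = ((\<lambda>_. 0)(0 := w), [])) (Code (init_code K @ [Literal 60 0])) (7 * K + 188)
     (\<lambda>s. snd s = [] \<and> regs (fst s) \<and> fst s 60 + m = min (length P) N)"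
  proof (rule triple_Code_ex)
    fix M :: "nat \<Rightarrow> nat" and out :: "nat list" assume "(M, out) = ((\<lambda>_. 0)(0 := w), [] :: nat list)"
    then have MM: "M = (\<lambda>_. 0)(0 := w)" "out = []" by auto
    obtain M1 where M1: "fold ex (init_code K) ((\<lambda>_. 0)(0 := w), []) = (M1, [])" "regs M1"
      using init_regs[OF lam] by blast
    have "regs (M1(60 := 0))" using M1(2) by (rule regs_cong) auto
    moreover have "fold ex (init_code K @ [Literal 60 0]) (M, out) = (M1(60 := 0), [])"
      using M1(1) MM by simp
    ultimately show "\<exists>s'. fold ex (init_code K @ [Literal 60 0]) (M, out) = s' \<and>
      (snd s' = [] \<and> regs (fst s') \<and> fst s' 60 + m = min (length P) N)" by (simp add: m_def)
  qed (simp add: length_init_code)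
  let ?L = "\<lambda>s :: state. snd s = [] \<and> regs (fst s) \<and> (fst s 67 \<noteq> 0 \<longleftrightarrow> length P \<le> N) \<and>
         (length P \<le> N \<longrightarrow> fst s 60 = length P + 1)"
  have t2: "triple (\<lambda>s. snd s = [] \<and> regs (fst s) \<and> fst s 60 + m = min (length P) N) (Rep length_body 65)
     ((m + 1) * (5 + 1)) ?L"
    by (rule triple_Rep[where I = "\<lambda>k s. snd s = [] \<and> regs (fst s) \<and> fst s 60 + k = min (length P) N",
          OF length_body_triple])
  let ?t = "length P * (2 * query_time k + 63) + card (occurrences T P) * report_time k + 10"
  have t3: "triple ?L (When 67 (search_and_report K)) (?t + 1) correct"
  proof (rule triple_When)
    show "triple (\<lambda>s. ?L s \<and> fst s 67 \<noteq> 0) (search_and_report K) ?t correct"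
    proof (cases "length P \<le> N")
      case True
      show ?thesis
        by (rule triple_weaken[OF search_and_report_triple[OF lam k True]]) auto
    next
      case False
      then show ?thesis unfolding triple_def by auto
    qed
  next
    fix s :: state assume s: "?L s" "fst s 67 = 0"
    then have "n < length P" using N by auto
    then have "occurrences T P = {}" by (auto simp: occurrences_def n)
    then show "correct s" using s by (simp add: correct_def)
  qed
  have "triple (\<lambda>s. s = ((\<lambda>_. 0)(0 := w), [])) (csa_program K) (7 * K + 188 + ((m + 1) * (5 + 1) + (?t + 1))) correct"
    unfolding csa_program_def by (rule triple_Seq[OF t1 triple_Seq[OF t2 t3]])
  moreover have "(m + 1) * (5 + 1) \<le> (length P + 1) * 6" by (intro mult_mono) (auto simp: m_def)
  ultimately have "triple (\<lambda>s. s = ((\<lambda>_. 0)(0 := w), [])) (csa_program K)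
    (7 * K + 200 + (length P + 1) * 6 +
      length P * (2 * query_time k + 63) + card (occurrences T P) * report_time k) correct"
    by (elim triple_weaken) auto
  then show ?thesis unfolding triple_def by simp
qed

end

section \<open>Space\<close>

lemma ln_2_ge_half: "ln (2::real) \<ge> 1 / 2"
proof -
  have "exp (1 / 2 :: real) ^ 2 = exp 1" by (simp add: power2_eq_square flip: exp_add)
  also have "\<dots> \<le> 2 ^ 2" using exp_le by simp
  finally have "exp (1 / 2 :: real) \<le> 2" by (rule power2_le_imp_le) simp
  then have "ln (exp (1 / 2 :: real)) \<le> ln 2" by (subst ln_le_cancel_iff) auto
  then show ?thesis by simp
qed

lemma log2_le_scaled:
  fixes y Y :: real
  assumes "y > 0" "Y > 0"
  shows "log 2 y \<le> log 2 Y + 2 * (y / Y)"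
proof -
  have "ln y - ln Y = ln (y / Y)" using assms by (simp add: ln_div)
  also have "\<dots> \<le> y / Y" using assms ln_le_minus_one[of "y / Y"] by simp
  finally have "(ln y - ln Y) / ln 2 \<le> (y / Y) / ln 2" by (intro divide_right_mono) auto
  also have "\<dots> \<le> (y / Y) / (1 / 2)"
    using assms ln_2_ge_half by (intro divide_left_mono) auto
  also have "\<dots> = 2 * (y / Y)" by simp
  finally show ?thesis unfolding log_def diff_divide_distrib by linarith
qed

lemma sum_log2_le:
  fixes f :: "'a \<Rightarrow> real"
  assumes "\<And>j. j \<in> A \<Longrightarrow> f j > 0" "Y > 0" "(\<Sum>j\<in>A. f j) \<le> S"
  shows "(\<Sum>j\<in>A. log 2 (f j)) \<le> real (card A) * log 2 Y + 2 * (S / Y)"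
proof -
  have "(\<Sum>j\<in>A. log 2 (f j)) \<le> (\<Sum>j\<in>A. log 2 Y + 2 * (f j / Y))"
    using assms by (intro sum_mono log2_le_scaled) auto
  also have "\<dots> = real (card A) * log 2 Y + 2 * ((\<Sum>j\<in>A. f j) / Y)"
    by (simp add: sum.distrib sum_divide_distrib sum_distrib_left)
  also have "\<dots> \<le> real (card A) * log 2 Y + 2 * (S / Y)"
    using assms by (intro add_left_mono mult_left_mono divide_right_mono) auto
  finally show ?thesis .
qed

lemma length_chunk_code_le:
  assumes "K > 0"
  shows "real (length (chunk_code K x)) \<le> (1 + 1 / real K) * log 2 (real x + 1) + (real K + 2)"
proof (cases "chunks K x")
  case 0
  have "0 \<le> (1 + 1 / real K) * log 2 (real x + 1)" by simp
  then show ?thesis by (simp add: length_chunk_code 0)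
next
  case (Suc u)
  have "\<not> x < 2 ^ (K * u)" using Suc not_less_Least[of u "\<lambda>u. x < 2 ^ (K * u)"] by (simp add: chunks_def)
  then have "real (2 ^ (K * u)) \<le> real x + 1" by (simp only: of_nat_le_iff flip: of_nat_Suc Suc_eq_plus1)
  then have "2 powr real (K * u) \<le> real x + 1" by (simp add: powr_realpow del: of_nat_mult)
  then have "real (K * u) \<le> log 2 (real x + 1)" by (subst le_log_iff) auto
  then have u: "real K * real u \<le> log 2 (real x + 1)" by simp
  have "real (length (chunk_code K x)) = (1 + 1 / real K) * (real K * real u) + (real K + 2)"
    using assms by (simp add: length_chunk_code Suc field_simps)
  also have "\<dots> \<le> (1 + 1 / real K) * log 2 (real x + 1) + (real K + 2)"
    using u by (intro add_right_mono mult_left_mono) auto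
  finally show ?thesis .
qed

lemma length_chunk_code_le2:
  assumes "K > 0"
  shows "real (length (chunk_code K x)) \<le> 2 * log 2 (real x + 1) + (real K + 2)"
proof -
  have "1 / real K \<le> 1" using assms by simp
  then have "(1 + 1 / real K) * log 2 (real x + 1) \<le> 2 * log 2 (real x + 1)"
    by (intro mult_right_mono) auto
  then show ?thesis using length_chunk_code_le[OF assms, of x] by linarith
qed

lemma log2_Suc_le: "log 2 (real x + 1) \<le> real x"
proof -
  have "x < 2 ^ x" by (rule less_exp)
  then have "real x + 1 \<le> 2 ^ x" by (metis Suc_leI of_nat_Suc of_nat_le_iff of_nat_numeral of_nat_power add.commute)
  then show ?thesis by (simp add: log_le_iff powr_realpow)
qed

context sampled_text
begin

lemma r_le_n: "r \<le> n"
  using card_mono[OF _ starts_sub] by (simp add: r_def)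

lemma sum_gaps: "m \<le> N0 + r \<Longrightarrow> (\<Sum>j<m. (sval j - ve j) + slen j) = ve m"
proof (induction m)
  case 0 show ?case by (simp add: ve_def)
next
  case (Suc m)
  then show ?case using ve_le_sv[of m] ve_Suc[of m] by simp
qed

lemma stream_length_le:
  assumes N: "N \<le> 6 * n" and N0: "N0 \<le> r" and \<sigma>: "\<sigma> \<ge> 1"
  defines "a \<equiv> log 2 (real n / real r)" and "g \<equiv> log 2 (real \<sigma>)"
  shows "real (so (N0 + r)) \<le> real N0 * a + (1 + 2 / real K) * (real r * (2 * a + g)) + (82 + 4 * real K) * real r"
proof -
  define c where "c = 1 + 1 / real K"
  define gap where "gap j = real (sval j - ve j)" for j
  define len where "len j = real (slen j)" for j
  have rn: "real r > 0" "real n > 0" "real r \<le> real n" using r_pos n_pos r_le_n by auto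
  have a0: "a \<ge> 0" using rn by (simp add: a_def)
  have g0: "g \<ge> 0" using \<sigma> by (simp add: g_def)
  have cK: "0 \<le> c" "c \<le> 2" using K_pos by (auto simp: c_def)
  have "real (so (N0 + r)) = (\<Sum>j<N0 + r. real (length (chunk_code K (sval j - ve j))) + real (length (chunk_code K (slen j))))"
    by (simp add: so_def rec_code_def)
  also have "\<dots> \<le> (\<Sum>j<N0 + r. (c * log 2 (gap j + 1) + (real K + 2)) + (c * log 2 (len j + 1) + (real K + 2)))"
    unfolding c_def gap_def len_def by (intro sum_mono add_mono length_chunk_code_le K_pos)
  also have "\<dots> = c * ((\<Sum>j<N0 + r. log 2 (gap j + 1)) + (\<Sum>j<N0 + r. log 2 (len j + 1))) + 2 * (real K + 2) * real (N0 + r)"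
    by (simp add: sum.distrib sum_distrib_left algebra_simps)
  finally have 1: "real (so (N0 + r)) \<le> c * ((\<Sum>j<N0 + r. log 2 (gap j + 1)) + (\<Sum>j<N0 + r. log 2 (len j + 1))) +
     2 * (real K + 2) * real (N0 + r)" .
  have split: "{..<N0 + r} = {..<N0} \<union> {N0..<N0 + r}" "{..<N0} \<inter> {N0..<N0 + r} = {}" by auto
  have gsum: "(\<Sum>j<m. gap j) \<le> real (ve m)" if "m \<le> N0 + r" for m
  proof -
    have "(\<Sum>j<m. sval j - ve j) \<le> (\<Sum>j<m. (sval j - ve j) + slen j)" by (intro sum_mono) auto
    then show ?thesis using sum_gaps[OF that] by (simp add: gap_def flip: of_nat_sum)
  qed
  have "ve N0 \<le> n + 1"
  proof (cases "N0 = 0")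
    case True
    have "ve N0 = 0" unfolding ve_def using True by (simp only: simp_thms if_True)
    then show ?thesis by linarith
  next
    case False
    then show ?thesis using ve_aux[of "N0 - 1"] xs_range[of "N0 - 1"] by simp
  qed
  then have "(\<Sum>j<N0. gap j) \<le> real n + 1" using gsum[of N0] by linarith
  then have s1: "(\<Sum>j<N0. gap j + 1) \<le> 3 * real n"
    using N0 rn n_pos by (simp add: sum.distrib)
  have "(\<Sum>j\<in>{N0..<N0 + r}. gap j) \<le> (\<Sum>j<N0 + r. gap j)"
    by (intro sum_mono2) (auto simp: gap_def)
  also have "\<dots> \<le> real ((\<sigma> + 1) * N)" using gsum[of "N0 + r"] ve_R by (meson of_nat_le_iff order_trans order.refl)
  also have "(\<sigma> + 1) * N \<le> (2 * \<sigma>) * (6 * n)" using N \<sigma> by (intro mult_mono) auto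
  finally have "(\<Sum>j\<in>{N0..<N0 + r}. gap j) \<le> 12 * (real n * real \<sigma>)" by (simp add: mult.commute)
  moreover have "real r \<le> real n * real \<sigma>"
    using rn \<sigma> mult_mono[of "real r" "real n" 1 "real \<sigma>"] by simp
  ultimately have s2: "(\<Sum>j\<in>{N0..<N0 + r}. gap j + 1) \<le> 13 * (real n * real \<sigma>)"
    by (simp add: sum.distrib)
  have "(\<Sum>j\<in>{N0..<N0 + r}. slen j) + ps N0 = ps (N0 + r)"
    unfolding ps_def split(1) by (subst sum.union_disjoint) auto
  then have "(\<Sum>j\<in>{N0..<N0 + r}. slen j) = n" using ps_R ps_aux[of N0] by simp
  then have "(\<Sum>j\<in>{N0..<N0 + r}. len j) = real n" by (simp add: len_def flip: of_nat_sum)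
  then have s3: "(\<Sum>j\<in>{N0..<N0 + r}. len j + 1) \<le> 2 * real n" using rn by (simp add: sum.distrib)
  have Y: "real n / real r > 0" "real n * real \<sigma> / real r > 0" using rn \<sigma> by auto
  have "(\<Sum>j<N0. log 2 (gap j + 1)) \<le> real (card {..<N0}) * log 2 (real n / real r) + 2 * (3 * real n / (real n / real r))"
    by (rule sum_log2_le[OF _ Y(1) s1]) (simp add: gap_def add_nonneg_pos)
  then have l1: "(\<Sum>j<N0. log 2 (gap j + 1)) \<le> real N0 * a + 6 * real r" using rn by (simp add: a_def)
  have "(\<Sum>j\<in>{N0..<N0 + r}. log 2 (gap j + 1)) \<le>
     real (card {N0..<N0 + r}) * log 2 (real n * real \<sigma> / real r) + 2 * (13 * (real n * real \<sigma>) / (real n * real \<sigma> / real r))"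
    by (rule sum_log2_le[OF _ Y(2) s2]) (simp add: gap_def add_nonneg_pos)
  moreover have "log 2 (real n * real \<sigma> / real r) = a + g"
    using rn \<sigma> by (simp add: a_def g_def log_mult log_divide)
  ultimately have l2: "(\<Sum>j\<in>{N0..<N0 + r}. log 2 (gap j + 1)) \<le> real r * (a + g) + 26 * real r"
    using rn \<sigma> by simp
  have "(\<Sum>j\<in>{N0..<N0 + r}. log 2 (len j + 1)) \<le>
     real (card {N0..<N0 + r}) * log 2 (real n / real r) + 2 * (2 * real n / (real n / real r))"
    by (rule sum_log2_le[OF _ Y(1) s3]) (simp add: len_def add_nonneg_pos)
  then have l3: "(\<Sum>j\<in>{N0..<N0 + r}. log 2 (len j + 1)) \<le> real r * a + 4 * real r" using rn by (simp add: a_def)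
  have l4: "(\<Sum>j<N0. log 2 (len j + 1)) = real N0" by (simp add: len_def slen_def)
  have u: "(\<Sum>j<N0 + r. f j) = (\<Sum>j<N0. f j) + (\<Sum>j\<in>{N0..<N0 + r}. f j)" for f :: "nat \<Rightarrow> real"
    unfolding split(1) by (rule sum.union_disjoint) auto
  define X where "X = (\<Sum>j<N0 + r. log 2 (gap j + 1)) + (\<Sum>j<N0 + r. log 2 (len j + 1))"
  have "X \<le> real N0 * a + real r * (2 * a + g) + 37 * real r"
    unfolding X_def u using l1 l2 l3 l4 N0 by (simp add: algebra_simps)
  then have "c * X \<le> c * (real N0 * a + real r * (2 * a + g) + 37 * real r)"
    using cK by (intro mult_left_mono) auto
  also have "\<dots> = real N0 * a + real r * (2 * a + g) + (real N0 * a + real r * (2 * a + g)) / real K + c * (37 * real r)"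
    by (simp add: c_def algebra_simps add_divide_distrib)
  also have "\<dots> \<le> real N0 * a + real r * (2 * a + g) + (2 * (real r * (2 * a + g))) / real K + 2 * (37 * real r)"
  proof -
    have "real N0 * a \<le> real r * (2 * a + g)" using N0 a0 g0 by (intro mult_mono) auto
    then show ?thesis using cK a0 g0 by (intro add_mono divide_right_mono mult_right_mono) auto
  qed
  also have "\<dots> = real N0 * a + (1 + 2 / real K) * (real r * (2 * a + g)) + 74 * real r"
    by (simp add: algebra_simps add_divide_distrib)
  finally have 2: "c * X \<le> real N0 * a + (1 + 2 / real K) * (real r * (2 * a + g)) + 74 * real r" .
  have "2 * (real K + 2) * real (N0 + r) \<le> 2 * (real K + 2) * (2 * real r)"
    using N0 by (intro mult_left_mono) auto
  also have "\<dots> = (8 + 4 * real K) * real r" by (simp add: algebra_simps)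
  finally show ?thesis using 1 2 unfolding X_def[symmetric] by (simp add: algebra_simps)
qed

end

lemma length_chunk_code_nat:
  assumes "K > 0" "x < 2 ^ e"
  shows "length (chunk_code K x) \<le> 2 * e + K + 2"
proof -
  have "real x + 1 \<le> 2 ^ e"
    using assms(2) by (metis Suc_leI of_nat_Suc of_nat_le_iff of_nat_numeral of_nat_power add.commute)
  then have "log 2 (real x + 1) \<le> real e" by (simp add: log_le_iff powr_realpow)
  then have "real (length (chunk_code K x)) \<le> real (2 * e + K + 2)"
    using length_chunk_code_le2[OF assms(1), of x] by simp
  then show ?thesis by linarith
qed

context layout
begin

lemma header_length_le:
  assumes l: "real l \<le> log 2 (real n) + 3" and lam: "real lam \<le> log 2 (real r) + 1"
    and L: "real L \<le> 2 * log 2 (real n) + 2 * log 2 (real \<sigma>) + real K + 16"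
    and N0: "N0 \<le> r" and BS_le: "BS \<le> R" and mode: "mode \<le> 1" and \<sigma>: "\<sigma> \<ge> 1"
  defines "a \<equiv> log 2 (real n / real r)" and "g \<equiv> log 2 (real \<sigma>)"
  shows "real (length header) \<le> (12 / real K) * (real r * (2 * a + g)) + (11 * real K + 130) * real r"
proof -
  define Lg where "Lg = log 2 (real n)"
  have rn: "real r \<ge> 1" "real n > 0" "real r \<le> real n" using r_pos n_pos r_le_n by auto
  have K1: "real K \<ge> 1" using K_pos by simp
  have a0: "a \<ge> 0" using rn by (simp add: a_def)
  have g0: "g \<ge> 0" using \<sigma> by (simp add: g_def)
  have small_log: "log 2 (real x + 1) \<le> real x" for x :: nat by (rule log2_Suc_le)
  have logr: "log 2 (real r) \<le> real r" "Lg = a + log 2 (real r)"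
  proof -
    have "log 2 (real r) \<le> log 2 (real r + 1)" using rn by simp
    then show "log 2 (real r) \<le> real r" using small_log[of r] by linarith
    show "Lg = a + log 2 (real r)" using rn by (simp add: Lg_def a_def log_divide)
  qed
  have scaled: "2 * log 2 (real x + 1) \<le> 2 * real K + 4 * (real x + 1) / real K" for x :: nat
  proof -
    have "log 2 (real x + 1) \<le> log 2 (real K) + 2 * ((real x + 1) / real K)"
      using K1 by (intro log2_le_scaled) auto
    moreover have "log 2 (real K) \<le> log 2 (real K + 1)" using K1 by simp
    moreover have "log 2 (real K + 1) \<le> real K" by (rule small_log)
    moreover have "4 * (real x + 1) / real K = 2 * (2 * ((real x + 1) / real K))" by simp
    ultimately show ?thesis by linarith
  qed
  have "real (length header) = (\<Sum>x\<leftarrow>params. real (length (chunk_code K x)))"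
    by (simp add: header_def params_def length_concat)
  also have "\<dots> \<le> (\<Sum>x\<leftarrow>params. 2 * log 2 (real x + 1) + (real K + 2))"
    by (intro sum_list_mono length_chunk_code_le2 K_pos)
  also have "\<dots> = 2 * log 2 (real l + 1) + 2 * log 2 (real N0 + 1) + 2 * log 2 (real R + 1) +
      2 * log 2 (real mode + 1) + 2 * log 2 (real lam + 1) + 2 * log 2 (real L + 1) +
      2 * log 2 (real BS + 1) + 7 * (real K + 2)"
    by (simp add: params_def)
  also have "\<dots> \<le> (2 * real K + 4 * (Lg + 4) / real K) + 2 * real r + 4 * real r + 2 + (2 * real r + 2) +
      (2 * real K + 4 * (2 * Lg + 2 * g + real K + 17) / real K) + 4 * real r + 7 * (real K + 2)"
  proof (intro add_mono)
    have "4 * (real l + 1) / real K \<le> 4 * (Lg + 4) / real K"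
      using l K1 by (intro divide_right_mono mult_left_mono) (auto simp: Lg_def)
    then show "2 * log 2 (real l + 1) \<le> 2 * real K + 4 * (Lg + 4) / real K"
      using scaled[of l] by linarith
    have "4 * (real L + 1) / real K \<le> 4 * (2 * Lg + 2 * g + real K + 17) / real K"
      using L K1 by (intro divide_right_mono mult_left_mono) (auto simp: Lg_def g_def)
    then show "2 * log 2 (real L + 1) \<le> 2 * real K + 4 * (2 * Lg + 2 * g + real K + 17) / real K"
      using scaled[of L] by linarith
    show "2 * log 2 (real N0 + 1) \<le> 2 * real r" using small_log[of N0] N0 by simp
    have RR: "real R \<le> 2 * real r" using N0 by simp
    then show "2 * log 2 (real R + 1) \<le> 4 * real r" using small_log[of R] by linarith
    have "real BS \<le> real R" using BS_le by linarith
    then show "2 * log 2 (real BS + 1) \<le> 4 * real r" using small_log[of BS] RR by linarith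
    have "real mode \<le> 1" using mode by simp
    then show "2 * log 2 (real mode + 1) \<le> 2" using small_log[of mode] by linarith
    show "2 * log 2 (real lam + 1) \<le> 2 * real r + 2" using small_log[of lam] lam logr(1) by linarith
  qed auto
  also have "\<dots> = 12 * Lg / real K + 8 * g / real K + (16 + 68) / real K + 11 * real K + 12 * real r + 22"
    using K1 by (simp add: field_simps)
  also have "\<dots> \<le> (12 * (2 * a + g) / real K + 12 * real r) + 84 + 11 * real K + 12 * real r + 22"
  proof -
    have "12 * Lg / real K + 8 * g / real K = (12 * a + 8 * g) / real K + 12 * log 2 (real r) / real K"
      by (simp add: logr(2) add_divide_distrib distrib_left)
    also have "\<dots> \<le> 12 * (2 * a + g) / real K + 12 * real r / 1"
      using a0 g0 logr(1) K1 rn by (intro add_mono divide_right_mono frac_le) auto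
    finally have "12 * Lg / real K + 8 * g / real K \<le> 12 * (2 * a + g) / real K + 12 * real r" by simp
    moreover have "(16 + 68) / real K \<le> 84" using K1 by (simp add: field_simps)
    ultimately show ?thesis by linarith
  qed
  also have "\<dots> \<le> (12 / real K) * (real r * (2 * a + g)) + (11 * real K + 130) * real r"
  proof -
    have "1 * (2 * a + g) \<le> real r * (2 * a + g)" using rn a0 g0 by (intro mult_right_mono) auto
    then have "12 * (2 * a + g) / real K \<le> (12 / real K) * (real r * (2 * a + g))"
      using K1 by (simp add: divide_right_mono)
    moreover have "(11 * real K + 106) * 1 \<le> (11 * real K + 106) * real r"
      using rn by (intro mult_left_mono) auto
    ultimately show ?thesis by (simp add: algebra_simps)
  qed
  finally show ?thesis .
qed

lemma block_heads_length_le: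
  assumes L: "real L \<le> 2 * log 2 (real n) + 2 * log 2 (real \<sigma>) + real K + 16"
    and N0: "N0 \<le> r" and BS_eq: "BS = R \<or> BS = K * B" and B: "B > 0" and \<sigma>: "\<sigma> \<ge> 1"
  defines "g \<equiv> log 2 (real \<sigma>)"
  shows "real (blocks * (3 * L)) \<le> 12 * real r * (log 2 (real n) / real B) + (12 / real K) * (real r * g) +
    (6 * real K + 96) * real r"
proof -
  define Lg where "Lg = log 2 (real n)"
  have rn: "real r \<ge> 1" "real n \<ge> 1" using r_pos n_pos by auto
  have K1: "real K \<ge> 1" "real B \<ge> 1" using K_pos B by auto
  have nn: "Lg \<ge> 0" "g \<ge> 0" using rn \<sigma> by (auto simp: Lg_def g_def)
  show ?thesis
  proof (cases "BS = R")
    case True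
    have "blocks = (R - 1) div BS" by (rule blocks_def)
    then have "blocks = 0" using True R by simp
    moreover have "0 \<le> 12 * real r * (Lg / real B) + (12 / real K) * (real r * g) + (6 * real K + 96) * real r"
      using rn K1 nn by simp
    ultimately show ?thesis by (simp add: Lg_def)
  next
    case False
    then have BS: "BS = K * B" using BS_eq by simp
    have "blocks * BS \<le> R - 1" by (simp add: blocks_def)
    then have "real (blocks * BS) \<le> real (2 * r)" using N0 by (intro of_nat_mono) linarith
    then have "real blocks * (real K * real B) \<le> 2 * real r" by (simp add: BS)
    then have b: "real blocks \<le> 2 * real r / (real K * real B)" using K1 by (simp add: field_simps)
    have "real (blocks * (3 * L)) = real blocks * (3 * real L)" by simp
    also have "\<dots> \<le> (2 * real r / (real K * real B)) * (6 * Lg + 6 * g + 3 * real K + 48)"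
      using b L K1 rn by (intro mult_mono) (auto simp: Lg_def g_def)
    also have "\<dots> = 12 * real r * Lg / (real K * real B) + 12 * real r * g / (real K * real B) +
        (6 * real K + 96) * real r / (real K * real B)"
      by (simp add: add_divide_distrib algebra_simps)
    also have "\<dots> \<le> 12 * real r * Lg / (1 * real B) + 12 * real r * g / (real K * 1) + (6 * real K + 96) * real r / (1 * 1)"
      using K1 nn rn by (intro add_mono divide_left_mono mult_mono) auto
    finally show ?thesis by (simp add: Lg_def)
  qed
qed

lemma csa_bits_length_le:
  assumes N: "N \<le> 6 * n" and l: "real l \<le> log 2 (real n) + 3" and lam: "real lam \<le> log 2 (real r) + 1"
    and L: "real L \<le> 2 * log 2 (real n) + 2 * log 2 (real \<sigma>) + real K + 16"
    and N0: "N0 \<le> r" and BS_le: "BS \<le> R" and BS_eq: "BS = R \<or> BS = K * B" and B: "B > 0"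
    and mode: "mode \<le> 1" and \<sigma>: "\<sigma> \<ge> 1"
  shows "real (length csa_bits) \<le>
    real r * ((2 * log 2 (real n / real r) + log 2 (real \<sigma>)) * (1 + 26 / real K) +
       12 * (log 2 (real n) / real B) + (21 * real K + 312)) + real N0 * (2 * log 2 (real n))"
proof -
  define a g Lg where "a = log 2 (real n / real r)" and "g = log 2 (real \<sigma>)" and "Lg = log 2 (real n)"
  have rn: "real r \<ge> 1" "real n > 0" "real r \<le> real n" using r_pos n_pos r_le_n by auto
  have K1: "real K \<ge> 1" using K_pos by simp
  have a0: "a \<ge> 0" using rn by (simp add: a_def)
  have g0: "g \<ge> 0" using \<sigma> by (simp add: g_def)
  have logr: "log 2 (real r) = Lg - a" using rn by (simp add: Lg_def a_def log_divide)
  define X where "X = real r * (2 * a + g)"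
  have h: "real (length header) \<le> (12 / real K) * X + (11 * real K + 130) * real r"
    using header_length_le[OF l lam L N0 BS_le mode \<sigma>] by (simp add: X_def a_def g_def)
  have b: "real (blocks * (3 * L)) \<le> 12 * real r * (Lg / real B) + (12 / real K) * (real r * g) + (6 * real K + 96) * real r"
    using block_heads_length_le[OF L N0 BS_eq B \<sigma>] by (simp add: Lg_def g_def)
  have s: "real (so R) \<le> real N0 * a + (1 + 2 / real K) * X + (82 + 4 * real K) * real r"
    using stream_length_le[OF N N0 \<sigma>] by (simp add: X_def a_def g_def)
  have "real (N0 * (lam + l)) \<le> real N0 * ((Lg - a + 1) + (Lg + 3))"
    using l lam logr by (simp only: of_nat_mult of_nat_add, intro mult_left_mono) (auto simp: Lg_def)
  also have "\<dots> = real N0 * (2 * Lg) - real N0 * a + 4 * real N0" by (simp add: algebra_simps)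
  also have "\<dots> \<le> real N0 * (2 * Lg) - real N0 * a + 4 * real r" using N0 by simp
  finally have p: "real (N0 * (lam + l)) \<le> real N0 * (2 * Lg) - real N0 * a + 4 * real r" .
  have gX: "(12 / real K) * (real r * g) \<le> (12 / real K) * X"
    using rn a0 g0 K1 unfolding X_def by (intro mult_left_mono) auto
  have "real (length csa_bits) = real (length header) + real (N0 * (lam + l)) + real (blocks * (3 * L)) + real (so R)"
    by (simp only: length_csa_bits of_nat_add)
  also have "\<dots> \<le> ((12 / real K) * X + (11 * real K + 130) * real r) + (real N0 * (2 * Lg) - real N0 * a + 4 * real r) +
     (12 * real r * (Lg / real B) + (12 / real K) * X + (6 * real K + 96) * real r) +
     (real N0 * a + (1 + 2 / real K) * X + (82 + 4 * real K) * real r)"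
    using h b s p gX by linarith
  also have "\<dots> = X * (1 + 26 / real K) + 12 * real r * (Lg / real B) + (21 * real K + 312) * real r + real N0 * (2 * Lg)"
    using K1 by (simp add: field_simps)
  also have "\<dots> = real r * ((2 * a + g) * (1 + 26 / real K) + 12 * (Lg / real B) + (21 * real K + 312)) + real N0 * (2 * Lg)"
    by (simp add: X_def algebra_simps add_divide_distrib)
  finally show ?thesis by (simp add: a_def g_def Lg_def)
qed

lemma stream_length_nat:
  assumes "\<sigma> + 1 \<le> 2 ^ ls" "N0 \<le> r" "n < N"
  shows "so R < 2 ^ (2 * l + ls + K + 5)"
proof -
  define e where "e = l + ls"
  have "(\<sigma> + 1) * N \<le> 2 ^ ls * 2 ^ l" using assms(1) N_eq by (intro mult_mono) auto
  moreover have "(2::nat) ^ (e + 1) = 2 * (2 ^ ls * 2 ^ l)" "0 < (2::nat) ^ ls * 2 ^ l"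
    by (simp_all add: e_def power_add)
  ultimately have VR: "ve R < 2 ^ (e + 1)" using ve_R by linarith
  have len: "length (rec_code j) \<le> 2 * (2 * (e + 1) + K + 2)" if "j < R" for j
  proof -
    have "ve (Suc j) < 2 ^ (e + 1)" using VR ve_mono[of "Suc j" R] that by simp
    then have "sval j - ve j < 2 ^ (e + 1)" "slen j < 2 ^ (e + 1)" using ve_Suc[of j] by auto
    from this[THEN length_chunk_code_nat[OF K_pos]] show ?thesis by (simp add: rec_code_def)
  qed
  have "so R \<le> (\<Sum>j<R. 2 * (2 * (e + 1) + K + 2))" unfolding so_def by (intro sum_mono len) simp
  also have "\<dots> = R * (2 * (2 * (e + 1) + K + 2))" by simp
  finally have s: "so R \<le> R * (2 * (2 * (e + 1) + K + 2))" .
  have "R < 2 ^ (l + 1)" using assms(2,3) r_le_n N_eq by simp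
  moreover have "2 * (2 * (e + 1) + K + 2) \<le> 2 ^ (e + K + 4)"
  proof -
    define X where "X = (2::nat) ^ (e + K)"
    have "e + K < X" unfolding X_def by (rule less_exp)
    then have "2 * (2 * (e + 1) + K + 2) \<le> 16 * X" by simp
    also have "16 * X = 2 ^ (e + K + 4)" by (simp add: X_def power_add)
    finally show ?thesis .
  qed
  ultimately have "R * (2 * (2 * (e + 1) + K + 2)) < 2 ^ (l + 1) * 2 ^ (e + K + 4)"
    by (intro mult_less_le_imp_less) auto
  also have "\<dots> = 2 ^ (l + 1 + (e + K + 4))" by (rule power_add[symmetric])
  also have "l + 1 + (e + K + 4) = 2 * l + ls + K + 5" by (simp add: e_def)
  finally show ?thesis using s by linarith
qed

end

section \<open>Choice of samples and parameters\<close>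

context indexed_text
begin

lemma card_sampled:
  "card {i \<in> {1..n}. (n - SA T i) mod (s + 1) = 0} = (n + s) div (s + 1)"
proof -
  define A where "A = {i \<in> {1..n}. (n - SA T i) mod (s + 1) = 0}"
  define Q where "Q = {q \<in> {1..n}. (n - q) mod (s + 1) = 0}"
  define m where "m = (n + s) div (s + 1)"
  have "SA T ` A = Q"
  proof (intro equalityI subsetI)
    fix q assume "q \<in> SA T ` A"
    then obtain i where "i \<in> A" "q = SA T i" by blast
    then show "q \<in> Q" using SA_in[of i] by (simp add: A_def Q_def)
  next
    fix q assume q: "q \<in> Q"
    then have "SA_inv T q \<in> A" using SA_inv_in[of q] SA_SA_inv[of q] by (simp add: A_def Q_def)
    moreover have "q = SA T (SA_inv T q)" using q SA_SA_inv[of q] by (simp add: Q_def)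
    ultimately show "q \<in> SA T ` A" by blast
  qed
  moreover have "inj_on (SA T) A"
    by (rule inj_on_subset[OF bij_betw_imp_inj_on[OF SA_bij]]) (unfold A_def, blast)
  ultimately have cA: "card A = card Q" by (metis card_image)
  have km: "k < m \<longleftrightarrow> k * (s + 1) < n" for k
  proof -
    have "k < m \<longleftrightarrow> Suc k \<le> (n + s) div (s + 1)" by (auto simp: m_def)
    also have "\<dots> \<longleftrightarrow> Suc k * (s + 1) \<le> n + s" by (rule less_eq_div_iff_mult_less_eq) simp
    also have "\<dots> \<longleftrightarrow> k * (s + 1) < n" by auto
    finally show ?thesis .
  qed
  have "bij_betw (\<lambda>k. n - k * (s + 1)) {..<m} Q"
  proof (rule bij_betw_imageI)
    show "inj_on (\<lambda>k. n - k * (s + 1)) {..<m}"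
    proof (rule inj_onI)
      fix j k assume a: "j \<in> {..<m}" "k \<in> {..<m}" "n - j * (s + 1) = n - k * (s + 1)"
      then have "j * (s + 1) = k * (s + 1)" using km[of j] km[of k] by auto
      then show "j = k" by (metis Suc_eq_plus1 Suc_mult_cancel1 mult.commute)
    qed
    show "(\<lambda>k. n - k * (s + 1)) ` {..<m} = Q"
    proof (intro equalityI subsetI)
      fix q assume "q \<in> (\<lambda>k. n - k * (s + 1)) ` {..<m}"
      then obtain k where k: "k * (s + 1) < n" "q = n - k * (s + 1)" using km by auto
      then have "n - q = k * (s + 1)" by simp
      then have "(n - q) mod (s + 1) = 0" by (metis mod_mult_self2_is_0)
      then show "q \<in> Q" using k by (simp add: Q_def)
    next
      fix q assume q: "q \<in> Q"
      define k where "k = (n - q) div (s + 1)"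
      have q': "1 \<le> q" "q \<le> n" "(n - q) mod (s + 1) = 0" using q by (auto simp only: Q_def mem_Collect_eq atLeastAtMost_iff)
      then have k: "n - q = k * (s + 1)" using div_mult_mod_eq[of "n - q" "s + 1"] unfolding k_def by linarith
      then have "k * (s + 1) < n" using q'(1,2) by linarith
      then have "k < m" using km by blast
      moreover have "q = n - k * (s + 1)" using q'(2) k by linarith
      ultimately show "q \<in> (\<lambda>k. n - k * (s + 1)) ` {..<m}" by blast
    qed
  qed
  then have "card Q = m" using bij_betw_same_card by fastforce
  then show ?thesis using cA by (simp add: A_def m_def)
qed

lemma card_ends: "card ends = card starts"
proof -
  have e: "ends = insert n ((\<lambda>a. a - 1) ` (starts - {1}))"
  proof (intro equalityI subsetI)
    fix x assume x: "x \<in> ends"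
    show "x \<in> insert n ((\<lambda>a. a - 1) ` (starts - {1}))"
    proof (cases "x = n")
      case False
      then have "x + 1 \<in> starts - {1}" "x = (x + 1) - 1" using x by (auto simp: ends_def)
      then show ?thesis by blast
    qed simp
  next
    fix x assume "x \<in> insert n ((\<lambda>a. a - 1) ` (starts - {1}))"
    then show "x \<in> ends" using starts_sub n_pos by (fastforce simp: ends_def)
  qed
  have "n \<notin> (\<lambda>a. a - 1) ` (starts - {1})"
  proof
    assume "n \<in> (\<lambda>a. a - 1) ` (starts - {1})"
    then obtain a where a: "a \<in> starts" "n = a - 1" by blast
    then have "a \<in> {1..n}" using starts_sub by blast
    then have "1 \<le> a" "a \<le> n" by simp_all
    then show False using a(2) by linarith
  qed
  moreover have "inj_on (\<lambda>a. a - 1) (starts - {1})"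
  proof (rule inj_onI)
    fix a b assume "a \<in> starts - {1}" "b \<in> starts - {1}" "a - 1 = b - 1"
    moreover from this have "a \<ge> 1" "b \<ge> 1" using starts_sub by auto
    ultimately show "a = b" by linarith
  qed
  ultimately have "card ends = Suc (card (starts - {1}))"
    unfolding e using finite_starts by (simp add: card_image)
  then show ?thesis using card_Suc_Diff1[OF finite_starts one_in_starts] by simp
qed

end

lemma power_two_bracket:
  fixes x :: nat
  assumes "x \<ge> 1"
  obtains l where "x \<le> 2 ^ l" "2 ^ l < 2 * x"
proof -
  define l where "l = (LEAST l. x \<le> 2 ^ l)"
  have "x \<le> 2 ^ x" using less_exp[of x] by simp
  then have 1: "x \<le> 2 ^ l" unfolding l_def by (rule LeastI)
  have "2 ^ l < 2 * x"
  proof (cases l)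
    case 0 then show ?thesis using assms by simp
  next
    case (Suc k)
    then have "\<not> x \<le> 2 ^ k" using not_less_Least[of k "\<lambda>l. x \<le> 2 ^ l"] by (simp add: l_def)
    then show ?thesis by (simp add: Suc)
  qed
  with 1 show thesis using that by blast
qed

lemma bracket_log:
  fixes x l c :: nat
  assumes "2 ^ l \<le> 2 ^ c * x" "x \<ge> 1"
  shows "real l \<le> log 2 (real x) + real c"
proof -
  have "real (2 ^ l) \<le> real (2 ^ c * x)" using assms(1) by (simp only: of_nat_le_iff)
  then have "2 powr real l \<le> 2 ^ c * real x" by (simp add: powr_realpow)
  then have "real l \<le> log 2 (2 ^ c * real x)" using assms(2) by (subst le_log_iff) auto
  also have "\<dots> = log 2 (real x) + real c" using assms(2) by (simp add: log_mult log_nat_power)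
  finally show ?thesis .
qed

lemma samples_exist:
  assumes "indexed_text \<sigma> T n N" "K > 0" "s \<ge> 1"
  defines "r \<equiv> card (Psi_runs T)"
  obtains xs mode arr perm where
    "sampled_text \<sigma> T n N xs K" "length xs = min r ((n + s) div (s + 1))" "mode \<le> (1::nat)"
    "length arr = length xs" "\<And>a. a \<in> set arr \<Longrightarrow> a < N"
    "length perm = length xs" "\<And>p. p \<in> set perm \<Longrightarrow> p < length xs"
    "mode \<noteq> 0 \<Longrightarrow> set xs = {i \<in> {1..n}. (n - SA T i) mod (s + 1) = 0} \<and>
      (\<forall>k<length xs. arr ! (perm ! k) = SA T (xs ! k))"
    "mode = 0 \<Longrightarrow> set xs = SA T ` indexed_text.ends T n N \<and> length xs = sampled_text.r T n N \<and>
      (\<forall>j<sampled_text.r T n N. arr ! j = SA T (sampled_text.st T n N j)) \<and>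
      (\<forall>k<length xs. \<forall>e\<in>indexed_text.ends T n N. e < n \<longrightarrow> xs ! k = SA T e \<longrightarrow>
         arr ! (perm ! k) = SA T (e + 1))"
proof -
  interpret indexed_text \<sigma> T n N by fact
  have r: "r = card starts" by (simp add: r_def card_Psi_runs)
  show thesis
  proof (cases "(n + s) div (s + 1) < r")
    case True
    define A where "A = {i \<in> {1..n}. (n - SA T i) mod (s + 1) = 0}"
    define xs where "xs = sorted_list_of_set A"
    have fin: "finite A" by (simp add: A_def)
    have xs: "set xs = A" "sorted_wrt (<) xs" "length xs = (n + s) div (s + 1)"
      using fin card_sampled[of s] by (simp_all add: xs_def A_def strict_sorted_list_of_set)
    have sub: "set xs \<subseteq> {1..n}" using xs(1) by (auto simp: A_def)
    show thesis
    proof (rule that[of xs 1 "map (SA T) xs" "[0..<length xs]"])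
      show "sampled_text \<sigma> T n N xs K" by unfold_locales (use xs sub assms in auto)
      show "length xs = min r ((n + s) div (s + 1))" using True xs(3) by simp
      fix a assume "a \<in> set (map (SA T) xs)"
      then obtain i where "i \<in> {1..n}" "a = SA T i" using sub by auto
      then show "a < N" using SA_in[of i] N by auto
    qed (use xs in \<open>auto simp: A_def\<close>)
  next
    case False
    define sl where "sl = sorted_list_of_set starts"
    define xs where "xs = sorted_list_of_set (SA T ` ends)"
    have ends_sub: "ends \<subseteq> {1..n}" by (auto simp: ends_def)
    then have fin: "finite ends" using finite_subset by blast
    have inj: "inj_on (SA T) ends" using SA_bij ends_sub by (meson bij_betw_def inj_on_subset)
    have xs: "set xs = SA T ` ends" "sorted_wrt (<) xs" "length xs = r"
      using fin card_ends by (simp_all add: xs_def strict_sorted_list_of_set card_image[OF inj] r)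
    have sub: "set xs \<subseteq> {1..n}" using xs(1) ends_sub SA_in by auto
    have st: "sampled_text \<sigma> T n N xs K" by unfold_locales (use xs sub assms in auto)
    then interpret sampled_text \<sigma> T n N xs K .
    have rr: "sampled_text.r T n N = r" by (simp add: sampled_text.r_def[OF st] r)
    define pm where "pm k = (if \<exists>j<r. st j = SA_inv T (xs ! k) + 1
       then (SOME j. j < r \<and> st j = SA_inv T (xs ! k) + 1) else 0)" for k
    have rpos: "r > 0" using r_pos rr by simp
    have pm: "pm k < r" for k
      using someI_ex[of "\<lambda>j. j < r \<and> st j = SA_inv T (xs ! k) + 1"] rpos by (auto simp: pm_def)
    have pm_st: "st (pm k) = e + 1" if "k < r" "e \<in> ends" "e < n" "xs ! k = SA T e" for k e
    proof -
      have "e + 1 \<in> starts" using that by (auto simp: ends_def)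
      then have "\<exists>j<r. st j = e + 1" using starts_st rr by metis
      moreover have "SA_inv T (xs ! k) = e" using that SA_inv_SA[of e] ends_sub by auto
      ultimately show ?thesis
        using someI_ex[of "\<lambda>j. j < r \<and> st j = SA_inv T (xs ! k) + 1"] by (auto simp: pm_def)
    qed
    show thesis
    proof (rule that[of xs 0 "map (\<lambda>j. SA T (st j)) [0..<r]" "map pm [0..<r]"])
      show "sampled_text \<sigma> T n N xs K" by fact
      show "length xs = min r ((n + s) div (s + 1))" using False xs(3) by simp
      show "length (map (\<lambda>j. SA T (st j)) [0..<r]) = length xs" "length (map pm [0..<r]) = length xs"
        using xs(3) by auto
      show "a < N" if a: "a \<in> set (map (\<lambda>j. SA T (st j)) [0..<r])" for a
      proof -
        obtain j where "j < r" "a = SA T (st j)" using a by auto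
        then show ?thesis using SA_in[OF st_range[of j]] N rr by auto
      qed
      show "p < length xs" if "p \<in> set (map pm [0..<r])" for p using that pm xs(3) by auto
      show "set xs = SA T ` ends \<and> length xs = sampled_text.r T n N \<and>
        (\<forall>j<sampled_text.r T n N. map (\<lambda>j. SA T (st j)) [0..<r] ! j = SA T (st j)) \<and>
        (\<forall>k<length xs. \<forall>e\<in>ends. e < n \<longrightarrow> xs ! k = SA T e \<longrightarrow>
           map (\<lambda>j. SA T (st j)) [0..<r] ! (map pm [0..<r] ! k) = SA T (e + 1))"
        using xs rr pm pm_st by auto
    qed auto
  qed
qed

lemma le_two_powr: "x \<le> 2 powr (x::real)" if "x \<ge> 0"
proof -
  define m where "m = nat \<lfloor>x\<rfloor>"
  have m: "real m \<le> x" "x < real m + 1" using that by (auto simp: m_def)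
  have "Suc m \<le> 2 ^ m" by (rule Suc_leI[OF less_exp])
  then have "real m + 1 \<le> 2 ^ m" by (metis of_nat_Suc of_nat_le_iff of_nat_numeral of_nat_power add.commute)
  also have "(2::real) ^ m = 2 powr real m" by (simp add: powr_realpow)
  also have "\<dots> \<le> 2 powr x" using m by simp
  finally show ?thesis using m by simp
qed

lemma search_time_le:
  fixes K B BS k m occ s :: nat and lr Ln :: real
  assumes K: "K > 0" and B: "B > 0" and BS: "BS \<le> K * B" and k: "real k \<le> lr + 1" and lr: "lr \<ge> 0"
    and m: "m \<ge> 1" and s: "s \<ge> 1" and Ln: "Ln \<ge> 0"
  defines "Q \<equiv> 30 + (k + 1) * 92 + BS * (2 * K + 57)" and "CQ \<equiv> 306 + real K * (2 * real K + 57)"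
  shows "real (7 * K + 200 + (m + 1) * 6 + m * (2 * Q + 63) + occ * ((s + 1) * (2 * Q + 13) + 53)) \<le>
    (7 * real K + 354 + 6 * CQ) * (real m * (lr + real B) + real occ * (real s * (lr + real B) + Ln))"
proof -
  define Z where "Z = lr + real B"
  have B1: "real B \<ge> 1" "real K \<ge> 1" "real m \<ge> 1" "real s \<ge> 1" using B K m s by auto
  have Z: "Z \<ge> 1" "lr \<le> Z" "real B \<le> Z" using B1 lr by (auto simp: Z_def)
  have CQ0: "CQ \<ge> 0" by (simp add: CQ_def)
  have "real BS \<le> real K * real B" using BS by (metis of_nat_le_iff of_nat_mult)
  then have "real BS * (2 * real K + 57) \<le> (real K * Z) * (2 * real K + 57)"
    using Z B1 by (intro mult_right_mono) (auto intro: order_trans mult_left_mono)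
  moreover have "(real k + 1) * 92 \<le> (Z + 2) * 92" using k Z by simp
  moreover have "real Q = 30 + (real k + 1) * 92 + real BS * (2 * real K + 57)" by (simp add: Q_def)
  ultimately have "real Q \<le> 30 + (Z + 2) * 92 + (real K * Z) * (2 * real K + 57)" by linarith
  also have "\<dots> \<le> CQ * Z" using Z by (simp add: CQ_def algebra_simps)
  finally have Q: "real Q \<le> CQ * Z" .
  have mZ: "1 \<le> real m * Z" "real m \<le> real m * Z"
    using B1 Z mult_mono[of 1 "real m" 1 Z] mult_left_mono[of 1 Z "real m"] by auto
  have sZ: "1 \<le> real s * Z" "real s + 1 \<le> 2 * real s" using B1 Z mult_mono[of 1 "real s" 1 Z] by auto
  have "(7 * real K + 200) * 1 \<le> (7 * real K + 200) * (real m * Z)"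
    using mZ by (intro mult_left_mono) auto
  then have p1: "7 * real K + 200 \<le> (7 * real K + 200) * (real m * Z)" by simp
  have p0: "(real m + 1) * 6 \<le> 12 * (real m * Z)" using mZ by simp
  have p2: "real m * (2 * real Q + 63) \<le> real m * ((2 * CQ + 63) * Z)"
    using Q Z B1 by (intro mult_left_mono) (auto simp: algebra_simps)
  have "(real s + 1) * (2 * real Q + 13) \<le> (2 * real s) * ((2 * CQ + 13) * Z)"
    using Q Z sZ B1 by (intro mult_mono) (auto simp: algebra_simps)
  then have p3: "real occ * ((real s + 1) * (2 * real Q + 13) + 53) \<le>
      real occ * ((2 * real s) * ((2 * CQ + 13) * Z) + 53 * (real s * Z))"
    using sZ by (intro mult_left_mono add_mono) auto
  have "real (7 * K + 200 + (m + 1) * 6 + m * (2 * Q + 63) + occ * ((s + 1) * (2 * Q + 13) + 53)) =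
      (7 * real K + 200) + (real m + 1) * 6 + real m * (2 * real Q + 63) +
      real occ * ((real s + 1) * (2 * real Q + 13) + 53)"
    by (simp only: of_nat_add of_nat_mult of_nat_numeral of_nat_1)
  also have "\<dots> \<le> (7 * real K + 200) * (real m * Z) + 12 * (real m * Z) + real m * ((2 * CQ + 63) * Z) +
      real occ * ((2 * real s) * ((2 * CQ + 13) * Z) + 53 * (real s * Z))"
    by (rule add_mono[OF add_mono[OF add_mono[OF p1 p0] p2] p3])
  also have "\<dots> = (7 * real K + 275 + 2 * CQ) * (real m * Z) + (4 * CQ + 79) * (real occ * (real s * Z))"
    by (simp add: algebra_simps)
  also have "\<dots> \<le> (7 * real K + 354 + 6 * CQ) * (real m * Z) + (7 * real K + 354 + 6 * CQ) * (real occ * (real s * Z + Ln))"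
  proof (rule add_mono)
    show "(7 * real K + 275 + 2 * CQ) * (real m * Z) \<le> (7 * real K + 354 + 6 * CQ) * (real m * Z)"
      by (rule mult_right_mono) (use CQ0 Z in auto)
    show "(4 * CQ + 79) * (real occ * (real s * Z)) \<le> (7 * real K + 354 + 6 * CQ) * (real occ * (real s * Z + Ln))"
    proof (rule mult_mono)
      show "real occ * (real s * Z) \<le> real occ * (real s * Z + Ln)" using Ln by (intro mult_left_mono) auto
    qed (use CQ0 Z in auto)
  qed
  finally show ?thesis by (simp add: Z_def distrib_left)
qed

lemma csa_exists:
  fixes K B \<sigma> n r s w :: nat and T :: "nat list" and \<epsilon> :: real
  assumes K: "K > 0" and B: "B > 0" and T: "terminated_text \<sigma> T" and n: "n = length T"
    and r: "r = card (Psi_runs T)" and s: "s \<ge> 1" and \<epsilon>: "26 / real K \<le> \<epsilon>"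
    and w: "real w \<ge> (24 * real K + 3 * \<epsilon> + 376) * log 2 (real n + real \<sigma>)"
  defines "CQ \<equiv> 306 + real K * (2 * real K + 57)"
  shows "\<exists>D. real (length D) \<le>
      real r * ((2 * log 2 (real n / real r) + log 2 (real \<sigma>)) * (1 + \<epsilon>) + 12 * (log 2 (real n) / real B) +
        (21 * real K + 312)) + min (real r) (2 * real_of_int \<lceil>real n / (real s + 1)\<rceil>) * (2 * log 2 (real n)) \<and>
      (\<forall>P. P \<noteq> [] \<and> set P \<subseteq> {1..\<sigma>} \<longrightarrow> finds_occurrences (compile 0 (csa_program K)) w D T P
        ((7 * real K + 354 + 6 * CQ) * (real (length P) * (log 2 (real r) + real B) +
           real (card (occurrences T P)) * (real s * (log 2 (real r) + real B) + log 2 (real n)))))"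
proof -
  have n1: "n \<ge> 1" using T n by (cases T) (auto simp: terminated_text_def)
  have "T ! 0 \<in> {1..\<sigma>}" using T n1 n unfolding terminated_text_def by (metis One_nat_def Suc_le_lessD nth_mem subsetD)
  then have \<sigma>1: "\<sigma> \<ge> 1" by simp
  obtain l where l: "n + 2 \<le> 2 ^ l" "2 ^ l < 2 * (n + 2)" using power_two_bracket[of "n + 2"] by auto
  obtain ls where ls: "\<sigma> + 1 \<le> 2 ^ ls" "2 ^ ls < 2 * (\<sigma> + 1)" using power_two_bracket[of "\<sigma> + 1"] by auto
  define N where "N = (2::nat) ^ l"
  have it: "indexed_text \<sigma> T n N" by unfold_locales (use T n l in \<open>auto simp: N_def\<close>)
  then interpret indexed_text \<sigma> T n N .
  show ?thesis
  proof (rule samples_exist[OF it K s, folded r])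
  fix xs perm arr :: "nat list" and mode :: nat
  assume samples:
    "sampled_text \<sigma> T n N xs K" "length xs = min r ((n + s) div (s + 1))" "mode \<le> 1"
    "length arr = length xs" "\<And>a. a \<in> set arr \<Longrightarrow> a < N"
    "length perm = length xs" "\<And>p. p \<in> set perm \<Longrightarrow> p < length xs"
    "mode \<noteq> 0 \<Longrightarrow> set xs = {i \<in> {1..n}. (n - SA T i) mod (s + 1) = 0} \<and>
      (\<forall>k<length xs. arr ! (perm ! k) = SA T (xs ! k))"
    "mode = 0 \<Longrightarrow> set xs = SA T ` ends \<and> length xs = sampled_text.r T n N \<and>
      (\<forall>j<sampled_text.r T n N. arr ! j = SA T (sampled_text.st T n N j)) \<and>
      (\<forall>k<length xs. \<forall>e\<in>ends. e < n \<longrightarrow> xs ! k = SA T e \<longrightarrow> arr ! (perm ! k) = SA T (e + 1))"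
  interpret sampled_text \<sigma> T n N xs K by (rule samples(1))
  have rr: "sampled_text.r T n N = r" using r by (simp add: sampled_text.r_def[OF samples(1)] card_Psi_runs)
  have r1: "r \<ge> 1" "r \<le> n" using r_pos r_le_n rr by auto
  obtain lam where lam: "r \<le> 2 ^ lam" "2 ^ lam < 2 * r" using power_two_bracket[OF r1(1)] by auto
  define L where "L = 2 * l + 2 * ls + K + 6"
  define BS where "BS = min (N0 + r) (K * B)"
  have N0r: "N0 \<le> r" using samples(2) by simp
  have BSp: "0 < BS" using r1 K B by (simp add: BS_def)
  have lay: "layout \<sigma> T n N xs K l lam L BS arr perm"
  proof unfold_locales
    show "p < N0 \<and> p < 2 ^ lam" if "p \<in> set perm" for p
      using samples(7)[OF that] N0r lam(1) by linarith
  qed (use samples(4,6) BSp in \<open>simp_all add: N_def[symmetric] L_def samples(5)\<close>)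
  then interpret layout \<sigma> T n N xs K l lam L BS mode arr perm .
  define Lg g \<mu> where "Lg = log 2 (real n)" and "g = log 2 (real \<sigma>)" and "\<mu> = log 2 (real n + real \<sigma>)"
  have lr: "real l \<le> log 2 (real n) + 3" using bracket_log[of l 3 n] l n1 by simp
  have lsr: "real ls \<le> log 2 (real \<sigma>) + 2" using bracket_log[of ls 2 \<sigma>] ls \<sigma>1 by simp
  have lamr: "real lam \<le> log 2 (real r) + 1" using bracket_log[of lam 1 r] lam r1 by simp
  have Lr: "real L \<le> 2 * log 2 (real n) + 2 * log 2 (real \<sigma>) + real K + 16"
    using lr lsr by (simp add: L_def)
  have N6: "N \<le> 6 * n" using l n1 by (simp add: N_def)
  have pos: "Lg \<ge> 0" "g \<ge> 0" "\<mu> \<ge> 1" "Lg \<le> \<mu>" "g \<le> \<mu>"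
  proof -
    show "Lg \<ge> 0" "g \<ge> 0" "Lg \<le> \<mu>" "g \<le> \<mu>" using n1 \<sigma>1 by (auto simp: Lg_def g_def \<mu>_def)
    show "\<mu> \<ge> 1" using n1 \<sigma>1 by (simp add: \<mu>_def le_log_iff)
  qed
  have \<epsilon>0: "\<epsilon> > 0"
  proof -
    have "26 / real K > 0" using K by simp
    then show ?thesis using \<epsilon> by linarith
  qed
  define a where "a = log 2 (real n / real r)"
  have a: "0 \<le> a" "a \<le> Lg" using r1 n1 by (auto simp: a_def Lg_def log_divide)
  let ?E = "real r * ((2 * a + g) * (1 + \<epsilon>) + 12 * (Lg / real B) + (21 * real K + 312))"
  have len: "real (length csa_bits) \<le> ?E + real N0 * (2 * Lg)"
  proof -
    have "real (length csa_bits) \<le> real r * ((2 * a + g) * (1 + 26 / real K) + 12 * (Lg / real B) + (21 * real K + 312)) +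
        real N0 * (2 * Lg)"
      using csa_bits_length_le[OF N6 lr _ Lr _ _ _ B samples(3) \<sigma>1] lamr N0r rr
      by (auto simp: BS_def a_def g_def Lg_def min_def)
    also have "\<dots> \<le> ?E + real N0 * (2 * Lg)"
      using \<epsilon> a pos r1 by (intro add_mono mult_mono) auto
    finally show ?thesis .
  qed
  have space: "real (length csa_bits) \<le> ?E + min (real r) (2 * real_of_int \<lceil>real n / (real s + 1)\<rceil>) * (2 * Lg)"
  proof -
    have "real ((n + s) div (s + 1)) \<le> real (n + s) / real (s + 1)" by (rule of_nat_div_le_of_nat)
    also have "\<dots> < real n / (real s + 1) + 1" by (simp add: field_simps)
    finally have "real ((n + s) div (s + 1)) < real n / (real s + 1) + 1" .
    then have "real ((n + s) div (s + 1)) < real_of_int \<lceil>real n / (real s + 1)\<rceil> + 1"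
      by (meson add_right_mono le_of_int_ceiling less_le_trans)
    then have c: "real ((n + s) div (s + 1)) \<le> real_of_int \<lceil>real n / (real s + 1)\<rceil>"
      by (metis of_int_less_iff of_int_le_iff of_int_of_nat_eq of_int_1 of_int_add zless_add1_eq le_less)
    have "real N0 \<le> min (real r) (2 * real_of_int \<lceil>real n / (real s + 1)\<rceil>)"
      using c samples(2) by (simp add: min_def)
    then have "real N0 * (2 * Lg) \<le> min (real r) (2 * real_of_int \<lceil>real n / (real s + 1)\<rceil>) * (2 * Lg)"
      using pos by (intro mult_right_mono) auto
    then show ?thesis using len by linarith
  qed
  have wL: "2 * L + K + 3 \<le> w"
  proof -
    have "real (2 * L + K + 3) \<le> 8 * \<mu> + 3 * real K + 35" using Lr pos by (simp add: Lg_def g_def)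
    also have "\<dots> \<le> 8 * \<mu> + (3 * real K + 35) * \<mu>"
      using pos mult_left_mono[of 1 \<mu> "3 * real K + 35"] by simp
    also have "\<dots> \<le> (24 * real K + 3 * \<epsilon> + 376) * \<mu>"
      using pos \<epsilon>0 mult_right_mono[of "3 * real K + 43" "24 * real K + 3 * \<epsilon> + 376" \<mu>] by (simp add: algebra_simps)
    finally show ?thesis using w by (simp add: \<mu>_def)
  qed
  have wD: "length csa_bits < 2 ^ (w - 1)"
  proof -
    define c where "c = 329 + 21 * real K + 3 * \<epsilon>"
    have c0: "c \<ge> 0" using \<epsilon>0 by (simp add: c_def)
    have "Lg / real B \<le> \<mu>"
    proof -
      have "Lg / real B \<le> Lg / 1" using B pos by (intro divide_left_mono) auto
      then show ?thesis using pos by simp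
    qed
    then have "(2 * a + g) * (1 + \<epsilon>) + 12 * (Lg / real B) + (21 * real K + 312) \<le>
       (3 * \<mu>) * (1 + \<epsilon>) + 12 * \<mu> + (21 * real K + 312) * \<mu>"
      using a pos \<epsilon>0 mult_left_mono[of 1 \<mu> "21 * real K + 312"] by (intro add_mono mult_right_mono) auto
    then have "?E \<le> real n * ((3 * \<mu>) * (1 + \<epsilon>) + 12 * \<mu> + (21 * real K + 312) * \<mu>)"
      using r1 pos a \<epsilon>0 by (intro mult_mono) auto
    moreover have "real N0 * (2 * Lg) \<le> real n * (2 * \<mu>)" using N0r r1 pos by (intro mult_mono) auto
    ultimately have "real (length csa_bits) \<le> real n * (c * \<mu>)"
      using len by (simp add: c_def algebra_simps)
    also have "\<dots> \<le> 2 powr \<mu> * (2 powr c * 2 powr \<mu>)"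
    proof (intro mult_mono)
      show "real n \<le> 2 powr \<mu>" using n1 by (simp add: \<mu>_def)
      show "c \<le> 2 powr c" "\<mu> \<le> 2 powr \<mu>" using c0 pos le_two_powr by auto
    qed (use c0 pos in auto)
    also have "\<dots> = 2 powr (2 * \<mu> + c)" by (simp flip: powr_add)
    also have "\<dots> < 2 powr (real w - 1)"
    proof -
      have "c \<le> c * \<mu>" using c0 pos mult_left_mono[of 1 \<mu> c] by simp
      moreover have "(c + 4) * \<mu> \<le> (24 * real K + 3 * \<epsilon> + 376) * \<mu>"
        using pos by (intro mult_right_mono) (auto simp: c_def)
      ultimately have "2 * \<mu> + c < real w - 1" using w pos by (simp add: \<mu>_def algebra_simps)
      then show ?thesis by simp
    qed
    also have "real w - 1 = real (w - 1)" using wL by simp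
    also have "2 powr real (w - 1) = real (2 ^ (w - 1))" by (simp add: powr_realpow)
    finally show ?thesis by (simp only: of_nat_less_iff)
  qed
  have pw: "(2::nat) ^ i \<le> 2 ^ L" if "i \<le> L" for i using that by (intro power_increasing) auto
  have nN: "n < 2 ^ l" using l by simp
  have small: "(\<sigma> + 1) * N < 2 ^ L" "N0 + n < 2 ^ L" "so R < 2 ^ L"
  proof -
    have ls1: "ls \<ge> 1" using ls(1) \<sigma>1 by (cases ls) auto
    have "(\<sigma> + 1) * N \<le> 2 ^ ls * 2 ^ l" using ls(1) by (intro mult_mono) (auto simp: N_def)
    also have "\<dots> = 2 ^ (ls + l)" by (simp add: power_add)
    also have "\<dots> < (2::nat) ^ L" by (intro power_strict_increasing) (auto simp: L_def)
    finally show "(\<sigma> + 1) * N < 2 ^ L" .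
    have "N0 + n < 2 ^ (l + 1)" using nN N0r r1 by simp
    also have "\<dots> \<le> (2::nat) ^ L" by (rule pw) (simp add: L_def)
    finally show "N0 + n < 2 ^ L" .
    have "so R < 2 ^ (2 * l + ls + K + 5)"
      using stream_length_nat[OF ls(1)] N0r rr nN by (simp add: N_def)
    also have "\<dots> \<le> (2::nat) ^ L" by (rule pw) (use ls1 in \<open>simp add: L_def\<close>)
    finally show "so R < 2 ^ L" .
  qed
  have lamL: "lam < L"
  proof -
    have "(2::nat) ^ lam < 2 ^ (l + 1)" using lam(2) r1 nN by simp
    then have "lam < l + 1" by (rule power_less_imp_less_exp[rotated]) simp
    then show ?thesis by (simp add: L_def)
  qed
  have params_small: "x < 2 ^ L" if "x \<in> set params" for x
  proof -
    have LL: "L < 2 ^ L" by (rule less_exp)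
    have RL: "R < 2 ^ L" using small(2) rr r1 by simp
    have "l \<le> L" "1 \<le> L" by (simp_all add: L_def)
    then have "l < 2 ^ L" "lam < 2 ^ L" "mode < 2 ^ L" using LL lamL samples(3) by linarith+
    moreover have "N0 < 2 ^ L" "BS < 2 ^ L" using RL by (auto simp: BS_def rr)
    ultimately show ?thesis using that LL RL by (auto simp: params_def)
  qed
  have "finds_occurrences (compile 0 (csa_program K)) w csa_bits T P
        ((7 * real K + 354 + 6 * CQ) * (real (length P) * (log 2 (real r) + real B) +
           real (card (occurrences T P)) * (real s * (log 2 (real r) + real B) + log 2 (real n))))"
    if P: "P \<noteq> []" "set P \<subseteq> {1..\<sigma>}" for P
  proof -
    interpret csa \<sigma> T n N xs K l lam L BS mode arr perm w s P
    proof unfold_locales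
      show "length (chunk_code K x) < w" if "x < 2 ^ L" for x
        using length_chunk_code_nat[OF K that] wL by linarith
    qed (use small params_small wL wD samples P in auto)
    obtain k where k: "r \<le> 2 ^ k" "2 ^ k < 2 * r" using power_two_bracket[OF r1(1)] by auto
    have kr: "real k \<le> log 2 (real r) + 1" using bracket_log[of k 1 r] k r1 by simp
    have "nb < R" by (rule nb_small)
    also have "R \<le> 2 ^ Suc k" using N0r rr k by simp
    finally have nbk: "nb < 2 ^ Suc k" .
    have lamw: "lam < w" using lamL wL by simp
    show ?thesis
    proof (rule ok_finds_occurrences[OF ok_mono[OF csa_program_ok[OF lamw nbk]] well_formed_csa_program], intro conjI)
      fix t st assume t: "t \<le> 7 * K + 200 + (length P + 1) * 6 + length P * (2 * query_time k + 63) +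
          card (occurrences T P) * report_time k \<and> correct st"
      show "distinct (snd st)" "set (snd st) = occurrences T P" using t by (auto simp: correct_def)
      have "real t \<le> real (7 * K + 200 + (length P + 1) * 6 + length P * (2 * query_time k + 63) +
          card (occurrences T P) * ((s + 1) * (2 * query_time k + 13) + 53))"
        using t unfolding report_time_def of_nat_le_iff by blast
      also have "\<dots> \<le> (7 * real K + 354 + 6 * CQ) * (real (length P) * (log 2 (real r) + real B) +
           real (card (occurrences T P)) * (real s * (log 2 (real r) + real B) + log 2 (real n)))"
        unfolding query_time_def CQ_def
        by (rule search_time_le[OF K B _ kr]) (use P r1 n1 s in \<open>auto simp: BS_def Suc_le_eq\<close>)
      finally show "real t \<le> (7 * real K + 354 + 6 * CQ) * (real (length P) * (log 2 (real r) + real B) +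
           real (card (occurrences T P)) * (real s * (log 2 (real r) + real B) + log 2 (real n)))" .
    qed
  qed
  then show ?thesis using space by (intro exI[of _ csa_bits]) (simp add: a_def g_def Lg_def)
  qed
qed

theorem theorem5p6:
  "\<exists>c_blk::real. \<forall>\<epsilon>::real. \<epsilon> > 0 \<longrightarrow> (\<exists>(c_one::real) (c_time::real) (c_word::real).
     \<forall>B::nat. B > 0 \<longrightarrow> (\<exists>prog :: instr list.
     \<forall>(\<sigma>::nat) (T::nat list) (n::nat) (r::nat) (s::nat) (w::nat).
       terminated_text \<sigma> T \<and> n = length T \<and> r = card (Psi_runs T) \<and> s \<ge> 1 \<and>
       real w \<ge> c_word * log 2 (real n + real \<sigma>) \<longrightarrow>
       (\<exists>D :: bool list.
          real (length D) \<le>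
            real r * ((2 * log 2 (real n / real r) + log 2 (real \<sigma>)) * (1 + \<epsilon>)
                      + c_blk * (log 2 (real n) / real B) + c_one)
            + min (real r) (2 * real_of_int \<lceil>real n / (real s + 1)\<rceil>) * (2 * log 2 (real n)) \<and>
          (\<forall>(P::nat list) (m::nat) (occ::nat).
             P \<noteq> [] \<and> set P \<subseteq> {1..\<sigma>} \<and> m = length P \<and> occ = card (occurrences T P) \<longrightarrow>
             finds_occurrences prog w D T P
               (c_time * (real m * (log 2 (real r) + real B)
                     + real occ * (real s * (log 2 (real r) + real B) + log 2 (real n))))))))"
proof (rule exI[of _ 12], intro allI impI, goal_cases)
  case (1 \<epsilon>)
  then have \<epsilon>: "\<epsilon> > 0" .
  define K where "K = nat \<lceil>26 / \<epsilon>\<rceil>"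
  have "26 / \<epsilon> \<le> real K" "K > 0" using \<epsilon> by (auto simp: K_def of_nat_ceiling)
  then have K: "K > 0" "26 / real K \<le> \<epsilon>" using \<epsilon> by (auto simp: field_simps)
  let ?one = "21 * real K + 312" and ?word = "24 * real K + 3 * \<epsilon> + 376"
    and ?time = "7 * real K + 354 + 6 * (306 + real K * (2 * real K + 57))"
  show ?case
  proof (rule exI[of _ ?one], rule exI[of _ ?time], rule exI[of _ ?word], intro allI impI,
      rule exI[of _ "compile 0 (csa_program K)"], intro allI impI, goal_cases)
    case (1 B \<sigma> T n r s w)
    then show ?case
      using csa_exists[OF K(1), of B \<sigma> T n r s \<epsilon> w] K(2) by blast
  qed
qed

end
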